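(* Let $X$ be a smooth projective curve over $\mathbb{C}$ of genus $g\ge2$, $\mathcal{D}$ a (possibly empty) set of distinct points of $X$, and $\mathcal{T}_{\mathcal{D}}=T_X\otimes\mathcal{O}_X(-\mathcal{D})$. Let $\mathcal{E}$ be a vector bundle on $X$ belonging to $\mathbb{U}_X(s;r_1,d_1;\dots;r_s,d_s)$, and let $\Phi:\mathcal{E}\to\mathcal{E}\otimes\mathcal{T}_{\mathcal{D}}$ be a nonzero co-Higgs field. Then the pair $(\mathcal{E},\Phi)$ is not simple.
   Context: $\mathbb{U}_X(s;r_1,d_1;\dots;r_s,d_s)$ is the set of vector bundles on $X$ whose Harder-Narasimhan filtration has length $s$ and successive quotients of ranks $r_i$ and degrees $d_i$, $d_1/r_1>\cdots>d_s/r_s$. On a curve a co-Higgs field is any morphism $\Phi:\mathcal{E}\to\mathcal{E}\otimes\mathcal{T}_{\mathcal{D}}$. Set $\operatorname{End}(\mathcal{E},\Phi):=\{f\in\operatorname{End}(\mathcal{E})\mid\hat f\circ\Phi=\Phi\circ f\}$, where $\hat f=f\otimes\mathrm{id}_{\mathcal{T}_{\mathcal{D}}}$. The pair $(\mathcal{E},\Phi)$ is simple if $\operatorname{End}(\mathcal{E},\Phi)\cong\mathbb{C}$ (only scalar multiples of the identity). *)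

theory Defs
  imports "HOL-Analysis.Analysis" "HOL-Algebra.Free_Abelian_Groups" "HOL-Algebra.Module"
    "HOL-Algebra.AbelCoset"
begin

section \<open>Projective varieties over the complex numbers\<close>

text \<open>
  A variety is a set of closed points of a complex projective space, a point being a line through
  the origin of the space of homogeneous coordinates. The coordinates are indexed by an arbitrary
  finite type, so the ambient projective space has arbitrary dimension.
\<close>

type_synonym 'n pt = "(complex ^ 'n) set"

definition projective_space :: "'n::finite pt set" where
  "projective_space = {range (\<lambda>a. a *s v) |v. v \<noteq> 0}"

definition homogeneous :: "nat \<Rightarrow> (complex ^ 'n::finite \<Rightarrow> complex) \<Rightarrow> bool" where
  "homogeneous d f \<longleftrightarrow>
     (\<exists>a. \<forall>v. f v = (\<Sum>m | (\<Sum>i\<in>UNIV. m i) = d. a m * (\<Prod>i\<in>UNIV. (v $ i) ^ m i)))"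

definition principal_open :: "(complex ^ 'n::finite \<Rightarrow> complex) \<Rightarrow> 'n pt set" where
  "principal_open f = {p \<in> projective_space. \<forall>v \<in> p - {0}. f v \<noteq> 0}"

definition zariski_projective :: "'n::finite pt topology" where
  "zariski_projective = topology_generated_by {principal_open f |d f. homogeneous d f}"

definition zariski :: "'n::finite pt set \<Rightarrow> 'n pt topology" where
  "zariski X = subtopology zariski_projective X"

definition opens :: "'n::finite pt set \<Rightarrow> 'n pt set set" where
  "opens X = {U. openin (zariski X) U}"

text \<open>
  Functions and morphisms are taken to be undefined outside their domain, so that equality of
  functions is equality on the domain and restriction is the library's restrict.
\<close>

definition regular :: "'n::finite pt set \<Rightarrow> 'n pt set \<Rightarrow> ('n pt \<Rightarrow> complex) set" where
  "regular X U = {h \<in> extensional U. \<forall>x\<in>U. \<exists>V\<in>opens X. x \<in> V \<and> V \<subseteq> U \<and>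
     (\<exists>d f g. homogeneous d f \<and> homogeneous d g \<and>
        (\<forall>p\<in>V. \<forall>v \<in> p - {0}. g v \<noteq> 0 \<and> h p = f v / g v))}"

definition regular_ring :: "'n::finite pt set \<Rightarrow> 'n pt set \<Rightarrow> ('n pt \<Rightarrow> complex) ring" where
  "regular_ring X U = \<lparr>carrier = regular X U,
     monoid.mult = (\<lambda>f g. \<lambda>x\<in>U. f x * g x), one = (\<lambda>x\<in>U. 1),
     zero = (\<lambda>x\<in>U. 0), add = (\<lambda>f g. \<lambda>x\<in>U. f x + g x)\<rparr>"

definition irreducible_closed :: "'p topology \<Rightarrow> 'p set \<Rightarrow> bool" where
  "irreducible_closed T Z \<longleftrightarrow> closedin T Z \<and> Z \<noteq> {} \<and>
     (\<forall>A B. closedin T A \<and> closedin T B \<and> Z \<subseteq> A \<union> B \<longrightarrow> Z \<subseteq> A \<or> Z \<subseteq> B)"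

definition has_chain :: "'p topology \<Rightarrow> nat \<Rightarrow> bool" where
  "has_chain T n \<longleftrightarrow> (\<exists>Z::nat \<Rightarrow> 'p set.
     (\<forall>i\<le>n. irreducible_closed T (Z i)) \<and> (\<forall>i<n. Z i \<subset> Z (Suc i)))"

definition krull_dimension :: "'p topology \<Rightarrow> nat \<Rightarrow> bool" where
  "krull_dimension T n \<longleftrightarrow> has_chain T n \<and> \<not> has_chain T (Suc n)"

text \<open>The germ of \<open>t\<close> at \<open>x\<close> generates the maximal ideal of the local ring at \<open>x\<close>.\<close>

definition local_parameter ::
    "'n::finite pt set \<Rightarrow> 'n pt \<Rightarrow> 'n pt set \<Rightarrow> ('n pt \<Rightarrow> complex) \<Rightarrow> bool" where
  "local_parameter X x U t \<longleftrightarrow> U \<in> opens X \<and> x \<in> U \<and> t \<in> regular X U \<and> t x = 0 \<and>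
     (\<forall>V\<in>opens X. \<forall>h\<in>regular X V. x \<in> V \<and> h x = 0 \<longrightarrow>
        (\<exists>W\<in>opens X. \<exists>k\<in>regular X W. x \<in> W \<and> W \<subseteq> U \<inter> V \<and> (\<forall>y\<in>W. h y = t y * k y)))"

text \<open>
  Smoothness of a curve means that all its local rings, which have Krull dimension 1, are regular,
  that is, that their maximal ideals can be generated by one element.
\<close>

definition smooth_projective_curve :: "'n::finite pt set \<Rightarrow> bool" where
  "smooth_projective_curve X \<longleftrightarrow>
     irreducible_closed zariski_projective X \<and> krull_dimension (zariski X) 1 \<and>
     (\<forall>x\<in>X. \<exists>U t. local_parameter X x U t)"

text \<open>
  On a smooth curve: \<open>h\<close>, a regular function on \<open>W\<close>, has order \<open>k\<close> at \<open>x\<close> as a rational function.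
  The point \<open>x\<close> need not belong to \<open>W\<close>.
\<close>

definition order_at ::
    "'n::finite pt set \<Rightarrow> 'n pt set \<Rightarrow> ('n pt \<Rightarrow> complex) \<Rightarrow> 'n pt \<Rightarrow> int \<Rightarrow> bool" where
  "order_at X W h x k \<longleftrightarrow> (\<exists>V t u. local_parameter X x V t \<and> u \<in> regular X V \<and>
     (\<forall>y\<in>V. u y \<noteq> 0) \<and> (\<forall>y \<in> V \<inter> W - {x}. h y = t y powi k * u y))"


section \<open>Sheaves of modules\<close>

record ('p, 'm) presheaf =
  sections :: "'p set \<Rightarrow> ('p \<Rightarrow> complex, 'm) module"
  restr :: "'p set \<Rightarrow> 'p set \<Rightarrow> 'm \<Rightarrow> 'm"

abbreviation Sec :: "('p, 'm) presheaf \<Rightarrow> 'p set \<Rightarrow> 'm set" where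
  "Sec F U \<equiv> carrier (sections F U)"

definition presheaf_of_modules :: "'n::finite pt set \<Rightarrow> ('n pt, 'm) presheaf \<Rightarrow> bool" where
  "presheaf_of_modules X F \<longleftrightarrow>
     (\<forall>U\<in>opens X. Module.module (regular_ring X U) (sections F U)) \<and>
     (\<forall>U\<in>opens X. \<forall>m\<in>Sec F U. restr F U U m = m) \<and>
     (\<forall>U\<in>opens X. \<forall>V\<in>opens X. V \<subseteq> U \<longrightarrow>
        (\<forall>m\<in>Sec F U. restr F U V m \<in> Sec F V) \<and>
        (\<forall>m\<in>Sec F U. \<forall>n\<in>Sec F U.
           restr F U V (m \<oplus>\<^bsub>sections F U\<^esub> n) = restr F U V m \<oplus>\<^bsub>sections F V\<^esub> restr F U V n) \<and>
        (\<forall>f\<in>regular X U. \<forall>m\<in>Sec F U.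
           restr F U V (f \<odot>\<^bsub>sections F U\<^esub> m) = restrict f V \<odot>\<^bsub>sections F V\<^esub> restr F U V m)) \<and>
     (\<forall>U\<in>opens X. \<forall>V\<in>opens X. \<forall>W\<in>opens X. W \<subseteq> V \<and> V \<subseteq> U \<longrightarrow>
        (\<forall>m\<in>Sec F U. restr F V W (restr F U V m) = restr F U W m))"

definition sheaf_of_modules :: "'n::finite pt set \<Rightarrow> ('n pt, 'm) presheaf \<Rightarrow> bool" where
  "sheaf_of_modules X F \<longleftrightarrow> presheaf_of_modules X F \<and>
     (\<forall>\<U> m. \<U> \<subseteq> opens X \<and> (\<forall>U\<in>\<U>. m U \<in> Sec F U) \<and>
        (\<forall>U\<in>\<U>. \<forall>V\<in>\<U>. restr F U (U \<inter> V) (m U) = restr F V (U \<inter> V) (m V)) \<longrightarrow>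
        (\<exists>!n. n \<in> Sec F (\<Union>\<U>) \<and> (\<forall>U\<in>\<U>. restr F (\<Union>\<U>) U n = m U)))"

text \<open>Morphisms of sheaves of modules from the restriction of \<open>F\<close> to \<open>U\<close> to that of \<open>G\<close>.\<close>

definition sheaf_homs ::
    "'n::finite pt set \<Rightarrow> 'n pt set \<Rightarrow> ('n pt, 'a) presheaf \<Rightarrow> ('n pt, 'b) presheaf \<Rightarrow>
     ('n pt set \<Rightarrow> 'a \<Rightarrow> 'b) set" where
  "sheaf_homs X U F G = {\<phi> \<in> \<Pi>\<^sub>E V \<in> {V \<in> opens X. V \<subseteq> U}. Sec F V \<rightarrow>\<^sub>E Sec G V.
     (\<forall>V\<in>opens X. V \<subseteq> U \<longrightarrow>
        (\<forall>m\<in>Sec F V. \<forall>n\<in>Sec F V.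
           \<phi> V (m \<oplus>\<^bsub>sections F V\<^esub> n) = \<phi> V m \<oplus>\<^bsub>sections G V\<^esub> \<phi> V n) \<and>
        (\<forall>f\<in>regular X V. \<forall>m\<in>Sec F V. \<phi> V (f \<odot>\<^bsub>sections F V\<^esub> m) = f \<odot>\<^bsub>sections G V\<^esub> \<phi> V m)) \<and>
     (\<forall>V\<in>opens X. \<forall>W\<in>opens X. W \<subseteq> V \<and> V \<subseteq> U \<longrightarrow>
        (\<forall>m\<in>Sec F V. \<phi> W (restr F V W m) = restr G V W (\<phi> V m)))}"

definition zero_hom ::
    "'n::finite pt set \<Rightarrow> ('n pt, 'a) presheaf \<Rightarrow> ('n pt, 'b) presheaf \<Rightarrow> 'n pt set \<Rightarrow> 'a \<Rightarrow> 'b" where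
  "zero_hom X F G = (\<lambda>U\<in>opens X. \<lambda>m\<in>Sec F U. \<zero>\<^bsub>sections G U\<^esub>)"

definition scalar_hom ::
    "'n::finite pt set \<Rightarrow> ('n pt, 'a) presheaf \<Rightarrow> complex \<Rightarrow> 'n pt set \<Rightarrow> 'a \<Rightarrow> 'a" where
  "scalar_hom X F a = (\<lambda>U\<in>opens X. \<lambda>m\<in>Sec F U. (\<lambda>x\<in>U. a) \<odot>\<^bsub>sections F U\<^esub> m)"

definition sub_presheaf ::
    "('p, 'm) presheaf \<Rightarrow> ('p set \<Rightarrow> 'm set) \<Rightarrow> ('p, 'm) presheaf" where
  "sub_presheaf F S = F\<lparr>sections := \<lambda>U. (sections F U)\<lparr>carrier := S U\<rparr>\<rparr>"

definition subsheaf ::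
    "'n::finite pt set \<Rightarrow> ('n pt, 'm) presheaf \<Rightarrow> ('n pt set \<Rightarrow> 'm set) \<Rightarrow> bool" where
  "subsheaf X F S \<longleftrightarrow> (\<forall>U\<in>opens X. submodule (S U) (regular_ring X U) (sections F U)) \<and>
     sheaf_of_modules X (sub_presheaf F S)"

text \<open>
  Modules here are the library's module records, whose ring multiplication and unit play no role.
\<close>

definition structure_sheaf :: "'n::finite pt set \<Rightarrow> ('n pt, 'n pt \<Rightarrow> complex) presheaf" where
  "structure_sheaf X = \<lparr>sections = (\<lambda>U. \<lparr>carrier = regular X U,
       monoid.mult = (\<lambda>f g. \<lambda>x\<in>U. f x * g x), one = (\<lambda>x\<in>U. 1),
       zero = (\<lambda>x\<in>U. 0), add = (\<lambda>f g. \<lambda>x\<in>U. f x + g x),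
       smult = (\<lambda>f g. \<lambda>x\<in>U. f x * g x)\<rparr>),
     restr = (\<lambda>U V f. restrict f V)\<rparr>"

text \<open>The ideal sheaf of a finite set \<open>D\<close> of points is \<open>\<O>(-D)\<close> for the reduced divisor \<open>D\<close>.\<close>

definition ideal_sheaf ::
    "'n::finite pt set \<Rightarrow> 'n pt set \<Rightarrow> ('n pt, 'n pt \<Rightarrow> complex) presheaf" where
  "ideal_sheaf X D = sub_presheaf (structure_sheaf X) (\<lambda>U. {f \<in> regular X U. \<forall>x \<in> D \<inter> U. f x = 0})"


section \<open>Sheafification\<close>

definition germ ::
    "'n::finite pt set \<Rightarrow> ('n pt, 'm) presheaf \<Rightarrow> 'n pt \<Rightarrow> 'n pt set \<Rightarrow> 'm \<Rightarrow> ('n pt set \<times> 'm) set" where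
  "germ X F x U m = {(V, n). V \<in> opens X \<and> x \<in> V \<and> n \<in> Sec F V \<and>
     (\<exists>W\<in>opens X. x \<in> W \<and> W \<subseteq> U \<inter> V \<and> restr F U W m = restr F V W n)}"

text \<open>
  Sections of the sheafification of \<open>F\<close> assign to each point an element of the stalk of \<open>F\<close> (an
  equivalence class of local sections) and are locally given by sections of \<open>F\<close>. Operations on
  germs are computed on representatives; the unions below are unions of equal sets.
\<close>

definition sheafify ::
    "'n::finite pt set \<Rightarrow> ('n pt, 'm) presheaf \<Rightarrow> ('n pt, 'n pt \<Rightarrow> ('n pt set \<times> 'm) set) presheaf" where
  "sheafify X F = \<lparr>sections = (\<lambda>U. \<lparr>carrier = {s \<in> extensional U. \<forall>x\<in>U. \<exists>V\<in>opens X. \<exists>m\<in>Sec F V.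
           x \<in> V \<and> V \<subseteq> U \<and> (\<forall>y\<in>V. s y = germ X F y V m)},
       monoid.mult = undefined, one = undefined,
       zero = (\<lambda>x\<in>U. germ X F x U \<zero>\<^bsub>sections F U\<^esub>),
       add = (\<lambda>s t. \<lambda>x\<in>U. \<Union>(V, m)\<in>s x. \<Union>(W, n)\<in>t x.
           germ X F x (V \<inter> W) (restr F V (V \<inter> W) m \<oplus>\<^bsub>sections F (V \<inter> W)\<^esub> restr F W (V \<inter> W) n)),
       smult = (\<lambda>f s. \<lambda>x\<in>U. \<Union>(V, m)\<in>s x.
           germ X F x (U \<inter> V) (restrict f (U \<inter> V) \<odot>\<^bsub>sections F (U \<inter> V)\<^esub> restr F V (U \<inter> V) m))\<rparr>),
     restr = (\<lambda>U V s. restrict s V)\<rparr>"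

definition sheafify_hom ::
    "'n::finite pt set \<Rightarrow> ('n pt, 'a) presheaf \<Rightarrow> ('n pt, 'b) presheaf \<Rightarrow> ('n pt set \<Rightarrow> 'a \<Rightarrow> 'b) \<Rightarrow>
     'n pt set \<Rightarrow> ('n pt \<Rightarrow> ('n pt set \<times> 'a) set) \<Rightarrow> ('n pt \<Rightarrow> ('n pt set \<times> 'b) set)" where
  "sheafify_hom X F G \<phi> = (\<lambda>U\<in>opens X. \<lambda>s\<in>Sec (sheafify X F) U. \<lambda>x\<in>U.
     \<Union>(V, m)\<in>s x. germ X G x V (\<phi> V m))"

definition quotient_presheaf ::
    "('p, 'm) presheaf \<Rightarrow> ('p set \<Rightarrow> 'm set) \<Rightarrow> ('p, 'm set) presheaf" where
  "quotient_presheaf F S = \<lparr>sections = (\<lambda>U. \<lparr>carrier = A_RCOSETS (sections F U) (S U),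
       monoid.mult = undefined, one = undefined, zero = S U,
       add = set_add (sections F U),
       smult = (\<lambda>f C. \<Union>m\<in>C. a_r_coset (sections F U) (S U) (f \<odot>\<^bsub>sections F U\<^esub> m))\<rparr>),
     restr = (\<lambda>U V C. \<Union>m\<in>C. a_r_coset (sections F V) (S V) (restr F U V m))\<rparr>"

definition quotient_sheaf ::
    "'n::finite pt set \<Rightarrow> ('n pt, 'm) presheaf \<Rightarrow> ('n pt set \<Rightarrow> 'm set) \<Rightarrow>
     ('n pt, 'n pt \<Rightarrow> ('n pt set \<times> 'm set) set) presheaf" where
  "quotient_sheaf X F S = sheafify X (quotient_presheaf F S)"


section \<open>Tensor products\<close>

text \<open>
  The tensor product of two modules is the free abelian group on pairs of elements modulo the
  subgroup generated by the biadditivity and balancing relations.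
\<close>

definition tensor_relations ::
    "('r, 'x) ring_scheme \<Rightarrow> ('r, 'a) module \<Rightarrow> ('r, 'b) module \<Rightarrow> ('a \<times> 'b \<Rightarrow>\<^sub>0 int) set" where
  "tensor_relations R M N =
     {frag_of (m \<oplus>\<^bsub>M\<^esub> m', n) - frag_of (m, n) - frag_of (m', n) |m m' n.
        m \<in> carrier M \<and> m' \<in> carrier M \<and> n \<in> carrier N} \<union>
     {frag_of (m, n \<oplus>\<^bsub>N\<^esub> n') - frag_of (m, n) - frag_of (m, n') |m n n'.
        m \<in> carrier M \<and> n \<in> carrier N \<and> n' \<in> carrier N} \<union>
     {frag_of (f \<odot>\<^bsub>M\<^esub> m, n) - frag_of (m, f \<odot>\<^bsub>N\<^esub> n) |f m n.
        f \<in> carrier R \<and> m \<in> carrier M \<and> n \<in> carrier N}"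

definition tensor_subgroup ::
    "('r, 'x) ring_scheme \<Rightarrow> ('r, 'a) module \<Rightarrow> ('r, 'b) module \<Rightarrow> ('a \<times> 'b \<Rightarrow>\<^sub>0 int) set" where
  "tensor_subgroup R M N =
     generate (free_Abelian_group (carrier M \<times> carrier N)) (tensor_relations R M N)"

definition tensor_class ::
    "('r, 'x) ring_scheme \<Rightarrow> ('r, 'a) module \<Rightarrow> ('r, 'b) module \<Rightarrow>
     ('a \<times> 'b \<Rightarrow>\<^sub>0 int) \<Rightarrow> ('a \<times> 'b \<Rightarrow>\<^sub>0 int) set" where
  "tensor_class R M N z =
     r_coset (free_Abelian_group (carrier M \<times> carrier N)) (tensor_subgroup R M N) z"

text \<open>
  The map \<open>f \<otimes> g\<close> into the tensor product of \<open>M\<close> and \<open>N\<close> over \<open>R\<close>, applied to a class of the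
  source tensor product.
\<close>

definition tensor_map ::
    "('r, 'x) ring_scheme \<Rightarrow> ('r, 'a) module \<Rightarrow> ('r, 'b) module \<Rightarrow> ('c \<Rightarrow> 'a) \<Rightarrow> ('d \<Rightarrow> 'b) \<Rightarrow>
     ('c \<times> 'd \<Rightarrow>\<^sub>0 int) set \<Rightarrow> ('a \<times> 'b \<Rightarrow>\<^sub>0 int) set" where
  "tensor_map R M N f g C =
     (\<Union>z\<in>C. tensor_class R M N (frag_extend (\<lambda>(m, n). frag_of (f m, g n)) z))"

definition tensor_module ::
    "('r, 'x) ring_scheme \<Rightarrow> ('r, 'a) module \<Rightarrow> ('r, 'b) module \<Rightarrow>
     ('r, ('a \<times> 'b \<Rightarrow>\<^sub>0 int) set) module" where
  "tensor_module R M N =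
     (let Q = free_Abelian_group (carrier M \<times> carrier N) Mod tensor_subgroup R M N
      in \<lparr>carrier = carrier Q, monoid.mult = undefined, one = undefined,
          zero = \<one>\<^bsub>Q\<^esub>, add = monoid.mult Q,
          smult = (\<lambda>f. tensor_map R M N (\<lambda>m. f \<odot>\<^bsub>M\<^esub> m) (\<lambda>n. n))\<rparr>)"

definition tensor_presheaf ::
    "'n::finite pt set \<Rightarrow> ('n pt, 'a) presheaf \<Rightarrow> ('n pt, 'b) presheaf \<Rightarrow>
     ('n pt, ('a \<times> 'b \<Rightarrow>\<^sub>0 int) set) presheaf" where
  "tensor_presheaf X F G =
     \<lparr>sections = (\<lambda>U. tensor_module (regular_ring X U) (sections F U) (sections G U)),
      restr = (\<lambda>U V. tensor_map (regular_ring X V) (sections F V) (sections G V)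
                 (restr F U V) (restr G U V))\<rparr>"

type_synonym ('n, 'a, 'b) tensor_section =
  "'n pt \<Rightarrow> ('n pt set \<times> ('a \<times> 'b \<Rightarrow>\<^sub>0 int) set) set"

definition tensor_sheaf ::
    "'n::finite pt set \<Rightarrow> ('n pt, 'a) presheaf \<Rightarrow> ('n pt, 'b) presheaf \<Rightarrow>
     ('n pt, ('n, 'a, 'b) tensor_section) presheaf" where
  "tensor_sheaf X F G = sheafify X (tensor_presheaf X F G)"

text \<open>The endomorphism \<open>f \<otimes> id\<close> of the tensor product of \<open>F\<close> and \<open>G\<close>.\<close>

definition tensor_id ::
    "'n::finite pt set \<Rightarrow> ('n pt, 'a) presheaf \<Rightarrow> ('n pt, 'b) presheaf \<Rightarrow> ('n pt set \<Rightarrow> 'a \<Rightarrow> 'a) \<Rightarrow>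
     'n pt set \<Rightarrow> ('n, 'a, 'b) tensor_section \<Rightarrow> ('n, 'a, 'b) tensor_section" where
  "tensor_id X F G f = sheafify_hom X (tensor_presheaf X F G) (tensor_presheaf X F G)
     (\<lambda>U. tensor_map (regular_ring X U) (sections F U) (sections G U) (f U) (\<lambda>n. n))"


section \<open>The tangent sheaf, the canonical sheaf and the genus\<close>

text \<open>
  Sheaves whose sections over \<open>U\<close> are families, indexed by the open subsets \<open>V\<close> of \<open>U\<close>, of maps
  from \<open>A V\<close> to the functions on \<open>V\<close>, with pointwise operations.
\<close>

definition operator_sheaf ::
    "'n::finite pt set \<Rightarrow> ('n pt set \<Rightarrow> 'a set) \<Rightarrow>
     ('n pt set \<Rightarrow> ('n pt set \<Rightarrow> 'a \<Rightarrow> 'n pt \<Rightarrow> complex) set) \<Rightarrow>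
     ('n pt, 'n pt set \<Rightarrow> 'a \<Rightarrow> 'n pt \<Rightarrow> complex) presheaf" where
  "operator_sheaf X A H =
     \<lparr>sections = (\<lambda>U. \<lparr>carrier = H U,
        monoid.mult = undefined, one = undefined,
        zero = (\<lambda>V\<in>{V \<in> opens X. V \<subseteq> U}. \<lambda>a\<in>A V. \<lambda>x\<in>V. 0),
        add = (\<lambda>\<phi> \<psi>. \<lambda>V\<in>{V \<in> opens X. V \<subseteq> U}. \<lambda>a\<in>A V. \<lambda>x\<in>V. \<phi> V a x + \<psi> V a x),
        smult = (\<lambda>f \<phi>. \<lambda>V\<in>{V \<in> opens X. V \<subseteq> U}. \<lambda>a\<in>A V. \<lambda>x\<in>V. f x * \<phi> V a x)\<rparr>),
      restr = (\<lambda>U V \<phi>. restrict \<phi> {W \<in> opens X. W \<subseteq> V})\<rparr>"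

definition derivations ::
    "'n::finite pt set \<Rightarrow> 'n pt set \<Rightarrow>
     ('n pt set \<Rightarrow> ('n pt \<Rightarrow> complex) \<Rightarrow> 'n pt \<Rightarrow> complex) set" where
  "derivations X U = {\<delta> \<in> \<Pi>\<^sub>E V \<in> {V \<in> opens X. V \<subseteq> U}. regular X V \<rightarrow>\<^sub>E regular X V.
     (\<forall>V\<in>opens X. V \<subseteq> U \<longrightarrow>
        (\<forall>f\<in>regular X V. \<forall>g\<in>regular X V. \<forall>x\<in>V.
           \<delta> V (\<lambda>y\<in>V. f y + g y) x = \<delta> V f x + \<delta> V g x \<and>
           \<delta> V (\<lambda>y\<in>V. f y * g y) x = f x * \<delta> V g x + g x * \<delta> V f x) \<and>
        (\<forall>a. \<forall>f\<in>regular X V. \<forall>x\<in>V. \<delta> V (\<lambda>y\<in>V. a * f y) x = a * \<delta> V f x)) \<and>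
     (\<forall>V\<in>opens X. \<forall>W\<in>opens X. W \<subseteq> V \<and> V \<subseteq> U \<longrightarrow>
        (\<forall>f\<in>regular X V. \<delta> W (restrict f W) = restrict (\<delta> V f) W))}"

definition tangent_sheaf ::
    "'n::finite pt set \<Rightarrow>
     ('n pt, 'n pt set \<Rightarrow> ('n pt \<Rightarrow> complex) \<Rightarrow> 'n pt \<Rightarrow> complex) presheaf" where
  "tangent_sheaf X = operator_sheaf X (regular X) (derivations X)"

definition dual_sheaf ::
    "'n::finite pt set \<Rightarrow> ('n pt, 'm) presheaf \<Rightarrow>
     ('n pt, 'n pt set \<Rightarrow> 'm \<Rightarrow> 'n pt \<Rightarrow> complex) presheaf" where
  "dual_sheaf X F = operator_sheaf X (Sec F) (\<lambda>U. sheaf_homs X U F (structure_sheaf X))"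

definition canonical_sheaf where
  "canonical_sheaf X = dual_sheaf X (tangent_sheaf X)"

text \<open>The complex vector space of global sections of \<open>F\<close> has dimension \<open>k\<close>.\<close>

definition h0 :: "'n::finite pt set \<Rightarrow> ('n pt, 'm) presheaf \<Rightarrow> nat \<Rightarrow> bool" where
  "h0 X F k \<longleftrightarrow> (\<exists>b. (\<forall>i<k. b i \<in> Sec F X) \<and>
     (\<forall>m\<in>Sec F X. \<exists>!a. a \<in> {..<k} \<rightarrow>\<^sub>E (UNIV :: complex set) \<and>
        m = (\<Oplus>\<^bsub>sections F X\<^esub>i\<in>{..<k}. (\<lambda>x\<in>X. a i) \<odot>\<^bsub>sections F X\<^esub> b i)))"

definition has_genus :: "'n::finite pt set \<Rightarrow> nat \<Rightarrow> bool" where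
  "has_genus X g \<longleftrightarrow> h0 X (canonical_sheaf X) g"

type_synonym ('n) log_vector_field =
  "('n, 'n pt set \<Rightarrow> ('n pt \<Rightarrow> complex) \<Rightarrow> 'n pt \<Rightarrow> complex, 'n pt \<Rightarrow> complex) tensor_section"

definition log_tangent_sheaf ::
    "'n::finite pt set \<Rightarrow> 'n pt set \<Rightarrow> ('n pt, 'n log_vector_field) presheaf" where
  "log_tangent_sheaf X D = tensor_sheaf X (tangent_sheaf X) (ideal_sheaf X D)"


section \<open>Vector bundles\<close>

definition frame ::
    "'n::finite pt set \<Rightarrow> ('n pt, 'm) presheaf \<Rightarrow> nat \<Rightarrow> 'n pt set \<Rightarrow> (nat \<Rightarrow> 'm) \<Rightarrow> bool" where
  "frame X F r U e \<longleftrightarrow> U \<in> opens X \<and> (\<forall>i<r. e i \<in> Sec F U) \<and>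
     (\<forall>V\<in>opens X. V \<subseteq> U \<longrightarrow> (\<forall>m\<in>Sec F V. \<exists>!a. a \<in> {..<r} \<rightarrow>\<^sub>E regular X V \<and>
        m = (\<Oplus>\<^bsub>sections F V\<^esub>i\<in>{..<r}. a i \<odot>\<^bsub>sections F V\<^esub> restr F U V (e i))))"

definition vector_bundle :: "'n::finite pt set \<Rightarrow> nat \<Rightarrow> ('n pt, 'm) presheaf \<Rightarrow> bool" where
  "vector_bundle X r F \<longleftrightarrow> sheaf_of_modules X F \<and> (\<forall>x\<in>X. \<exists>U e. x \<in> U \<and> frame X F r U e)"

definition leibniz_det :: "nat \<Rightarrow> (nat \<Rightarrow> nat \<Rightarrow> complex) \<Rightarrow> complex" where
  "leibniz_det r A = (\<Sum>p | p permutes {..<r}. of_int (sign p) * (\<Prod>i<r. A i (p i)))"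

text \<open>
  Sections \<open>s 0, \<dots>, s (r - 1)\<close> over \<open>U\<close> of a bundle of rank \<open>r\<close> define a rational section
  of its determinant line bundle, their wedge product. Its order at \<open>x\<close> is the order of the
  determinant of the matrix expressing the sections in a frame around \<open>x\<close>.
\<close>

definition wedge_order ::
    "'n::finite pt set \<Rightarrow> ('n pt, 'm) presheaf \<Rightarrow> nat \<Rightarrow> 'n pt set \<Rightarrow> (nat \<Rightarrow> 'm) \<Rightarrow>
     'n pt \<Rightarrow> int \<Rightarrow> bool" where
  "wedge_order X F r U s x k \<longleftrightarrow> (\<exists>V e A. x \<in> V \<and> frame X F r V e \<and>
     (\<forall>i<r. \<forall>j<r. A i j \<in> regular X (U \<inter> V)) \<and>
     (\<forall>j<r. restr F U (U \<inter> V) (s j) = (\<Oplus>\<^bsub>sections F (U \<inter> V)\<^esub>i\<in>{..<r}.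
        A i j \<odot>\<^bsub>sections F (U \<inter> V)\<^esub> restr F V (U \<inter> V) (e i))) \<and>
     order_at X (U \<inter> V) (\<lambda>y. leibniz_det r (\<lambda>i j. A i j y)) x k)"

text \<open>
  The degree of a vector bundle of rank \<open>r\<close> is the degree of its determinant line bundle, that is,
  of the divisor of any nonzero rational section. (The existence of orders at all points forces the
  sections \<open>s\<close> to be generically linearly independent.)
\<close>

definition has_degree :: "'n::finite pt set \<Rightarrow> ('n pt, 'm) presheaf \<Rightarrow> nat \<Rightarrow> int \<Rightarrow> bool" where
  "has_degree X F r d \<longleftrightarrow> (\<exists>U s ord. U \<in> opens X \<and> U \<noteq> {} \<and> (\<forall>j<r. s j \<in> Sec F U) \<and>
     (\<forall>x\<in>X. wedge_order X F r U s x (ord x)) \<and> finite {x\<in>X. ord x \<noteq> 0} \<and>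
     d = (\<Sum>x | x \<in> X \<and> ord x \<noteq> 0. ord x))"

text \<open>Slope-semistability of a bundle of positive rank \<open>r\<close> and degree \<open>d\<close>.\<close>

definition semistable :: "'n::finite pt set \<Rightarrow> ('n pt, 'm) presheaf \<Rightarrow> nat \<Rightarrow> int \<Rightarrow> bool" where
  "semistable X F r d \<longleftrightarrow> vector_bundle X r F \<and> 0 < r \<and> has_degree X F r d \<and>
     (\<forall>S r' d'. subsheaf X F S \<and> vector_bundle X r' (sub_presheaf F S) \<and> 0 < r' \<and>
        has_degree X (sub_presheaf F S) r' d' \<longrightarrow>
        real_of_int d' / real r' \<le> real_of_int d / real r)"

text \<open>
  Vector bundles whose Harder-Narasimhan filtration has length \<open>s\<close> and successive quotients that
  are semistable of ranks \<open>r 1, \<dots>, r s\<close> and degrees \<open>d 1, \<dots>, d s\<close>.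
\<close>

definition HN_bundles ::
    "'n::finite pt set \<Rightarrow> nat \<Rightarrow> (nat \<Rightarrow> nat) \<Rightarrow> (nat \<Rightarrow> int) \<Rightarrow> ('n pt, 'm) presheaf set" where
  "HN_bundles X s r d = {E. (\<exists>k. vector_bundle X k E) \<and>
     (\<exists>S. (\<forall>U\<in>opens X. S 0 U = {\<zero>\<^bsub>sections E U\<^esub>} \<and> S s U = Sec E U) \<and>
        (\<forall>i\<le>s. subsheaf X E (S i)) \<and>
        (\<forall>i<s. (\<forall>U\<in>opens X. S i U \<subseteq> S (Suc i) U) \<and>
           semistable X (quotient_sheaf X (sub_presheaf E (S (Suc i))) (S i)) (r (Suc i)) (d (Suc i))) \<and>
        (\<forall>i\<in>{1..<s}. real_of_int (d i) / real (r i) > real_of_int (d (Suc i)) / real (r (Suc i))))}"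


section \<open>Co-Higgs fields\<close>

definition cohiggs_fields where
  "cohiggs_fields X D E = sheaf_homs X X E (tensor_sheaf X E (log_tangent_sheaf X D))"

definition cohiggs_End where
  "cohiggs_End X D E \<Phi> = {f \<in> sheaf_homs X X E E. \<forall>U\<in>opens X. \<forall>m\<in>Sec E U.
     tensor_id X E (log_tangent_sheaf X D) f U (\<Phi> U m) = \<Phi> U (f U m)}"

text \<open>The scalar multiplications identify the complex numbers with the endomorphisms of the pair.\<close>

definition simple_pair where
  "simple_pair X D E \<Phi> \<longleftrightarrow> bij_betw (scalar_hom X E) UNIV (cohiggs_End X D E \<Phi>)"

end

theory Submission
  imports Defs
begin

text \<open>
  A differential \<open>w\<close> contracts logarithmic vector fields to functions and hence
  \<open>E \<otimes> T\<^sub>D\<close> to \<open>E\<close>; let \<open>c\<^sub>w\<close> be this contraction. As the sheaf \<open>T\<^sub>D\<close> has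
  rank one, the order in which two of its sections are contracted is irrelevant, and therefore
  \<open>c\<^sub>w \<circ> \<Phi>\<close> commutes with \<open>\<Phi>\<close>. If the pair were simple, \<open>c\<^sub>w \<circ> \<Phi>\<close> would be a scalar for
  every \<open>w\<close>; since the space of differentials has dimension at least two, some \<open>w \<noteq> 0\<close> would give
  \<open>c\<^sub>w \<circ> \<Phi> = 0\<close>. But \<open>c\<^sub>w\<close> is injective for \<open>w \<noteq> 0\<close>, because \<open>X\<close> is irreducible and \<open>E\<close> is
  locally free; so \<open>\<Phi> = 0\<close>.
\<close>

section \<open>Tensor products of modules\<close>


text \<open>Two points are hidden in the sketch. First, rank one is used without any frame of the
  tangent sheaf: a local parameter shows that the values of all derivations at a point are multiples
  of one number, and this yields \<open>w(\<delta>) \<epsilon> = w(\<epsilon>) \<delta>\<close>. Let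
  \<open>lam\<close> be the contraction of \<open>T\<^sub>D\<close> with \<open>w\<close> and
  \<open>c\<close> that of \<open>E \<otimes> T\<^sub>D\<close>. The symmetry becomes
  \<open>lam(s) Q = c(Q) \<otimes> s\<close>, and with \<open>f = c \<circ> \<Phi>\<close> and the
  linearity of \<Phi> it gives (f \<otimes> id)(m \<otimes> s) = c(\<Phi> m) \<otimes> s = lam(s)
  \<Phi>(m) = \<Phi>(lam(s) m) = \<Phi>(c(m \<otimes> s)). So f \<otimes> id = \<Phi> \<circ> c on
  all of E \<otimes> T, and commuting with \<Phi> is the restriction of this identity to the image
  of \<Phi>. Second, sections of a tensor sheaf are functions into germs of cosets in free abelian
  groups. Contractions are therefore obtained from two universal properties, that of the tensor
  product and that of sheafification, and are known only through their values on pure tensors.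
  Identities are reduced to neighbourhoods on which the sections are germs, and there to pure
  tensors by additivity.\<close>

definition pure_tensor ::
    "('r, 'x) ring_scheme \<Rightarrow> ('r, 'a) module \<Rightarrow> ('r, 'b) module \<Rightarrow> 'a \<Rightarrow> 'b \<Rightarrow> ('a \<times> 'b \<Rightarrow>\<^sub>0 int) set" where
  "pure_tensor R M N m n = tensor_class R M N (frag_of (m, n))"

text \<open>Three maps share this shape: multiplication by a scalar, restriction of sections, and an
  endomorphism of a presheaf over one open set. Only restriction changes the ring of scalars, and
  \<open>\<rho>\<close> is there for it. The conditions are what carries the tensor relations of the
  source into those of the target.\<close>

definition semilinear where
  "semilinear R M R' M' \<rho> f \<longleftrightarrow>
     (\<forall>m\<in>carrier M. f m \<in> carrier M') \<and>
     (\<forall>m\<in>carrier M. \<forall>n\<in>carrier M. f (m \<oplus>\<^bsub>M\<^esub> n) = f m \<oplus>\<^bsub>M'\<^esub> f n) \<and>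
     (\<forall>a\<in>carrier R. \<rho> a \<in> carrier R') \<and>
     (\<forall>a\<in>carrier R. \<forall>m\<in>carrier M. f (a \<odot>\<^bsub>M\<^esub> m) = \<rho> a \<odot>\<^bsub>M'\<^esub> f m)"

lemma semilinear_id: "semilinear R M R M (\<lambda>a. a) (\<lambda>m. m)"
  by (simp add: semilinear_def)

text \<open>Commutativity of \<open>R\<close> enters here: it makes multiplication by
  \<open>a\<close> linear, so that the scalar action on a tensor product becomes an instance of
  functoriality.\<close>

lemma (in module) semilinear_smult:
  assumes "a \<in> carrier R"
  shows "semilinear R M R M (\<lambda>b. b) (\<lambda>m. a \<odot>\<^bsub>M\<^esub> m)"
  using assms unfolding semilinear_def
  by (metis R.m_comm smult_assoc1 smult_closed smult_r_distr)

lemma tensor_relations_cases [consumes 1, case_names left right balanced]: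
  assumes "z \<in> tensor_relations R M N"
  obtains (left) m m' n where "z = frag_of (m \<oplus>\<^bsub>M\<^esub> m', n) - frag_of (m, n) - frag_of (m', n)"
      "m \<in> carrier M" "m' \<in> carrier M" "n \<in> carrier N"
    | (right) m n n' where "z = frag_of (m, n \<oplus>\<^bsub>N\<^esub> n') - frag_of (m, n) - frag_of (m, n')"
      "m \<in> carrier M" "n \<in> carrier N" "n' \<in> carrier N"
    | (balanced) a m n where "z = frag_of (a \<odot>\<^bsub>M\<^esub> m, n) - frag_of (m, a \<odot>\<^bsub>N\<^esub> n)"
      "a \<in> carrier R" "m \<in> carrier M" "n \<in> carrier N"
  using assms unfolding tensor_relations_def by (elim UnE CollectE exE conjE) metis+

locale tensor = M: module R M + N: module R N
  for R :: "('r, 'x) ring_scheme" (structure) and M :: "('r, 'a) module" and N :: "('r, 'b) module"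
begin

abbreviation free where "free \<equiv> free_Abelian_group (carrier M \<times> carrier N)"
abbreviation TM where "TM \<equiv> tensor_module R M N"
abbreviation cls where "cls \<equiv> tensor_class R M N"
abbreviation pt (infixl \<open>\<bowtie>\<close> 75) where "m \<bowtie> n \<equiv> pure_tensor R M N m n"

lemma tensor_relations_subset: "tensor_relations R M N \<subseteq> carrier free"
  unfolding tensor_relations_def by (auto dest!: subsetD[OF keys_diff])

lemma subgroup_tensor: "subgroup (tensor_subgroup R M N) free"
  unfolding tensor_subgroup_def
  by (rule group.generate_is_subgroup[OF group_free_Abelian_group tensor_relations_subset])

lemma tensor_relation_mem: "z \<in> tensor_relations R M N \<Longrightarrow> z \<in> tensor_subgroup R M N"
  unfolding tensor_subgroup_def by (rule generate.incl)

lemma normal_tensor: "tensor_subgroup R M N \<lhd> free"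
  by (simp add: comm_group.normal_iff_subgroup[OF abelian_free_Abelian_group] subgroup_tensor)

lemma cls_eq_iff:
  assumes "z \<in> carrier free" "w \<in> carrier free"
  shows "cls z = cls w \<longleftrightarrow> z - w \<in> tensor_subgroup R M N"
proof -
  interpret F: comm_group free by (rule abelian_free_Abelian_group)
  have inv: "z \<otimes>\<^bsub>free\<^esub> inv\<^bsub>free\<^esub> w = z - w" using assms by simp
  show ?thesis
  proof
    assume "cls z = cls w"
    then have "z \<in> r_coset free (tensor_subgroup R M N) w"
      unfolding tensor_class_def
      using F.rcos_self[OF assms(1) subgroup_tensor] by simp
    then obtain h where "h \<in> tensor_subgroup R M N" "z = h + w" by (auto simp: r_coset_def)
    then show "z - w \<in> tensor_subgroup R M N" by simp
  next
    assume a: "z - w \<in> tensor_subgroup R M N"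
    have "z \<in> r_coset free (tensor_subgroup R M N) w"
      unfolding r_coset_def using a by (auto intro!: bexI[of _ "z - w"])
    then show "cls z = cls w"
      unfolding tensor_class_def
      using F.repr_independence[OF _ _ subgroup_tensor] assms(2) by metis
  qed
qed

lemma carrier_TM: "carrier TM = cls ` carrier free"
  by (simp add: tensor_module_def Let_def carrier_FactGroup tensor_class_def)

lemma cls_closed: "z \<in> carrier free \<Longrightarrow> cls z \<in> carrier TM"
  by (auto simp: carrier_TM)

lemma add_cls:
  assumes "z \<in> carrier free" "w \<in> carrier free"
  shows "cls z \<oplus>\<^bsub>TM\<^esub> cls w = cls (z + w)"
  using normal.rcos_sum[OF normal_tensor assms]
  by (simp add: tensor_module_def Let_def tensor_class_def)

lemma zero_cls: "\<zero>\<^bsub>TM\<^esub> = cls 0"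
proof -
  have "r_coset free (tensor_subgroup R M N) \<one>\<^bsub>free\<^esub> = tensor_subgroup R M N"
    using group.coset_mult_one[OF group_free_Abelian_group] subgroup.subset[OF subgroup_tensor] by blast
  then show ?thesis by (simp add: tensor_module_def Let_def tensor_class_def)
qed

lemma abelian_group_TM: "abelian_group TM"
proof (rule abelian_groupI)
  show "\<zero>\<^bsub>TM\<^esub> \<in> carrier TM" by (auto simp: zero_cls carrier_TM)
next
  fix x y z assume "x \<in> carrier TM" "y \<in> carrier TM" "z \<in> carrier TM"
  then obtain a b c where [simp]: "x = cls a" "y = cls b" "z = cls c"
    and k: "a \<in> carrier free" "b \<in> carrier free" "c \<in> carrier free"
    unfolding carrier_TM by blast
  have ab: "a + b \<in> carrier free" "b + c \<in> carrier free" 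
    using k by (auto dest!: subsetD[OF keys_add])
  show "x \<oplus>\<^bsub>TM\<^esub> y \<in> carrier TM" using k ab by (simp add: add_cls cls_closed)
  show "(x \<oplus>\<^bsub>TM\<^esub> y) \<oplus>\<^bsub>TM\<^esub> z = x \<oplus>\<^bsub>TM\<^esub> (y \<oplus>\<^bsub>TM\<^esub> z)"
    using k ab by (simp add: add_cls add.assoc del: carrier_free_Abelian_group_iff)
  show "x \<oplus>\<^bsub>TM\<^esub> y = y \<oplus>\<^bsub>TM\<^esub> x" using k by (simp add: add_cls add.commute)
  show "\<zero>\<^bsub>TM\<^esub> \<oplus>\<^bsub>TM\<^esub> x = x" using k by (simp add: add_cls zero_cls)
  show "\<exists>y\<in>carrier TM. y \<oplus>\<^bsub>TM\<^esub> x = \<zero>\<^bsub>TM\<^esub>"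
    by (rule bexI[of _ "cls (- a)"]) (use k in \<open>simp_all add: add_cls zero_cls cls_closed\<close>)
qed

lemma pure_closed [simp, intro]: "\<lbrakk>m \<in> carrier M; n \<in> carrier N\<rbrakk> \<Longrightarrow> m \<bowtie> n \<in> carrier TM"
  unfolding pure_tensor_def by (rule cls_closed) simp

lemma pure_add_left:
  assumes "m \<in> carrier M" "m' \<in> carrier M" "n \<in> carrier N"
  shows "(m \<oplus>\<^bsub>M\<^esub> m') \<bowtie> n = m \<bowtie> n \<oplus>\<^bsub>TM\<^esub> m' \<bowtie> n"
proof -
  have c: "frag_of (m, n) + frag_of (m', n) \<in> carrier free" using assms
    by (auto dest!: subsetD[OF keys_add])
  have "frag_of (m \<oplus>\<^bsub>M\<^esub> m', n) - frag_of (m, n) - frag_of (m', n) \<in> tensor_relations R M N"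
    unfolding tensor_relations_def using assms by blast
  from tensor_relation_mem[OF this] show ?thesis
    unfolding pure_tensor_def using assms c by (simp add: add_cls cls_eq_iff diff_diff_eq)
qed

lemma pure_add_right:
  assumes "m \<in> carrier M" "n \<in> carrier N" "n' \<in> carrier N"
  shows "m \<bowtie> (n \<oplus>\<^bsub>N\<^esub> n') = m \<bowtie> n \<oplus>\<^bsub>TM\<^esub> m \<bowtie> n'"
proof -
  have c: "frag_of (m, n) + frag_of (m, n') \<in> carrier free" using assms
    by (auto dest!: subsetD[OF keys_add])
  have "frag_of (m, n \<oplus>\<^bsub>N\<^esub> n') - frag_of (m, n) - frag_of (m, n') \<in> tensor_relations R M N"
    unfolding tensor_relations_def using assms by blast
  from tensor_relation_mem[OF this] show ?thesis
    unfolding pure_tensor_def using assms c by (simp add: add_cls cls_eq_iff diff_diff_eq)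
qed

lemma pure_balanced:
  assumes "a \<in> carrier R" "m \<in> carrier M" "n \<in> carrier N"
  shows "(a \<odot>\<^bsub>M\<^esub> m) \<bowtie> n = m \<bowtie> (a \<odot>\<^bsub>N\<^esub> n)"
proof -
  have "frag_of (a \<odot>\<^bsub>M\<^esub> m, n) - frag_of (m, a \<odot>\<^bsub>N\<^esub> n) \<in> tensor_relations R M N"
    unfolding tensor_relations_def using assms by blast
  from tensor_relation_mem[OF this] show ?thesis
    unfolding pure_tensor_def using assms by (simp add: cls_eq_iff)
qed

text \<open>The element is its own double, hence zero by cancellation.\<close>

lemma pure_zero_right:
  assumes "m \<in> carrier M" shows "m \<bowtie> \<zero>\<^bsub>N\<^esub> = \<zero>\<^bsub>TM\<^esub>"
proof -
  interpret T: abelian_group TM by (rule abelian_group_TM)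
  have "m \<bowtie> \<zero>\<^bsub>N\<^esub> \<oplus>\<^bsub>TM\<^esub> m \<bowtie> \<zero>\<^bsub>N\<^esub> = m \<bowtie> \<zero>\<^bsub>N\<^esub>"
    using pure_add_right[OF assms N.zero_closed N.zero_closed] by simp
  then show ?thesis using assms by (metis T.add.r_cancel_one' N.zero_closed pure_closed)
qed

lemma pure_zero_left:
  assumes "n \<in> carrier N" shows "\<zero>\<^bsub>M\<^esub> \<bowtie> n = \<zero>\<^bsub>TM\<^esub>"
proof -
  interpret T: abelian_group TM by (rule abelian_group_TM)
  have "\<zero>\<^bsub>M\<^esub> \<bowtie> n \<oplus>\<^bsub>TM\<^esub> \<zero>\<^bsub>M\<^esub> \<bowtie> n = \<zero>\<^bsub>M\<^esub> \<bowtie> n"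
    using pure_add_left[OF M.zero_closed M.zero_closed assms] by simp
  then show ?thesis using assms by (metis T.add.r_cancel_one' M.zero_closed pure_closed)
qed

text \<open>Elements of the free group are integer combinations of pairs. This absorbs the signs, so
  that sums of pure tensors suffice in \<open>tensor_induct\<close>.\<close>

lemma pure_minus_left:
  assumes "m \<in> carrier M" "n \<in> carrier N"
  shows "cls (- frag_of (m, n)) = (\<ominus>\<^bsub>M\<^esub> m) \<bowtie> n"
proof -
  interpret T: abelian_group TM by (rule abelian_group_TM)
  have 1: "cls (- frag_of (m, n)) \<in> carrier TM" "cls (- frag_of (m, n)) \<oplus>\<^bsub>TM\<^esub> m \<bowtie> n = \<zero>\<^bsub>TM\<^esub>"
    using assms by (simp_all add: cls_closed pure_tensor_def add_cls zero_cls)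
  have 2: "(\<ominus>\<^bsub>M\<^esub> m) \<bowtie> n \<oplus>\<^bsub>TM\<^esub> m \<bowtie> n = \<zero>\<^bsub>TM\<^esub>"
    using assms pure_add_left[of "\<ominus>\<^bsub>M\<^esub> m" m n] by (simp add: M.M.l_neg pure_zero_left)
  show ?thesis using 1 2 assms by (metis T.minus_equality M.M.a_inv_closed pure_closed)
qed

text \<open>Zero and negatives need no cases of their own: zero is m \<otimes> 0, and the negative
  of a pure tensor is pure. Additive identities on tensors are reduced to pure tensors by this
  rule.\<close>

lemma tensor_induct [consumes 1, case_names pure add]:
  assumes "C \<in> carrier TM"
    and pure: "\<And>m n. \<lbrakk>m \<in> carrier M; n \<in> carrier N\<rbrakk> \<Longrightarrow> P (m \<bowtie> n)"
    and add: "\<And>C C'. \<lbrakk>C \<in> carrier TM; C' \<in> carrier TM; P C; P C'\<rbrakk> \<Longrightarrow> P (C \<oplus>\<^bsub>TM\<^esub> C')"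
  shows "P C"
proof -
  obtain z where z: "z \<in> carrier free" "C = cls z" using assms(1) by (auto simp: carrier_TM)
  have "Poly_Mapping.keys z \<subseteq> carrier M \<times> carrier N" using z by simp
  \<comment> \<open>Induction on the free group proceeds through differences, while the hypothesis
    \<open>add\<close> offers only sums. Carrying \<open>- z\<close> along turns a difference into a
    sum.\<close>
  then have "P (cls z) \<and> P (cls (- z))"
  proof (induction rule: free_Abelian_group_induct[consumes 1, case_names zero diff one])
    case zero
    then show ?case using pure[OF M.zero_closed N.zero_closed] 
      by (simp add: pure_zero_right zero_cls)
  next
    case (diff x y)
    have "cls (x + - y) = cls x \<oplus>\<^bsub>TM\<^esub> cls (- y)" "cls (- x + y) = cls (- x) \<oplus>\<^bsub>TM\<^esub> cls y"
      using diff by (simp_all add: add_cls)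
    then show ?case using diff add[of "cls x" "cls (- y)"] add[of "cls (- x)" "cls y"]
      by (simp add: cls_closed)
  next
    case (one a)
    then obtain m n where [simp]: "a = (m, n)" and mn: "m \<in> carrier M" "n \<in> carrier N" by auto
    show ?case using pure[OF mn] pure[of "\<ominus>\<^bsub>M\<^esub> m" n] mn pure_minus_left[OF mn]
      by (simp add: pure_tensor_def)
  qed
  with z show ?thesis by simp
qed

text \<open>The universal property for balanced biadditive maps: the extension of
  \<open>\<beta>\<close> to the free group kills the three kinds of relations, hence the subgroup
  they generate. The target is a mere abelian group; linearity over the ring is added in
  \<open>tensor_lift_presheaf_exists\<close>.\<close>

lemma tensor_lift_exists:
  assumes "abelian_group P"
    and closed: "\<And>m n. \<lbrakk>m \<in> carrier M; n \<in> carrier N\<rbrakk> \<Longrightarrow> \<beta> m n \<in> carrier P"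
    and add_left: "\<And>m m' n. \<lbrakk>m \<in> carrier M; m' \<in> carrier M; n \<in> carrier N\<rbrakk> \<Longrightarrow>
       \<beta> (m \<oplus>\<^bsub>M\<^esub> m') n = \<beta> m n \<oplus>\<^bsub>P\<^esub> \<beta> m' n"
    and add_right: "\<And>m n n'. \<lbrakk>m \<in> carrier M; n \<in> carrier N; n' \<in> carrier N\<rbrakk> \<Longrightarrow>
       \<beta> m (n \<oplus>\<^bsub>N\<^esub> n') = \<beta> m n \<oplus>\<^bsub>P\<^esub> \<beta> m n'"
    and bal: "\<And>a m n. \<lbrakk>a \<in> carrier R; m \<in> carrier M; n \<in> carrier N\<rbrakk> \<Longrightarrow>
       \<beta> (a \<odot>\<^bsub>M\<^esub> m) n = \<beta> m (a \<odot>\<^bsub>N\<^esub> n)"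
  shows "\<exists>h. (\<forall>C\<in>carrier TM. h C \<in> carrier P) \<and>
     (\<forall>C\<in>carrier TM. \<forall>C'\<in>carrier TM. h (C \<oplus>\<^bsub>TM\<^esub> C') = h C \<oplus>\<^bsub>P\<^esub> h C') \<and>
     (\<forall>m\<in>carrier M. \<forall>n\<in>carrier N. h (m \<bowtie> n) = \<beta> m n)"
proof -
  interpret P: abelian_group P by fact
  interpret F: comm_group free by (rule abelian_free_Abelian_group)
  obtain h where hom: "h \<in> hom free (add_monoid P)"
    and h: "\<And>x. x \<in> carrier M \<times> carrier N \<Longrightarrow> h (frag_of x) = (\<lambda>(m, n). \<beta> m n) x"
    by (rule comm_group.free_Abelian_group_universal[OF P.a_comm_group,
        where f = "\<lambda>(m, n). \<beta> m n" and S = "carrier M \<times> carrier N"])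
      (use closed in auto)
  interpret H: group_hom free "add_monoid P" h
    using hom by (simp add: group_hom_def group_hom_axioms_def P.a_group)
  have h_diff: "h (x - y) = h x \<ominus>\<^bsub>P\<^esub> h y" if "x \<in> carrier free" "y \<in> carrier free" for x y
  proof -
    have "h (x \<otimes>\<^bsub>free\<^esub> inv\<^bsub>free\<^esub> y) = h x \<ominus>\<^bsub>P\<^esub> h y"
      using that H.hom_mult[of x "inv\<^bsub>free\<^esub> y"] H.hom_inv[of y] F.inv_closed[of y]
      by (simp add: a_minus_def a_inv_def del: inv_free_Abelian_group)
    then show ?thesis using that by simp
  qed
  have cl: "x - y \<in> carrier free" if "x \<in> carrier free" "y \<in> carrier free" for x y
    using that by (auto dest!: subsetD[OF keys_diff])
  have rel: "h z = \<zero>\<^bsub>P\<^esub>" if "z \<in> tensor_relations R M N" for z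
    using that
  proof (cases rule: tensor_relations_cases)
      case (left m m' n)
      then have "h z = (\<beta> m n \<oplus>\<^bsub>P\<^esub> \<beta> m' n) \<ominus>\<^bsub>P\<^esub> \<beta> m n \<ominus>\<^bsub>P\<^esub> \<beta> m' n"
        by (simp add: h_diff cl h add_left del: carrier_free_Abelian_group_iff)
      also have "\<dots> = \<zero>\<^bsub>P\<^esub>" using left closed
        by (simp add: a_minus_def P.a_ac P.r_neg P.r_neg1 P.r_neg2)
      finally show ?thesis .
    next
      case (right m n n')
      then have "h z = (\<beta> m n \<oplus>\<^bsub>P\<^esub> \<beta> m n') \<ominus>\<^bsub>P\<^esub> \<beta> m n \<ominus>\<^bsub>P\<^esub> \<beta> m n'"
        by (simp add: h_diff cl h add_right del: carrier_free_Abelian_group_iff)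
      also have "\<dots> = \<zero>\<^bsub>P\<^esub>" using right closed
        by (simp add: a_minus_def P.a_ac P.r_neg P.r_neg1 P.r_neg2)
      finally show ?thesis .
    next
      case (balanced a m n)
      then show ?thesis using closed
        by (simp add: h_diff h bal P.r_neg a_minus_def)
  qed
  \<comment> \<open>A kernel is a subgroup, so it contains the generated subgroup as soon as it
    contains the relations.\<close>
  have ker: "h z = \<zero>\<^bsub>P\<^esub>" if "z \<in> tensor_subgroup R M N" for z
  proof -
    have "tensor_relations R M N \<subseteq> kernel free (add_monoid P) h"
      using rel subsetD[OF tensor_relations_subset]
      by (auto simp: kernel_def simp del: carrier_free_Abelian_group_iff)
    then have "tensor_subgroup R M N \<subseteq> kernel free (add_monoid P) h"
      unfolding tensor_subgroup_def
      using F.generate_subgroup_incl[OF _ H.subgroup_kernel] by blast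
    with that show ?thesis by (auto simp: kernel_def)
  qed
  have eq: "h x = h y" if "x \<in> carrier free" "y \<in> carrier free" "cls x = cls y" for x y
  proof -
    have "h x \<ominus>\<^bsub>P\<^esub> h y = \<zero>\<^bsub>P\<^esub>" using that ker[of "x - y"] cls_eq_iff h_diff by simp
    then show ?thesis using H.hom_closed[OF that(1)] H.hom_closed[OF that(2)]
      by (metis P.minus_equality P.minus_minus P.a_inv_closed a_minus_def monoid.select_convs(1) partial_object.select_convs(1))
  qed
  \<comment> \<open>A class is a coset; the map on classes evaluates \<open>h\<close> at a chosen
    representative, and \<open>eq\<close> makes the choice immaterial.\<close>
  define k where "k C = h (SOME z. z \<in> carrier free \<and> cls z = C)" for C
  have k: "k (cls z) = h z" if "z \<in> carrier free" for z
  proof -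
    have "(SOME w. w \<in> carrier free \<and> cls w = cls z) \<in> carrier free \<and>
          cls (SOME w. w \<in> carrier free \<and> cls w = cls z) = cls z"
      using that by (intro someI[of "\<lambda>w. w \<in> carrier free \<and> cls w = cls z"]) simp
    then show ?thesis unfolding k_def using eq that by blast
  qed
  show ?thesis
  proof (intro exI[of _ k] conjI ballI)
    fix C assume "C \<in> carrier TM"
    then obtain z where z: "z \<in> carrier free" "C = cls z" by (auto simp: carrier_TM)
    then show "k C \<in> carrier P" using k H.hom_closed[OF z(1)] by simp
    fix C' assume "C' \<in> carrier TM"
    then obtain z' where z': "z' \<in> carrier free" "C' = cls z'" by (auto simp: carrier_TM)
    have "z + z' \<in> carrier free" using z(1) z'(1) by (auto dest!: subsetD[OF keys_add])
    then show "k (C \<oplus>\<^bsub>TM\<^esub> C') = k C \<oplus>\<^bsub>P\<^esub> k C'"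
      using z z' k H.hom_mult[OF z(1) z'(1)] by (simp add: add_cls)
  next
    fix m n assume "m \<in> carrier M" "n \<in> carrier N"
    then show "k (m \<bowtie> n) = \<beta> m n" unfolding pure_tensor_def by (simp add: k h)
  qed
qed

end

section \<open>Functoriality of the tensor product\<close>

locale tensor_mor = S: tensor R M N + T: tensor R' M' N'
  for R :: "('r, 'x) ring_scheme" and M :: "('r, 'a) module" and N :: "('r, 'b) module"
    and R' :: "('r1, 'x1) ring_scheme" and M' :: "('r1, 'a1) module" and N' :: "('r1, 'b1) module" +
  fixes \<rho> f g
  assumes f: "semilinear R M R' M' \<rho> f" and g: "semilinear R N R' N' \<rho> g"
begin

abbreviation ext where "ext \<equiv> frag_extend (\<lambda>(m, n). frag_of (f m, g n))"

lemma ext_closed: "z \<in> carrier S.free \<Longrightarrow> ext z \<in> carrier T.free"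
proof -
  assume "z \<in> carrier S.free"
  then have "Poly_Mapping.keys z \<subseteq> carrier M \<times> carrier N" by simp
  then have "Poly_Mapping.keys (ext z) \<subseteq> carrier M' \<times> carrier N'"
  proof (induction rule: free_Abelian_group_induct[consumes 1, case_names zero diff one])
    case (diff x y)
    then show ?case by (auto simp: frag_extend_diff dest!: subsetD[OF keys_diff])
  next
    case (one a)
    then show ?case using f g by (auto simp: semilinear_def)
  qed simp
  then show ?thesis by simp
qed

lemma ext_relations: "z \<in> tensor_relations R M N \<Longrightarrow> ext z \<in> tensor_relations R' M' N'"
proof -
  assume "z \<in> tensor_relations R M N"
  then show ?thesis
  proof (cases rule: tensor_relations_cases)
    case (left m m' n)
    then have "ext z = frag_of (f m \<oplus>\<^bsub>M'\<^esub> f m', g n) - frag_of (f m, g n) - frag_of (f m', g n)"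
      using f by (simp add: frag_extend_diff semilinear_def)
    moreover have "f m \<in> carrier M'" "f m' \<in> carrier M'" "g n \<in> carrier N'"
      using left f g by (simp_all add: semilinear_def)
    ultimately show ?thesis unfolding tensor_relations_def by blast
  next
    case (right m n n')
    then have "ext z = frag_of (f m, g n \<oplus>\<^bsub>N'\<^esub> g n') - frag_of (f m, g n) - frag_of (f m, g n')"
      using g by (simp add: frag_extend_diff semilinear_def)
    moreover have "f m \<in> carrier M'" "g n \<in> carrier N'" "g n' \<in> carrier N'"
      using right f g by (simp_all add: semilinear_def)
    ultimately show ?thesis unfolding tensor_relations_def by blast
  next
    case (balanced a m n)
    then have "ext z = frag_of (\<rho> a \<odot>\<^bsub>M'\<^esub> f m, g n) - frag_of (f m, \<rho> a \<odot>\<^bsub>N'\<^esub> g n)"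
      using f g by (simp add: frag_extend_diff semilinear_def)
    moreover have "\<rho> a \<in> carrier R'" "f m \<in> carrier M'" "g n \<in> carrier N'"
      using balanced f g by (simp_all add: semilinear_def)
    ultimately show ?thesis unfolding tensor_relations_def by blast
  qed
qed

lemma ext_subgroup:
  assumes "z \<in> tensor_subgroup R M N" shows "ext z \<in> tensor_subgroup R' M' N'"
proof -
  have "z \<in> generate S.free (tensor_relations R M N)" using assms by (simp add: tensor_subgroup_def)
  then show ?thesis
  proof (induction rule: generate.induct)
    case one
    then show ?case using subgroup.one_closed[OF T.subgroup_tensor] by simp
  next
    case (incl h)
    then show ?case using ext_relations T.tensor_relation_mem by blast
  next
    case (inv h)
    then have h: "h \<in> carrier S.free" "ext h \<in> tensor_subgroup R' M' N'"
      using S.tensor_relations_subset ext_relations T.tensor_relation_mem by blast+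
    then have "inv\<^bsub>T.free\<^esub> (ext h) \<in> tensor_subgroup R' M' N'"
      using subgroup.m_inv_closed[OF T.subgroup_tensor] by blast
    then show ?case using h ext_closed[OF h(1)] by (simp add: frag_extend_minus)
  next
    case (eng h1 h2)
    then show ?case using subgroup.m_closed[OF T.subgroup_tensor] by (simp add: frag_extend_add)
  qed
qed

text \<open>\<open>tensor_map\<close> is a union over all representatives of a class. Since
  \<open>ext\<close> sends the relation subgroup into the relation subgroup, all members of this
  union are the same class, and the union is nonempty because \<open>z\<close> lies in its own
  class.\<close>

lemma map_cls:
  assumes "z \<in> carrier S.free"
  shows "tensor_map R' M' N' f g (S.cls z) = T.cls (ext z)"
proof -
  interpret F: comm_group S.free by (rule abelian_free_Abelian_group)
  have "T.cls (ext w) = T.cls (ext z)" if "w \<in> S.cls z" for w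
  proof -
    have w: "w \<in> carrier S.free"
      using that F.r_coset_subset_G[OF subgroup.subset[OF S.subgroup_tensor] assms]
      unfolding tensor_class_def by blast
    have "w - z \<in> tensor_subgroup R M N" using that by (auto simp: tensor_class_def r_coset_def)
    then have "ext w - ext z \<in> tensor_subgroup R' M' N'"
      using ext_subgroup by (metis frag_extend_diff)
    then show ?thesis using T.cls_eq_iff[OF ext_closed[OF w] ext_closed[OF assms]] by simp
  qed
  moreover have "z \<in> S.cls z"
    unfolding tensor_class_def by (rule F.rcos_self[OF assms S.subgroup_tensor])
  ultimately show ?thesis unfolding tensor_map_def by blast
qed

lemma map_pure:
  assumes "m \<in> carrier M" "n \<in> carrier N"
  shows "tensor_map R' M' N' f g (pure_tensor R M N m n) = pure_tensor R' M' N' (f m) (g n)"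
  unfolding pure_tensor_def using assms by (simp add: map_cls)

lemma map_closed:
  assumes "C \<in> carrier S.TM" shows "tensor_map R' M' N' f g C \<in> carrier T.TM"
  using assms ext_closed by (auto simp: S.carrier_TM map_cls T.cls_closed simp del: carrier_free_Abelian_group_iff)

lemma map_add:
  assumes "C \<in> carrier S.TM" "D \<in> carrier S.TM"
  shows "tensor_map R' M' N' f g (C \<oplus>\<^bsub>S.TM\<^esub> D) =
    tensor_map R' M' N' f g C \<oplus>\<^bsub>T.TM\<^esub> tensor_map R' M' N' f g D"
proof -
  obtain z w where z: "z \<in> carrier S.free" "C = S.cls z" and w: "w \<in> carrier S.free" "D = S.cls w"
    using assms by (auto simp: S.carrier_TM)
  have "z + w \<in> carrier S.free" using z(1) w(1) by (auto dest!: subsetD[OF keys_add])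
  then show ?thesis using z w ext_closed[OF z(1)] ext_closed[OF w(1)]
    by (simp add: S.add_cls T.add_cls map_cls frag_extend_add)
qed

end

context tensor
begin

text \<open>The scalar action in \<open>tensor_module\<close> is by definition the map induced by
  multiplication on the left factor, so closure and additivity are inherited from
  \<open>tensor_mor\<close>.\<close>

lemma smult_mor:
  assumes "a \<in> carrier R"
  shows "tensor_mor R M N R M N (\<lambda>b. b) (\<lambda>m. a \<odot>\<^bsub>M\<^esub> m) (\<lambda>n. n)"
  by (intro tensor_mor.intro tensor_axioms tensor_mor_axioms.intro M.semilinear_smult assms semilinear_id)

lemma smult_TM: "a \<odot>\<^bsub>TM\<^esub> C = tensor_map R M N (\<lambda>m. a \<odot>\<^bsub>M\<^esub> m) (\<lambda>n. n) C"
  by (simp add: tensor_module_def Let_def)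

lemma smult_pure:
  "\<lbrakk>a \<in> carrier R; m \<in> carrier M; n \<in> carrier N\<rbrakk> \<Longrightarrow> a \<odot>\<^bsub>TM\<^esub> (m \<bowtie> n) = (a \<odot>\<^bsub>M\<^esub> m) \<bowtie> n"
  unfolding smult_TM by (rule tensor_mor.map_pure[OF smult_mor])

lemma smult_TM_closed: "\<lbrakk>a \<in> carrier R; C \<in> carrier TM\<rbrakk> \<Longrightarrow> a \<odot>\<^bsub>TM\<^esub> C \<in> carrier TM"
  unfolding smult_TM by (rule tensor_mor.map_closed[OF smult_mor])

lemma smult_TM_add: "\<lbrakk>a \<in> carrier R; C \<in> carrier TM; D \<in> carrier TM\<rbrakk> \<Longrightarrow>
   a \<odot>\<^bsub>TM\<^esub> (C \<oplus>\<^bsub>TM\<^esub> D) = a \<odot>\<^bsub>TM\<^esub> C \<oplus>\<^bsub>TM\<^esub> a \<odot>\<^bsub>TM\<^esub> D"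
  unfolding smult_TM by (rule tensor_mor.map_add[OF smult_mor])

sublocale TM: module R TM
proof (rule moduleI)
  interpret T: abelian_group TM by (rule abelian_group_TM)
  show "cring R" by (rule M.R.is_cring)
  show "abelian_group TM" by (rule abelian_group_TM)
  show "\<one> \<odot>\<^bsub>TM\<^esub> C = C" if "C \<in> carrier TM" for C using that
    by (induction rule: tensor_induct) (simp_all add: smult_pure smult_TM_add)
  fix a C assume a: "a \<in> carrier R" and C: "C \<in> carrier TM"
  show "a \<odot>\<^bsub>TM\<^esub> C \<in> carrier TM" using smult_TM_closed[OF a C] .
  fix b assume b: "b \<in> carrier R"
  show "(a \<oplus> b) \<odot>\<^bsub>TM\<^esub> C = a \<odot>\<^bsub>TM\<^esub> C \<oplus>\<^bsub>TM\<^esub> b \<odot>\<^bsub>TM\<^esub> C" using C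
  proof (induction rule: tensor_induct)
    case (pure m n)
    then show ?case using a b by (simp add: smult_pure M.smult_l_distr pure_add_left)
  next
    case (add C C')
    then show ?case using a b by (simp add: smult_TM_add smult_TM_closed T.a_ac)
  qed
  show "(a \<otimes> b) \<odot>\<^bsub>TM\<^esub> C = a \<odot>\<^bsub>TM\<^esub> (b \<odot>\<^bsub>TM\<^esub> C)" using C
  proof (induction rule: tensor_induct)
    case (pure m n)
    then show ?case using a b by (simp add: smult_pure M.smult_assoc1)
  next
    case (add C C')
    then show ?case using a b by (simp add: smult_TM_add smult_TM_closed)
  qed
  fix D assume "D \<in> carrier TM"
  then show "a \<odot>\<^bsub>TM\<^esub> (C \<oplus>\<^bsub>TM\<^esub> D) = a \<odot>\<^bsub>TM\<^esub> C \<oplus>\<^bsub>TM\<^esub> a \<odot>\<^bsub>TM\<^esub> D"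
    using smult_TM_add[OF a C] by blast
qed

end


section \<open>Open sets, restriction of regular functions, presheaves of modules and their
  morphisms\<close>

lemma opens_Int: "\<lbrakk>U \<in> opens X; V \<in> opens X\<rbrakk> \<Longrightarrow> U \<inter> V \<in> opens X"
  by (auto simp: opens_def)

lemma opens_subset: "U \<in> opens X \<Longrightarrow> U \<subseteq> X"
  unfolding opens_def zariski_def using openin_subset by fastforce

lemma regular_restrict:
  assumes h: "h \<in> regular X U" and V: "V \<in> opens X" "V \<subseteq> U"
  shows "restrict h V \<in> regular X V"
  unfolding regular_def
proof (intro CollectI conjI ballI)
  fix x assume "x \<in> V"
  with h V obtain W d f g where W: "W \<in> opens X" "x \<in> W" "W \<subseteq> U" "homogeneous d f" "homogeneous d g"
     "\<forall>p\<in>W. \<forall>v \<in> p - {0}. g v \<noteq> 0 \<and> h p = f v / g v"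
    unfolding regular_def by (auto dest!: bspec[of U _ x])
  then show "\<exists>Va\<in>opens X. x \<in> Va \<and> Va \<subseteq> V \<and> (\<exists>d f g. homogeneous d f \<and> homogeneous d g \<and>
        (\<forall>p\<in>Va. \<forall>v \<in> p - {0}. g v \<noteq> 0 \<and> restrict h V p = f v / g v))"
    using \<open>x \<in> V\<close> V by (intro bexI[of _ "W \<inter> V"] conjI exI[of _ d] exI[of _ f] exI[of _ g]) (auto simp: opens_Int)
qed simp

text \<open>Unlike the elements of \<open>sheaf_homs\<close>, these families are unconstrained off
  the open sets and off the sections. Maps obtained by choice or by composition therefore qualify at
  once, and \<open>ext_mor\<close> turns them into elements of \<open>sheaf_homs\<close>.\<close>

definition presheaf_mor ::
    "'n::finite pt set \<Rightarrow> ('n pt, 'a) presheaf \<Rightarrow> ('n pt, 'b) presheaf \<Rightarrow>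
     ('n pt set \<Rightarrow> 'a \<Rightarrow> 'b) \<Rightarrow> bool" where
  "presheaf_mor X F G \<phi> \<longleftrightarrow> (\<forall>U\<in>opens X.
     semilinear (regular_ring X U) (sections F U) (regular_ring X U) (sections G U) (\<lambda>a. a) (\<phi> U) \<and>
     (\<forall>V\<in>opens X. V \<subseteq> U \<longrightarrow> (\<forall>m\<in>Sec F U. \<phi> V (restr F U V m) = restr G U V (\<phi> U m))))"

lemma carrier_regular_ring [simp]: "carrier (regular_ring X U) = regular X U"
  by (simp add: regular_ring_def)

lemma sheaf_homs_presheaf_mor:
  assumes "\<phi> \<in> sheaf_homs X X F G" shows "presheaf_mor X F G \<phi>"
proof -
  have V: "V \<in> opens X \<and> V \<subseteq> X \<longleftrightarrow> V \<in> opens X" for V using opens_subset by blast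
  have cl: "\<phi> U m \<in> Sec G U" if "U \<in> opens X" "m \<in> Sec F U" for U m
    using assms that V[of U] by (auto simp: sheaf_homs_def PiE_iff)
  show ?thesis
    using assms cl unfolding sheaf_homs_def presheaf_mor_def semilinear_def carrier_regular_ring
    by (simp add: opens_subset)
qed

definition ext_mor ::
    "'n::finite pt set \<Rightarrow> ('n pt, 'a) presheaf \<Rightarrow> ('n pt set \<Rightarrow> 'a \<Rightarrow> 'b) \<Rightarrow>
     'n pt set \<Rightarrow> 'a \<Rightarrow> 'b" where
  "ext_mor X F \<phi> = (\<lambda>U\<in>opens X. \<lambda>m\<in>Sec F U. \<phi> U m)"

locale presheaf_mod =
  fixes X :: "'n::finite pt set" and F :: "('n pt, 'm) presheaf"
  assumes presheaf: "presheaf_of_modules X F"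
begin

lemma module: "U \<in> opens X \<Longrightarrow> module (regular_ring X U) (sections F U)"
  using presheaf by (simp add: presheaf_of_modules_def)

lemma abelian_group: "U \<in> opens X \<Longrightarrow> abelian_group (sections F U)"
  using module by (simp add: module_def)

lemma cring: "U \<in> opens X \<Longrightarrow> cring (regular_ring X U)"
  using module by (simp add: module_def)

lemma restr_closed [simp, intro]:
  "\<lbrakk>U \<in> opens X; V \<in> opens X; V \<subseteq> U; m \<in> Sec F U\<rbrakk> \<Longrightarrow> restr F U V m \<in> Sec F V"
  using presheaf by (auto simp: presheaf_of_modules_def)

lemma restr_add:
  "\<lbrakk>U \<in> opens X; V \<in> opens X; V \<subseteq> U; m \<in> Sec F U; n \<in> Sec F U\<rbrakk> \<Longrightarrow>
   restr F U V (m \<oplus>\<^bsub>sections F U\<^esub> n) = restr F U V m \<oplus>\<^bsub>sections F V\<^esub> restr F U V n"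
  using presheaf by (auto simp: presheaf_of_modules_def)

lemma restr_smult:
  "\<lbrakk>U \<in> opens X; V \<in> opens X; V \<subseteq> U; f \<in> regular X U; m \<in> Sec F U\<rbrakk> \<Longrightarrow>
   restr F U V (f \<odot>\<^bsub>sections F U\<^esub> m) = restrict f V \<odot>\<^bsub>sections F V\<^esub> restr F U V m"
  using presheaf by (auto simp: presheaf_of_modules_def)

lemma restr_self: "\<lbrakk>U \<in> opens X; m \<in> Sec F U\<rbrakk> \<Longrightarrow> restr F U U m = m"
  using presheaf by (auto simp: presheaf_of_modules_def)

lemma restr_restr:
  "\<lbrakk>U \<in> opens X; V \<in> opens X; W \<in> opens X; W \<subseteq> V; V \<subseteq> U; m \<in> Sec F U\<rbrakk> \<Longrightarrow>
   restr F V W (restr F U V m) = restr F U W m"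
  using presheaf by (auto simp: presheaf_of_modules_def)

lemma semilinear_restr:
  assumes "U \<in> opens X" "V \<in> opens X" "V \<subseteq> U"
  shows "semilinear (regular_ring X U) (sections F U) (regular_ring X V) (sections F V)
     (\<lambda>f. restrict f V) (restr F U V)"
  using assms regular_restrict[OF _ assms(2,3)] by (simp add: semilinear_def restr_add restr_smult)

lemma restr_zero:
  assumes "U \<in> opens X" "V \<in> opens X" "V \<subseteq> U"
  shows "restr F U V \<zero>\<^bsub>sections F U\<^esub> = \<zero>\<^bsub>sections F V\<^esub>"
proof -
  interpret MU: abelian_group "sections F U" using abelian_group assms by blast
  interpret MV: abelian_group "sections F V" using abelian_group assms by blast
  have "restr F U V \<zero>\<^bsub>sections F U\<^esub> \<oplus>\<^bsub>sections F V\<^esub> restr F U V \<zero>\<^bsub>sections F U\<^esub> = restr F U V \<zero>\<^bsub>sections F U\<^esub>"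
    using restr_add[OF assms MU.zero_closed MU.zero_closed] by simp
  then show ?thesis using restr_closed[OF assms MU.zero_closed] by (metis MV.add.r_cancel_one')
qed

end

section \<open>Tensor products of presheaves\<close>

lemma sections_tensor_presheaf [simp]:
  "sections (tensor_presheaf X F G) U = tensor_module (regular_ring X U) (sections F U) (sections G U)"
  by (simp add: tensor_presheaf_def)

locale tensor_presheaves = F: presheaf_mod X F + G: presheaf_mod X G
  for X :: "'n::finite pt set" and F :: "('n pt, 'a) presheaf" and G :: "('n pt, 'b) presheaf"
begin

abbreviation pure_sec where
  "pure_sec U \<equiv> pure_tensor (regular_ring X U) (sections F U) (sections G U)"

lemma tensor_sections: "U \<in> opens X \<Longrightarrow> tensor (regular_ring X U) (sections F U) (sections G U)"
  by (intro tensor.intro F.module G.module)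

lemma tensor_restr:
  assumes "U \<in> opens X" "V \<in> opens X" "V \<subseteq> U"
  shows "tensor_mor (regular_ring X U) (sections F U) (sections G U)
     (regular_ring X V) (sections F V) (sections G V) (\<lambda>f. restrict f V) (restr F U V) (restr G U V)"
  using assms by (intro tensor_mor.intro tensor_sections tensor_mor_axioms.intro
      F.semilinear_restr G.semilinear_restr)

lemma restr_tensor: "restr (tensor_presheaf X F G) U V =
    tensor_map (regular_ring X V) (sections F V) (sections G V) (restr F U V) (restr G U V)"
  by (simp add: tensor_presheaf_def)

lemma restr_pure:
  "\<lbrakk>U \<in> opens X; V \<in> opens X; V \<subseteq> U; m \<in> Sec F U; n \<in> Sec G U\<rbrakk> \<Longrightarrow>
   restr (tensor_presheaf X F G) U V (pure_sec U m n) = pure_sec V (restr F U V m) (restr G U V n)"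
  unfolding restr_tensor by (rule tensor_mor.map_pure[OF tensor_restr])

lemma tensor_restr_closed:
  "\<lbrakk>U \<in> opens X; V \<in> opens X; V \<subseteq> U; C \<in> Sec (tensor_presheaf X F G) U\<rbrakk> \<Longrightarrow>
   restr (tensor_presheaf X F G) U V C \<in> Sec (tensor_presheaf X F G) V"
  unfolding restr_tensor sections_tensor_presheaf by (rule tensor_mor.map_closed[OF tensor_restr])

lemma tensor_restr_add:
  "\<lbrakk>U \<in> opens X; V \<in> opens X; V \<subseteq> U; C \<in> Sec (tensor_presheaf X F G) U; D \<in> Sec (tensor_presheaf X F G) U\<rbrakk> \<Longrightarrow>
   restr (tensor_presheaf X F G) U V (C \<oplus>\<^bsub>sections (tensor_presheaf X F G) U\<^esub> D) =
   restr (tensor_presheaf X F G) U V C \<oplus>\<^bsub>sections (tensor_presheaf X F G) V\<^esub> restr (tensor_presheaf X F G) U V D"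
  unfolding restr_tensor sections_tensor_presheaf by (rule tensor_mor.map_add[OF tensor_restr])

text \<open>Every axiom to be checked is additive in the tensor, so pure tensors suffice, and on
  these restriction acts on the two factors separately.\<close>

lemma presheaf_tensor: "presheaf_of_modules X (tensor_presheaf X F G)" (is "presheaf_of_modules X ?T")
  unfolding presheaf_of_modules_def
proof (intro conjI ballI impI)
  fix U assume U: "U \<in> opens X"
  interpret TU: tensor "regular_ring X U" "sections F U" "sections G U" by (rule tensor_sections[OF U])
  show "module (regular_ring X U) (sections ?T U)" using TU.TM.module_axioms by simp
  show "restr ?T U U C = C" if "C \<in> Sec ?T U" for C
    using that unfolding sections_tensor_presheaf
  proof (induction rule: TU.tensor_induct)
    case (pure m n)
    then show ?case using U by (simp add: restr_pure F.restr_self G.restr_self)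
  next
    case (add C C')
    then show ?case using U tensor_restr_add[OF U U, of C C'] by simp
  qed
  fix V assume V: "V \<in> opens X"
  {
    assume VU: "V \<subseteq> U"
    interpret TV: tensor "regular_ring X V" "sections F V" "sections G V" by (rule tensor_sections[OF V])
    show "restr ?T U V C \<in> Sec ?T V" if "C \<in> Sec ?T U" for C
      using tensor_restr_closed U V VU that by blast
    show "restr ?T U V (C \<oplus>\<^bsub>sections ?T U\<^esub> D) = restr ?T U V C \<oplus>\<^bsub>sections ?T V\<^esub> restr ?T U V D"
      if "C \<in> Sec ?T U" "D \<in> Sec ?T U" for C D
      using tensor_restr_add U V VU that by blast
    show "restr ?T U V (f \<odot>\<^bsub>sections ?T U\<^esub> C) = restrict f V \<odot>\<^bsub>sections ?T V\<^esub> restr ?T U V C"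
      if f: "f \<in> regular X U" and "C \<in> Sec ?T U" for f C
      using that(2) unfolding sections_tensor_presheaf
    proof (induction rule: TU.tensor_induct)
      case (pure m n)
      then show ?case using f U V VU regular_restrict[OF f V VU] TU.M.smult_closed[of f m]
        by (simp add: restr_pure F.restr_smult TU.smult_pure TV.smult_pure del: restrict_apply)
    next
      case (add C C')
      then show ?case
        using tensor_restr_add[OF U V VU, of C C'] tensor_restr_add[OF U V VU, of "f \<odot>\<^bsub>TU.TM\<^esub> C" "f \<odot>\<^bsub>TU.TM\<^esub> C'"]
          tensor_restr_closed[OF U V VU, of C] tensor_restr_closed[OF U V VU, of C'] regular_restrict[OF f V VU]
        by (simp add: TU.TM.smult_r_distr TV.TM.smult_r_distr f del: restrict_apply)
    qed
  }
  fix W C assume W: "W \<in> opens X" and WVU: "W \<subseteq> V \<and> V \<subseteq> U" and "C \<in> Sec ?T U"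
  then have "C \<in> carrier TU.TM" by simp
  then show "restr ?T V W (restr ?T U V C) = restr ?T U W C"
  proof (induction rule: TU.tensor_induct)
    case (pure m n)
    have "W \<subseteq> U" using WVU by auto
    then show ?case using pure U V W WVU F.restr_closed[of U V m] G.restr_closed[of U V n]
      by (simp add: restr_pure F.restr_restr G.restr_restr)
  next
    case (add C C')
    have UW: "W \<subseteq> U" and WV: "W \<subseteq> V" and VU: "V \<subseteq> U" using WVU by auto
    show ?case using add tensor_restr_add[OF U V VU, of C C'] tensor_restr_add[OF U W UW, of C C']
        tensor_restr_closed[OF U V VU, of C] tensor_restr_closed[OF U V VU, of C']
        tensor_restr_add[OF V W WV, of "restr ?T U V C" "restr ?T U V C'"]
      by simp
  qed
qed

text \<open>Linearity in both arguments implies balancing, so a lift can be chosen over each open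
  set independently. The choices are compatible with restriction all the same, because a lift is
  determined by its values on pure tensors and \<open>\<beta>\<close> is natural there.\<close>

lemma tensor_lift_presheaf_exists:
  assumes "presheaf_of_modules X P"
    and closed: "\<And>U m n. \<lbrakk>U \<in> opens X; m \<in> Sec F U; n \<in> Sec G U\<rbrakk> \<Longrightarrow> \<beta> U m n \<in> Sec P U"
    and add_left: "\<And>U m m' n. \<lbrakk>U \<in> opens X; m \<in> Sec F U; m' \<in> Sec F U; n \<in> Sec G U\<rbrakk> \<Longrightarrow>
       \<beta> U (m \<oplus>\<^bsub>sections F U\<^esub> m') n = \<beta> U m n \<oplus>\<^bsub>sections P U\<^esub> \<beta> U m' n"
    and add_right: "\<And>U m n n'. \<lbrakk>U \<in> opens X; m \<in> Sec F U; n \<in> Sec G U; n' \<in> Sec G U\<rbrakk> \<Longrightarrow>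
       \<beta> U m (n \<oplus>\<^bsub>sections G U\<^esub> n') = \<beta> U m n \<oplus>\<^bsub>sections P U\<^esub> \<beta> U m n'"
    and smult_left: "\<And>U a m n. \<lbrakk>U \<in> opens X; a \<in> regular X U; m \<in> Sec F U; n \<in> Sec G U\<rbrakk> \<Longrightarrow>
       \<beta> U (a \<odot>\<^bsub>sections F U\<^esub> m) n = a \<odot>\<^bsub>sections P U\<^esub> \<beta> U m n"
    and smult_right: "\<And>U a m n. \<lbrakk>U \<in> opens X; a \<in> regular X U; m \<in> Sec F U; n \<in> Sec G U\<rbrakk> \<Longrightarrow>
       \<beta> U m (a \<odot>\<^bsub>sections G U\<^esub> n) = a \<odot>\<^bsub>sections P U\<^esub> \<beta> U m n"
    and natural: "\<And>U V m n. \<lbrakk>U \<in> opens X; V \<in> opens X; V \<subseteq> U; m \<in> Sec F U; n \<in> Sec G U\<rbrakk> \<Longrightarrow>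
       restr P U V (\<beta> U m n) = \<beta> V (restr F U V m) (restr G U V n)"
  shows "\<exists>h. presheaf_mor X (tensor_presheaf X F G) P h \<and>
     (\<forall>U\<in>opens X. \<forall>m\<in>Sec F U. \<forall>n\<in>Sec G U. h U (pure_sec U m n) = \<beta> U m n)"
proof -
  let ?T = "tensor_presheaf X F G"
  interpret P: presheaf_mod X P by unfold_locales fact
  have "\<exists>h. (\<forall>C\<in>Sec ?T U. h C \<in> Sec P U) \<and>
     (\<forall>C\<in>Sec ?T U. \<forall>C'\<in>Sec ?T U. h (C \<oplus>\<^bsub>sections ?T U\<^esub> C') = h C \<oplus>\<^bsub>sections P U\<^esub> h C') \<and>
     (\<forall>m\<in>Sec F U. \<forall>n\<in>Sec G U. h (pure_sec U m n) = \<beta> U m n)" if "U \<in> opens X" for U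
    unfolding sections_tensor_presheaf
    by (rule tensor.tensor_lift_exists[OF tensor_sections[OF that] P.abelian_group[OF that]])
      (simp_all add: that closed add_left add_right smult_left smult_right)
  then obtain h where h: "U \<in> opens X \<Longrightarrow> (\<forall>C\<in>Sec ?T U. h U C \<in> Sec P U) \<and>
     (\<forall>C\<in>Sec ?T U. \<forall>C'\<in>Sec ?T U. h U (C \<oplus>\<^bsub>sections ?T U\<^esub> C') = h U C \<oplus>\<^bsub>sections P U\<^esub> h U C') \<and>
     (\<forall>m\<in>Sec F U. \<forall>n\<in>Sec G U. h U (pure_sec U m n) = \<beta> U m n)" for U
    by metis
  show ?thesis
  proof (intro exI[of _ h] conjI ballI)
    show "presheaf_mor X ?T P h"
      unfolding presheaf_mor_def
    proof (intro ballI conjI impI)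
      fix U assume U: "U \<in> opens X"
      interpret TU: tensor "regular_ring X U" "sections F U" "sections G U" by (rule tensor_sections[OF U])
      interpret PU: module "regular_ring X U" "sections P U" by (rule P.module[OF U])
      have sm: "h U (a \<odot>\<^bsub>TU.TM\<^esub> C) = a \<odot>\<^bsub>sections P U\<^esub> h U C" if a: "a \<in> regular X U" and "C \<in> carrier TU.TM" for a C
        using that(2)
      proof (induction rule: TU.tensor_induct)
        case (pure m n)
        then show ?case using a h[OF U] U TU.M.smult_closed[of a m]
          by (simp add: TU.smult_pure smult_left)
      next
        case (add C C')
        then show ?case using a h[OF U] TU.TM.smult_closed[of a C] TU.TM.smult_closed[of a C']
          by (simp add: TU.TM.smult_r_distr PU.smult_r_distr)
      qed
      show "semilinear (regular_ring X U) (sections ?T U) (regular_ring X U) (sections P U) (\<lambda>a. a) (h U)"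
        using h[OF U] sm by (simp add: semilinear_def)
      fix V C assume V: "V \<in> opens X" and VU: "V \<subseteq> U" and "C \<in> Sec ?T U"
      then have "C \<in> carrier TU.TM" by simp
      then show "h V (restr ?T U V C) = restr P U V (h U C)"
      proof (induction rule: TU.tensor_induct)
        case (pure m n)
        then show ?case using h[OF U] h[OF V] U V VU by (simp add: restr_pure natural)
      next
        case (add C C')
        then show ?case using h[OF U] h[OF V] tensor_restr_add[OF U V VU, of C C']
          tensor_restr_closed[OF U V VU, of C] tensor_restr_closed[OF U V VU, of C']
          P.restr_add[OF U V VU, of "h U C" "h U C'"] by simp
      qed
    qed
  qed (use h in blast)
qed

abbreviation map_left where
  "map_left f \<equiv> \<lambda>U. tensor_map (regular_ring X U) (sections F U) (sections G U) (f U) (\<lambda>n. n)"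

text \<open>The family \<open>map_left f\<close> is the presheaf map f \<otimes> id whose
  sheafification is \<open>tensor_id\<close>. Naturality and linearity are again read off on pure
  tensors.\<close>

lemma
  assumes "presheaf_mor X F F f"
  shows map_left_mor: "presheaf_mor X (tensor_presheaf X F G) (tensor_presheaf X F G) (map_left f)"
    (is "presheaf_mor X ?T ?T ?h")
    and map_left_pure: "\<And>U m n. \<lbrakk>U \<in> opens X; m \<in> Sec F U; n \<in> Sec G U\<rbrakk> \<Longrightarrow>
      map_left f U (pure_sec U m n) = pure_sec U (f U m) n"
proof -
  have f: "semilinear (regular_ring X U) (sections F U) (regular_ring X U) (sections F U) (\<lambda>a. a) (f U)"
     "\<And>V m. \<lbrakk>V \<in> opens X; V \<subseteq> U; m \<in> Sec F U\<rbrakk> \<Longrightarrow> f V (restr F U V m) = restr F U V (f U m)"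
    if "U \<in> opens X" for U
    using assms that by (auto simp: presheaf_mor_def)
  have mor: "tensor_mor (regular_ring X U) (sections F U) (sections G U)
     (regular_ring X U) (sections F U) (sections G U) (\<lambda>a. a) (f U) (\<lambda>n. n)" if "U \<in> opens X" for U
    using that by (intro tensor_mor.intro tensor_sections tensor_mor_axioms.intro f semilinear_id)
  show "?h U (pure_sec U m n) = pure_sec U (f U m) n" if "U \<in> opens X" "m \<in> Sec F U" "n \<in> Sec G U" for U m n
    using tensor_mor.map_pure[OF mor] that by blast
  note hp = this
  show "presheaf_mor X ?T ?T ?h"
    unfolding presheaf_mor_def
  proof (intro ballI conjI impI)
    fix U assume U: "U \<in> opens X"
    interpret TU: tensor "regular_ring X U" "sections F U" "sections G U" by (rule tensor_sections[OF U])
    note hU = tensor_mor.map_closed[OF mor[OF U]] tensor_mor.map_add[OF mor[OF U]]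
    have fU: "f U m \<in> Sec F U" if "m \<in> Sec F U" for m using f(1)[OF U] that by (simp add: semilinear_def)
    have sm: "?h U (a \<odot>\<^bsub>TU.TM\<^esub> C) = a \<odot>\<^bsub>TU.TM\<^esub> ?h U C" if a: "a \<in> regular X U" and "C \<in> carrier TU.TM" for a C
      using that(2)
    proof (induction rule: TU.tensor_induct)
      case (pure m n)
      then show ?case using a U f(1)[OF U] fU TU.M.smult_closed[of a m]
        by (simp add: TU.smult_pure hp semilinear_def)
    next
      case (add C C')
      then show ?case using a TU.TM.smult_closed[of a C] TU.TM.smult_closed[of a C']
        by (simp add: TU.TM.smult_r_distr hU)
    qed
    show "semilinear (regular_ring X U) (sections ?T U) (regular_ring X U) (sections ?T U) (\<lambda>a. a) (?h U)"
      using sm hU by (simp add: semilinear_def)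
    fix V C assume V: "V \<in> opens X" and VU: "V \<subseteq> U" and "C \<in> Sec ?T U"
    then have "C \<in> carrier TU.TM" by simp
    then show "?h V (restr ?T U V C) = restr ?T U V (?h U C)"
    proof (induction rule: TU.tensor_induct)
      case (pure m n)
      then show ?case using U V VU fU by (simp add: restr_pure hp f(2)[OF U])
    next
      case (add C C')
      then show ?case using tensor_mor.map_add[OF mor[OF V]] hU tensor_restr_add[OF U V VU, of C C']
          tensor_restr_closed[OF U V VU, of C] tensor_restr_closed[OF U V VU, of C']
          tensor_restr_add[OF U V VU, of "?h U C" "?h U C'"] by simp
    qed
  qed
qed

end


section \<open>Sheafification\<close>

text \<open>The unit of sheafification. Local representability of a section \<open>s\<close> is
  recorded as \<open>restrict s V = germ_section X F V m\<close>, an equality of functions, so that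
  shrinking \<open>V\<close> amounts to restricting both sides.\<close>

definition germ_section where
  "germ_section X F U m = (\<lambda>x\<in>U. germ X F x U m)"

lemma
  assumes "V \<subseteq> U"
  shows restrict_regular_add: "restrict (f \<oplus>\<^bsub>regular_ring X U\<^esub> g) V = restrict f V \<oplus>\<^bsub>regular_ring X V\<^esub> restrict g V"
    and restrict_regular_mult: "restrict (f \<otimes>\<^bsub>regular_ring X U\<^esub> g) V = restrict f V \<otimes>\<^bsub>regular_ring X V\<^esub> restrict g V"
    and restrict_regular_one: "restrict \<one>\<^bsub>regular_ring X U\<^esub> V = \<one>\<^bsub>regular_ring X V\<^esub>"
    and restrict_regular_zero: "restrict \<zero>\<^bsub>regular_ring X U\<^esub> V = \<zero>\<^bsub>regular_ring X V\<^esub>"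
  using assms unfolding regular_ring_def restrict_def by (auto simp: fun_eq_iff)

lemma restr_sheafify [simp]: "restr (sheafify X F) U V s = restrict s V"
  by (simp add: sheafify_def)

context presheaf_mod
begin

lemma germ_memD:
  assumes "(V, n) \<in> germ X F x U m"
  shows "V \<in> opens X" "x \<in> V" "n \<in> Sec F V"
  using assms by (auto simp: germ_def)

lemma germ_self:
  "\<lbrakk>U \<in> opens X; x \<in> U; m \<in> Sec F U\<rbrakk> \<Longrightarrow> (U, m) \<in> germ X F x U m"
  unfolding germ_def by auto

text \<open>The two inclusions differ: a witness for the smaller set also serves the larger one,
  while in the other direction it has to be intersected with \<open>W\<close>.\<close>

lemma germ_restr_eq:
  assumes "W \<in> opens X" "x \<in> W" "W \<subseteq> U" "U \<in> opens X" "m \<in> Sec F U"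
  shows "germ X F x W (restr F U W m) = germ X F x U m"
proof (intro equalityI subsetI; clarsimp simp: germ_def)
  fix V n W' assume a: "V \<in> opens X" "x \<in> V" "n \<in> Sec F V" "W' \<in> opens X" "x \<in> W'" "W' \<subseteq> W" "W' \<subseteq> V"
    "restr F W W' (restr F U W m) = restr F V W' n"
  show "\<exists>Wa\<in>opens X. x \<in> Wa \<and> Wa \<subseteq> U \<and> Wa \<subseteq> V \<and> restr F U Wa m = restr F V Wa n"
    using a assms by (intro bexI[of _ W']) (auto simp: restr_restr)
next
  fix V n W' assume a: "V \<in> opens X" "x \<in> V" "n \<in> Sec F V" "W' \<in> opens X" "x \<in> W'" "W' \<subseteq> U" "W' \<subseteq> V"
    "restr F U W' m = restr F V W' n"
  have "restr F W (W \<inter> W') (restr F U W m) = restr F V (W \<inter> W') n"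
    using a assms restr_restr[of U W' "W \<inter> W'" m] restr_restr[of V W' "W \<inter> W'" n]
    by (simp add: restr_restr opens_Int)
  then show "\<exists>Wa\<in>opens X. x \<in> Wa \<and> Wa \<subseteq> W \<and> Wa \<subseteq> V \<and> restr F W Wa (restr F U W m) = restr F V Wa n"
    using a assms by (intro bexI[of _ "W \<inter> W'"]) (auto simp: opens_Int)
qed

lemma germ_eqD:
  assumes "germ X F x U m = germ X F x V n" "V \<in> opens X" "x \<in> V" "n \<in> Sec F V"
  obtains W where "W \<in> opens X" "x \<in> W" "W \<subseteq> U" "W \<subseteq> V" "restr F U W m = restr F V W n"
proof -
  have "(V, n) \<in> germ X F x U m" using germ_self assms by simp
  then show thesis using that unfolding germ_def by auto
qed

lemma germ_eqI:
  assumes "W \<in> opens X" "x \<in> W" "W \<subseteq> U" "W \<subseteq> V" "restr F U W m = restr F V W n"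
    "U \<in> opens X" "V \<in> opens X" "m \<in> Sec F U" "n \<in> Sec F V"
  shows "germ X F x U m = germ X F x V n"
  using germ_restr_eq[of W x U m] germ_restr_eq[of W x V n] assms by simp

abbreviation SF where "SF \<equiv> sheafify X F"

lemma germ_section_at: "x \<in> U \<Longrightarrow> germ_section X F U m x = germ X F x U m"
  by (simp add: germ_section_def)

lemma restrict_germ_section:
  assumes "V \<in> opens X" "V \<subseteq> U" "U \<in> opens X" "m \<in> Sec F U"
  shows "restrict (germ_section X F U m) V = germ_section X F V (restr F U V m)"
  using assms germ_restr_eq[of V _ U m] by (auto simp: germ_section_def restrict_def fun_eq_iff)

lemma sheafify_section_iff:
  assumes U: "U \<in> opens X"
  shows "s \<in> Sec SF U \<longleftrightarrow> s \<in> extensional U \<and>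
     (\<forall>x\<in>U. \<exists>V\<in>opens X. x \<in> V \<and> V \<subseteq> U \<and> (\<exists>m\<in>Sec F V. restrict s V = germ_section X F V m))"
proof -
  have "(\<forall>y\<in>V. s y = germ X F y V m) \<longleftrightarrow> restrict s V = germ_section X F V m" for V m
    by (auto simp: germ_section_def restrict_def fun_eq_iff)
  then show ?thesis by (auto simp: sheafify_def Bex_def)
qed

lemma sheafify_local:
  assumes "U \<in> opens X" "s \<in> Sec SF U" "x \<in> U"
  obtains V m where "V \<in> opens X" "x \<in> V" "V \<subseteq> U" "m \<in> Sec F V" "restrict s V = germ_section X F V m"
  using assms by (auto simp: sheafify_section_iff)

lemma sheafify_local_subset:
  assumes "U \<in> opens X" "s \<in> Sec SF U" "x \<in> U" "W \<in> opens X" "x \<in> W"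
  obtains V m where "V \<in> opens X" "x \<in> V" "V \<subseteq> U" "V \<subseteq> W" "m \<in> Sec F V" "restrict s V = germ_section X F V m"
proof -
  obtain V m where V: "V \<in> opens X" "x \<in> V" "V \<subseteq> U" "m \<in> Sec F V" "restrict s V = germ_section X F V m"
    using sheafify_local assms(1-3) by metis
  have "restrict s (V \<inter> W) = germ_section X F (V \<inter> W) (restr F V (V \<inter> W) m)"
    using restrict_germ_section[of "V \<inter> W" V m] V assms opens_Int[of V X W]
    by (metis Int_lower1 restrict_restrict inf.absorb_iff2)
  then show thesis using V assms by (intro that[of "V \<inter> W" "restr F V (V \<inter> W) m"]) (auto simp: opens_Int)
qed

lemma sheafify_local2:
  assumes "U \<in> opens X" "s \<in> Sec SF U" "t \<in> Sec SF U" "x \<in> U"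
  obtains V m n where "V \<in> opens X" "x \<in> V" "V \<subseteq> U" "m \<in> Sec F V" "n \<in> Sec F V"
    "restrict s V = germ_section X F V m" "restrict t V = germ_section X F V n"
proof -
  obtain W m where W: "W \<in> opens X" "x \<in> W" "W \<subseteq> U" "m \<in> Sec F W" "restrict s W = germ_section X F W m"
    using sheafify_local assms by metis
  obtain V n where V: "V \<in> opens X" "x \<in> V" "V \<subseteq> U" "V \<subseteq> W" "n \<in> Sec F V" "restrict t V = germ_section X F V n"
    using sheafify_local_subset[OF assms(1) assms(3) assms(4) W(1) W(2)] by metis
  have "restrict s V = germ_section X F V (restr F W V m)"
    using restrict_germ_section[of V W m] V W by (metis restrict_restrict inf.absorb_iff2)
  then show thesis using V W by (intro that[of V "restr F W V m" n]) auto
qed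

lemma germ_section_closed:
  assumes "U \<in> opens X" "m \<in> Sec F U" shows "germ_section X F U m \<in> Sec SF U"
  unfolding sheafify_section_iff[OF assms(1)]
  using assms by (auto intro!: bexI[of _ U] bexI[of _ m] simp: germ_section_def)

text \<open>The sum in the sheafification is a union over all pairs of representatives of the two
  germs. Each pair agrees with \<open>m\<close> and \<open>n\<close> on some neighbourhoods of
  \<open>x\<close>, so on their intersection all sums coincide; the union is one of equal sets over
  a nonempty index set.\<close>

lemma add_at:
  assumes x: "x \<in> U" "x \<in> V" and V: "V \<in> opens X" and mn: "m \<in> Sec F V" "n \<in> Sec F V"
    and s: "s x = germ X F x V m" and t: "t x = germ X F x V n"
  shows "(s \<oplus>\<^bsub>sections SF U\<^esub> t) x = germ X F x V (m \<oplus>\<^bsub>sections F V\<^esub> n)"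
proof -
  interpret MV: abelian_group "sections F V" using abelian_group V by blast
  have eq: "germ X F x (A \<inter> B) (restr F A (A \<inter> B) a \<oplus>\<^bsub>sections F (A \<inter> B)\<^esub> restr F B (A \<inter> B) b) =
      germ X F x V (m \<oplus>\<^bsub>sections F V\<^esub> n)"
    if A: "(A, a) \<in> germ X F x V m" and B: "(B, b) \<in> germ X F x V n" for A a B b
  proof -
    obtain W where W: "W \<in> opens X" "x \<in> W" "W \<subseteq> V" "W \<subseteq> A" "restr F V W m = restr F A W a"
      using A by (auto simp: germ_def)
    obtain W' where W': "W' \<in> opens X" "x \<in> W'" "W' \<subseteq> V" "W' \<subseteq> B" "restr F V W' n = restr F B W' b"
      using B by (auto simp: germ_def)
    note AB = germ_memD[OF A] germ_memD[OF B]
    let ?C = "A \<inter> B" and ?W = "W \<inter> W'"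
    have C: "?C \<in> opens X" and Wo: "?W \<in> opens X" and WC: "?W \<subseteq> ?C"
      using AB W W' by (auto intro: opens_Int)
    interpret MC: abelian_group "sections F ?C" using abelian_group C by blast
    have r: "restr F A ?C a \<in> Sec F ?C" "restr F B ?C b \<in> Sec F ?C" using AB C by auto
    have "restr F ?C ?W (restr F A ?C a \<oplus>\<^bsub>sections F ?C\<^esub> restr F B ?C b) =
       restr F A ?W a \<oplus>\<^bsub>sections F ?W\<^esub> restr F B ?W b"
      using restr_add[OF C Wo WC r] AB C Wo WC by (simp add: restr_restr)
    also have "restr F A ?W a = restr F V ?W m"
      using W AB mn V Wo restr_restr[of A W ?W a] restr_restr[of V W ?W m] by simp
    also have "restr F B ?W b = restr F V ?W n"
      using W' AB mn V Wo restr_restr[of B W' ?W b] restr_restr[of V W' ?W n] by simp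
    also have "restr F V ?W m \<oplus>\<^bsub>sections F ?W\<^esub> restr F V ?W n = restr F V ?W (m \<oplus>\<^bsub>sections F V\<^esub> n)"
      using restr_add[OF V Wo le_infI1[OF W(3)] mn] by simp
    finally show ?thesis
      using C Wo WC V W W' r mn by (intro germ_eqI[of ?W]) auto
  qed
  have ne: "(V, m) \<in> germ X F x V m" "(V, n) \<in> germ X F x V n" using germ_self V x mn by auto
  define g where "g A a B b = germ X F x (A \<inter> B) (restr F A (A \<inter> B) a \<oplus>\<^bsub>sections F (A \<inter> B)\<^esub> restr F B (A \<inter> B) b)"
    for A a B b
  have "(s \<oplus>\<^bsub>sections SF U\<^esub> t) x = (\<Union>(A, a)\<in>germ X F x V m. \<Union>(B, b)\<in>germ X F x V n. g A a B b)"
    by (simp add: sheafify_def x s t g_def)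
  moreover have "g A a B b = germ X F x V (m \<oplus>\<^bsub>sections F V\<^esub> n)"
    if "(A, a) \<in> germ X F x V m" "(B, b) \<in> germ X F x V n" for A a B b
    unfolding g_def using eq that .
  ultimately show ?thesis using ne by fast
qed

lemma smult_at:
  assumes x: "x \<in> U" "x \<in> V" and V: "V \<in> opens X" "V \<subseteq> U" and U: "U \<in> opens X"
    and m: "m \<in> Sec F V" and f: "f \<in> regular X U" and s: "s x = germ X F x V m"
  shows "(f \<odot>\<^bsub>sections SF U\<^esub> s) x = germ X F x V (restrict f V \<odot>\<^bsub>sections F V\<^esub> m)"
proof -
  interpret MV: module "regular_ring X V" "sections F V" using module V by blast
  have fV: "restrict f V \<in> regular X V" using regular_restrict f V by blast
  have eq: "germ X F x (U \<inter> A) (restrict f (U \<inter> A) \<odot>\<^bsub>sections F (U \<inter> A)\<^esub> restr F A (U \<inter> A) a) =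
      germ X F x V (restrict f V \<odot>\<^bsub>sections F V\<^esub> m)"
    if A: "(A, a) \<in> germ X F x V m" for A a
  proof -
    obtain W where W: "W \<in> opens X" "x \<in> W" "W \<subseteq> V" "W \<subseteq> A" "restr F V W m = restr F A W a"
      using A by (auto simp: germ_def)
    note AB = germ_memD[OF A]
    let ?C = "U \<inter> A"
    have C: "?C \<in> opens X" and WC: "W \<subseteq> ?C" using AB W V U by (auto intro: opens_Int)
    interpret MC: module "regular_ring X ?C" "sections F ?C" using module C by blast
    have r: "restr F A ?C a \<in> Sec F ?C" "restrict f ?C \<in> regular X ?C"
      using AB C f by (auto intro: regular_restrict)
    have "restr F ?C W (restrict f ?C \<odot>\<^bsub>sections F ?C\<^esub> restr F A ?C a) =
       restrict f W \<odot>\<^bsub>sections F W\<^esub> restr F A W a"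
      using restr_smult[OF C W(1) WC r(2) r(1)] AB C W WC
      by (simp add: restr_restr restrict_restrict Int_absorb1 del: restrict_apply)
    also have "\<dots> = restr F V W (restrict f V \<odot>\<^bsub>sections F V\<^esub> m)"
      using restr_smult[OF V(1) W(1) W(3) fV m] W
      by (simp add: restrict_restrict Int_absorb1 del: restrict_apply)
    finally show ?thesis
      using C W WC V r m fV by (intro germ_eqI[of W]) auto
  qed
  have ne: "(V, m) \<in> germ X F x V m" using germ_self V x m by auto
  show ?thesis
    unfolding sheafify_def using x eq ne by (auto simp: s)
qed

lemma zero_sheafify: "\<zero>\<^bsub>sections SF U\<^esub> = germ_section X F U \<zero>\<^bsub>sections F U\<^esub>"
  by (simp add: sheafify_def germ_section_def)

lemma restrict_sheafify_add:
  "V \<subseteq> U \<Longrightarrow> restrict (s \<oplus>\<^bsub>sections SF U\<^esub> t) V = restrict s V \<oplus>\<^bsub>sections SF V\<^esub> restrict t V"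
  by (auto simp: sheafify_def restrict_def fun_eq_iff)

lemma germ_section_add:
  assumes "V \<in> opens X" "m \<in> Sec F V" "n \<in> Sec F V"
  shows "germ_section X F V (m \<oplus>\<^bsub>sections F V\<^esub> n) =
    germ_section X F V m \<oplus>\<^bsub>sections SF V\<^esub> germ_section X F V n"
proof
  fix x show "germ_section X F V (m \<oplus>\<^bsub>sections F V\<^esub> n) x =
    (germ_section X F V m \<oplus>\<^bsub>sections SF V\<^esub> germ_section X F V n) x"
  proof (cases "x \<in> V")
    case True
    then show ?thesis using add_at[of x V V m n "germ_section X F V m" "germ_section X F V n"] assms
      by (simp add: germ_section_at)
  next
    case False
    then show ?thesis by (simp add: germ_section_def sheafify_def)
  qed
qed

lemma germ_section_smult:
  assumes "V \<in> opens X" "m \<in> Sec F V" "f \<in> regular X V"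
  shows "germ_section X F V (f \<odot>\<^bsub>sections F V\<^esub> m) = f \<odot>\<^bsub>sections SF V\<^esub> germ_section X F V m"
proof
  have f: "restrict f V = f" using assms(3) by (simp add: regular_def extensional_restrict)
  fix x show "germ_section X F V (f \<odot>\<^bsub>sections F V\<^esub> m) x = (f \<odot>\<^bsub>sections SF V\<^esub> germ_section X F V m) x"
  proof (cases "x \<in> V")
    case True
    then show ?thesis using smult_at[of x V V m f "germ_section X F V m"] assms
      by (simp add: germ_section_at f)
  next
    case False
    then show ?thesis by (simp add: germ_section_def sheafify_def)
  qed
qed

lemma sheafify_add_closed:
  assumes U: "U \<in> opens X" and st: "s \<in> Sec SF U" "t \<in> Sec SF U"
  shows "s \<oplus>\<^bsub>sections SF U\<^esub> t \<in> Sec SF U"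
  unfolding sheafify_section_iff[OF U]
proof (intro conjI ballI)
  show "s \<oplus>\<^bsub>sections SF U\<^esub> t \<in> extensional U" by (simp add: sheafify_def)
  fix x assume "x \<in> U"
  then obtain V m n where V: "V \<in> opens X" "x \<in> V" "V \<subseteq> U" and mn: "m \<in> Sec F V" "n \<in> Sec F V"
    "restrict s V = germ_section X F V m" "restrict t V = germ_section X F V n"
    using sheafify_local2[OF U st] by metis
  interpret MV: abelian_group "sections F V" using abelian_group V by blast
  have "restrict (s \<oplus>\<^bsub>sections SF U\<^esub> t) V = germ_section X F V (m \<oplus>\<^bsub>sections F V\<^esub> n)"
    using germ_section_add V mn by (simp add: restrict_sheafify_add del: restrict_apply)
  then show "\<exists>V\<in>opens X. x \<in> V \<and> V \<subseteq> U \<and>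
       (\<exists>m\<in>Sec F V. restrict (s \<oplus>\<^bsub>sections SF U\<^esub> t) V = germ_section X F V m)"
    using V mn by blast
qed

text \<open>The formula for scalar multiplication mentions the ambient set \<open>U\<close> itself,
  unlike that for addition, so it does not restrict by unfolding. Both sides are evaluated at a
  point through a common representative near it.\<close>

lemma restrict_sheafify_smult:
  assumes U: "U \<in> opens X" "V \<in> opens X" "V \<subseteq> U" and s: "s \<in> Sec SF U" and f: "f \<in> regular X U"
  shows "restrict (f \<odot>\<^bsub>sections SF U\<^esub> s) V = restrict f V \<odot>\<^bsub>sections SF V\<^esub> restrict s V"
proof
  fix x show "restrict (f \<odot>\<^bsub>sections SF U\<^esub> s) V x = (restrict f V \<odot>\<^bsub>sections SF V\<^esub> restrict s V) x"
  proof (cases "x \<in> V")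
    case True
    then obtain W m where W: "W \<in> opens X" "x \<in> W" "W \<subseteq> U" "W \<subseteq> V" "m \<in> Sec F W"
      "restrict s W = germ_section X F W m"
      using sheafify_local_subset[OF U(1) s _ U(2) True] U by blast
    have sx: "s x = germ X F x W m" using W by (metis germ_section_at restrict_apply')
    have "restrict f V \<in> regular X V" using regular_restrict f U by blast
    then show ?thesis
      using smult_at[of x U W m f s] smult_at[of x V W m "restrict f V" "restrict s V"] True U W f sx
      by (simp add: restrict_apply' restrict_restrict Int_absorb1 subset_eq del: restrict_apply)
  next
    case False
    then show ?thesis by (simp add: sheafify_def)
  qed
qed

lemma sheafify_smult_closed:
  assumes U: "U \<in> opens X" and s: "s \<in> Sec SF U" and f: "f \<in> regular X U"
  shows "f \<odot>\<^bsub>sections SF U\<^esub> s \<in> Sec SF U"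
  unfolding sheafify_section_iff[OF U]
proof (intro conjI ballI)
  show "f \<odot>\<^bsub>sections SF U\<^esub> s \<in> extensional U" by (simp add: sheafify_def)
  fix x assume "x \<in> U"
  then obtain V m where V: "V \<in> opens X" "x \<in> V" "V \<subseteq> U" and m: "m \<in> Sec F V"
    "restrict s V = germ_section X F V m"
    using sheafify_local[OF U s] by metis
  interpret MV: module "regular_ring X V" "sections F V" using module V by blast
  have f': "restrict f V \<in> regular X V" using regular_restrict f V by blast
  then have "restrict (f \<odot>\<^bsub>sections SF U\<^esub> s) V = germ_section X F V (restrict f V \<odot>\<^bsub>sections F V\<^esub> m)"
    using germ_section_smult V m restrict_sheafify_smult[OF U V(1) V(3) s f] by (simp del: restrict_apply)
  then show "\<exists>V\<in>opens X. x \<in> V \<and> V \<subseteq> U \<and>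
       (\<exists>m\<in>Sec F V. restrict (f \<odot>\<^bsub>sections SF U\<^esub> s) V = germ_section X F V m)"
    using V m f' by (metis MV.smult_closed carrier_regular_ring)
qed

lemma sheafify_eqI:
  assumes "s \<in> extensional U" "t \<in> extensional U"
    and "\<And>x. x \<in> U \<Longrightarrow> \<exists>V. x \<in> V \<and> restrict s V = restrict t V"
  shows "s = t"
proof (rule extensionalityI[OF assms(1,2)])
  fix x assume "x \<in> U"
  with assms(3) show "s x = t x" by (metis restrict_apply')
qed

text \<open>A module axiom is an equality of functions on \<open>U\<close>. Around each point the
  sections involved are germ sections over one neighbourhood, and there the axiom is the one for
  \<open>F\<close>, because the unit respects the operations.\<close>

lemma presheaf_sheafify: "presheaf_of_modules X SF"
  unfolding presheaf_of_modules_def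
proof (intro conjI ballI impI)
  fix U assume U: "U \<in> opens X"
  have ext: "s \<in> extensional U" if "s \<in> Sec SF U" for s using that U by (simp add: sheafify_section_iff)
  have ext_add: "s \<oplus>\<^bsub>sections SF U\<^esub> t \<in> extensional U" for s t by (simp add: sheafify_def)
  have ext_smult: "f \<odot>\<^bsub>sections SF U\<^esub> t \<in> extensional U" for f t by (simp add: sheafify_def)
  have zero: "\<zero>\<^bsub>sections SF U\<^esub> \<in> Sec SF U"
    using germ_section_closed[OF U] abelian_group[OF U] unfolding zero_sheafify
    by (simp add: abelian_group_def abelian_monoid.zero_closed)
  interpret RU: cring "regular_ring X U" using cring[OF U] .
  show "module (regular_ring X U) (sections SF U)"
  proof (rule moduleI[OF cring[OF U]])
    show "abelian_group (sections SF U)"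
    proof (rule abelian_groupI)
      fix s t u assume st: "s \<in> Sec SF U" "t \<in> Sec SF U" and u: "u \<in> Sec SF U"
      show "s \<oplus>\<^bsub>sections SF U\<^esub> t \<in> Sec SF U" using sheafify_add_closed U st by blast
      show "s \<oplus>\<^bsub>sections SF U\<^esub> t = t \<oplus>\<^bsub>sections SF U\<^esub> s"
      proof (rule sheafify_eqI[OF ext_add ext_add])
        fix x assume "x \<in> U"
        with sheafify_local2[OF U st] obtain V m n where V: "V \<in> opens X" "x \<in> V" "V \<subseteq> U"
          "m \<in> Sec F V" "n \<in> Sec F V"
          "restrict s V = germ_section X F V m" "restrict t V = germ_section X F V n" by metis
        interpret MV: abelian_group "sections F V" using abelian_group V by blast
        show "\<exists>V. x \<in> V \<and> restrict (s \<oplus>\<^bsub>sections SF U\<^esub> t) V = restrict (t \<oplus>\<^bsub>sections SF U\<^esub> s) V"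
          using V by (intro exI[of _ V])
            (simp add: restrict_sheafify_add MV.a_comm del: restrict_apply flip: germ_section_add)
      qed
      show "s \<oplus>\<^bsub>sections SF U\<^esub> t \<oplus>\<^bsub>sections SF U\<^esub> u = s \<oplus>\<^bsub>sections SF U\<^esub> (t \<oplus>\<^bsub>sections SF U\<^esub> u)"
      proof (rule sheafify_eqI[OF ext_add ext_add])
        fix x assume x: "x \<in> U"
        with sheafify_local2[OF U st] obtain W m n where W: "W \<in> opens X" "x \<in> W" "W \<subseteq> U"
          "m \<in> Sec F W" "n \<in> Sec F W"
          "restrict s W = germ_section X F W m" "restrict t W = germ_section X F W n" by metis
        obtain V p where V: "V \<in> opens X" "x \<in> V" "V \<subseteq> U" "V \<subseteq> W" "p \<in> Sec F V" "restrict u V = germ_section X F V p"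
          using sheafify_local_subset[OF U u x W(1) W(2)] by metis
        have r: "restrict s V = germ_section X F V (restr F W V m)" "restrict t V = germ_section X F V (restr F W V n)"
          using restrict_germ_section[of V W m] restrict_germ_section[of V W n] V W
          by (metis restrict_restrict inf.absorb_iff2)+
        interpret MV: abelian_group "sections F V" using abelian_group V by blast
        have mn: "restr F W V m \<in> Sec F V" "restr F W V n \<in> Sec F V" using V W by auto
        show "\<exists>V. x \<in> V \<and> restrict (s \<oplus>\<^bsub>sections SF U\<^esub> t \<oplus>\<^bsub>sections SF U\<^esub> u) V =
           restrict (s \<oplus>\<^bsub>sections SF U\<^esub> (t \<oplus>\<^bsub>sections SF U\<^esub> u)) V"
          using V mn r by (intro exI[of _ V])
            (simp add: restrict_sheafify_add MV.a_assoc del: restrict_apply flip: germ_section_add)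
      qed
    next
      show "\<zero>\<^bsub>sections SF U\<^esub> \<in> Sec SF U" by (rule zero)
      fix s assume s: "s \<in> Sec SF U"
      show "\<zero>\<^bsub>sections SF U\<^esub> \<oplus>\<^bsub>sections SF U\<^esub> s = s"
      proof (rule sheafify_eqI[OF ext_add ext[OF s]])
        fix x assume "x \<in> U"
        with sheafify_local[OF U s] obtain V m where V: "V \<in> opens X" "x \<in> V" "V \<subseteq> U"
          "m \<in> Sec F V" "restrict s V = germ_section X F V m" by metis
        interpret MV: abelian_group "sections F V" using abelian_group V by blast
        interpret MU: abelian_group "sections F U" using abelian_group U by blast
        have "restrict \<zero>\<^bsub>sections SF U\<^esub> V = germ_section X F V \<zero>\<^bsub>sections F V\<^esub>"
          unfolding zero_sheafify using restrict_germ_section[of V U "\<zero>\<^bsub>sections F U\<^esub>"] V U restr_zero[of U V] by simp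
        then show "\<exists>V. x \<in> V \<and> restrict (\<zero>\<^bsub>sections SF U\<^esub> \<oplus>\<^bsub>sections SF U\<^esub> s) V = restrict s V"
          using V by (intro exI[of _ V])
            (simp add: restrict_sheafify_add del: restrict_apply flip: germ_section_add)
      qed
      \<comment> \<open>The negative of \<open>s\<close> is taken to be (-1) s, which is already
        known to be a section; that it cancels \<open>s\<close> is l-distributivity over a
        neighbourhood on which \<open>s\<close> is a germ section.\<close>
      let ?m1 = "\<ominus>\<^bsub>regular_ring X U\<^esub> \<one>\<^bsub>regular_ring X U\<^esub>"
      have m1: "?m1 \<in> regular X U" using RU.a_inv_closed[OF RU.one_closed] by simp
      show "\<exists>t\<in>Sec SF U. t \<oplus>\<^bsub>sections SF U\<^esub> s = \<zero>\<^bsub>sections SF U\<^esub>"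
      proof (rule bexI)
        show "?m1 \<odot>\<^bsub>sections SF U\<^esub> s \<in> Sec SF U" using sheafify_smult_closed[OF U s m1] .
        show "?m1 \<odot>\<^bsub>sections SF U\<^esub> s \<oplus>\<^bsub>sections SF U\<^esub> s = \<zero>\<^bsub>sections SF U\<^esub>"
        proof (rule sheafify_eqI[OF ext_add ext[OF zero]])
          fix x assume "x \<in> U"
          with sheafify_local[OF U s] obtain V m where V: "V \<in> opens X" "x \<in> V" "V \<subseteq> U"
            "m \<in> Sec F V" "restrict s V = germ_section X F V m" by metis
          interpret MV: module "regular_ring X V" "sections F V" using module V by blast
          interpret MU: abelian_group "sections F U" using abelian_group U by blast
          have zV: "restrict \<zero>\<^bsub>sections SF U\<^esub> V = germ_section X F V \<zero>\<^bsub>sections F V\<^esub>"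
            unfolding zero_sheafify using restrict_germ_section[of V U "\<zero>\<^bsub>sections F U\<^esub>"] V U restr_zero[of U V] by simp
          have rm: "restrict ?m1 V \<in> regular X V" using regular_restrict m1 V by blast
          have "?m1 \<oplus>\<^bsub>regular_ring X U\<^esub> \<one>\<^bsub>regular_ring X U\<^esub> = \<zero>\<^bsub>regular_ring X U\<^esub>"
            using RU.l_neg RU.one_closed by blast
          then have "restrict (?m1 \<oplus>\<^bsub>regular_ring X U\<^esub> \<one>\<^bsub>regular_ring X U\<^esub>) V = restrict \<zero>\<^bsub>regular_ring X U\<^esub> V" by simp
          then have "restrict ?m1 V \<oplus>\<^bsub>regular_ring X V\<^esub> \<one>\<^bsub>regular_ring X V\<^esub> = \<zero>\<^bsub>regular_ring X V\<^esub>"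
            using V by (simp add: restrict_regular_add restrict_regular_one restrict_regular_zero del: restrict_apply)
          then have "(restrict ?m1 V \<oplus>\<^bsub>regular_ring X V\<^esub> \<one>\<^bsub>regular_ring X V\<^esub>) \<odot>\<^bsub>sections F V\<^esub> m = \<zero>\<^bsub>sections F V\<^esub>"
            using V by simp
          then have "restrict ?m1 V \<odot>\<^bsub>sections F V\<^esub> m \<oplus>\<^bsub>sections F V\<^esub> m = \<zero>\<^bsub>sections F V\<^esub>"
            using V rm MV.smult_l_distr[of "restrict ?m1 V" "\<one>\<^bsub>regular_ring X V\<^esub>" m] MV.R.one_closed by simp
          then have "germ_section X F V (restrict ?m1 V \<odot>\<^bsub>sections F V\<^esub> m) \<oplus>\<^bsub>sections SF V\<^esub> germ_section X F V m
             = germ_section X F V \<zero>\<^bsub>sections F V\<^esub>"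
            using V rm MV.smult_closed[of "restrict ?m1 V" m] germ_section_add[of V "restrict ?m1 V \<odot>\<^bsub>sections F V\<^esub> m" m]
            by simp
          then show "\<exists>V. x \<in> V \<and> restrict (?m1 \<odot>\<^bsub>sections SF U\<^esub> s \<oplus>\<^bsub>sections SF U\<^esub> s) V = restrict \<zero>\<^bsub>sections SF U\<^esub> V"
            using V rm zV restrict_sheafify_smult[OF U V(1) V(3) s m1] germ_section_smult[of V m "restrict ?m1 V"]
            by (intro exI[of _ V]) (simp add: restrict_sheafify_add del: restrict_apply)
        qed
      qed
    qed
  next
    fix f s assume f: "f \<in> carrier (regular_ring X U)" and s: "s \<in> Sec SF U"
    then have f': "f \<in> regular X U" by simp
    show "f \<odot>\<^bsub>sections SF U\<^esub> s \<in> Sec SF U" using sheafify_smult_closed[OF U s f'] .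
    {
      fix t assume t: "t \<in> Sec SF U"
      show "f \<odot>\<^bsub>sections SF U\<^esub> (s \<oplus>\<^bsub>sections SF U\<^esub> t) =
        f \<odot>\<^bsub>sections SF U\<^esub> s \<oplus>\<^bsub>sections SF U\<^esub> f \<odot>\<^bsub>sections SF U\<^esub> t"
      proof (rule sheafify_eqI[OF ext_smult ext_add])
        fix x assume "x \<in> U"
        with sheafify_local2[OF U s t] obtain V m n where V: "V \<in> opens X" "x \<in> V" "V \<subseteq> U"
          "m \<in> Sec F V" "n \<in> Sec F V"
          "restrict s V = germ_section X F V m" "restrict t V = germ_section X F V n" by metis
        interpret MV: module "regular_ring X V" "sections F V" using module V by blast
        have fV: "restrict f V \<in> regular X V" using regular_restrict f' V by blast
        have st: "s \<oplus>\<^bsub>sections SF U\<^esub> t \<in> Sec SF U" using sheafify_add_closed U s t by blast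
        note r = restrict_sheafify_smult[OF U V(1) V(3) _ f']
        show "\<exists>V. x \<in> V \<and> restrict (f \<odot>\<^bsub>sections SF U\<^esub> (s \<oplus>\<^bsub>sections SF U\<^esub> t)) V =
            restrict (f \<odot>\<^bsub>sections SF U\<^esub> s \<oplus>\<^bsub>sections SF U\<^esub> f \<odot>\<^bsub>sections SF U\<^esub> t) V"
          using V fV by (intro exI[of _ V]) (simp add: restrict_sheafify_add r s t st MV.smult_r_distr
              del: restrict_apply flip: germ_section_add germ_section_smult)
      qed
    }
    fix g assume g: "g \<in> carrier (regular_ring X U)"
    then have g': "g \<in> regular X U" by simp
    have fg: "f \<oplus>\<^bsub>regular_ring X U\<^esub> g \<in> regular X U" "f \<otimes>\<^bsub>regular_ring X U\<^esub> g \<in> regular X U"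
      using RU.a_closed RU.m_closed f g by auto
    show "(f \<oplus>\<^bsub>regular_ring X U\<^esub> g) \<odot>\<^bsub>sections SF U\<^esub> s =
        f \<odot>\<^bsub>sections SF U\<^esub> s \<oplus>\<^bsub>sections SF U\<^esub> g \<odot>\<^bsub>sections SF U\<^esub> s"
    proof (rule sheafify_eqI[OF ext_smult ext_add])
      fix x assume "x \<in> U"
      with sheafify_local[OF U s] obtain V m where V: "V \<in> opens X" "x \<in> V" "V \<subseteq> U"
          "m \<in> Sec F V" "restrict s V = germ_section X F V m" by metis
      interpret MV: module "regular_ring X V" "sections F V" using module V by blast
      have fV: "restrict f V \<in> regular X V" "restrict g V \<in> regular X V" using regular_restrict f' g' V by blast+
      have fgV: "restrict f V \<oplus>\<^bsub>regular_ring X V\<^esub> restrict g V \<in> regular X V" using MV.R.a_closed fV by simp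
      note r = restrict_sheafify_smult[OF U V(1) V(3) s]
      show "\<exists>V. x \<in> V \<and> restrict ((f \<oplus>\<^bsub>regular_ring X U\<^esub> g) \<odot>\<^bsub>sections SF U\<^esub> s) V =
            restrict (f \<odot>\<^bsub>sections SF U\<^esub> s \<oplus>\<^bsub>sections SF U\<^esub> g \<odot>\<^bsub>sections SF U\<^esub> s) V"
        using V fV fgV by (intro exI[of _ V]) (simp add: restrict_sheafify_add r fg f' g' MV.smult_l_distr restrict_regular_add restrict_regular_mult
              del: restrict_apply flip: germ_section_add germ_section_smult)
    qed
    show "(f \<otimes>\<^bsub>regular_ring X U\<^esub> g) \<odot>\<^bsub>sections SF U\<^esub> s = f \<odot>\<^bsub>sections SF U\<^esub> (g \<odot>\<^bsub>sections SF U\<^esub> s)"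
    proof (rule sheafify_eqI[OF ext_smult ext_smult])
      fix x assume "x \<in> U"
      with sheafify_local[OF U s] obtain V m where V: "V \<in> opens X" "x \<in> V" "V \<subseteq> U"
          "m \<in> Sec F V" "restrict s V = germ_section X F V m" by metis
      interpret MV: module "regular_ring X V" "sections F V" using module V by blast
      have fV: "restrict f V \<in> regular X V" "restrict g V \<in> regular X V" using regular_restrict f' g' V by blast+
      have fgV: "restrict f V \<otimes>\<^bsub>regular_ring X V\<^esub> restrict g V \<in> regular X V" using MV.R.m_closed fV by simp
      note r = restrict_sheafify_smult[OF U V(1) V(3)]
      have gs: "g \<odot>\<^bsub>sections SF U\<^esub> s \<in> Sec SF U" using sheafify_smult_closed[OF U s g'] .
      show "\<exists>V. x \<in> V \<and> restrict ((f \<otimes>\<^bsub>regular_ring X U\<^esub> g) \<odot>\<^bsub>sections SF U\<^esub> s) V =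
            restrict (f \<odot>\<^bsub>sections SF U\<^esub> (g \<odot>\<^bsub>sections SF U\<^esub> s)) V"
        using V fV fgV by (intro exI[of _ V]) (simp add: r s gs fg f' g' MV.smult_assoc1 restrict_regular_add restrict_regular_mult
              del: restrict_apply flip: germ_section_smult)
    qed
  next
    fix s assume s: "s \<in> Sec SF U"
    show "\<one>\<^bsub>regular_ring X U\<^esub> \<odot>\<^bsub>sections SF U\<^esub> s = s"
    proof (rule sheafify_eqI[OF ext_smult ext[OF s]])
      fix x assume "x \<in> U"
      with sheafify_local[OF U s] obtain V m where V: "V \<in> opens X" "x \<in> V" "V \<subseteq> U"
          "m \<in> Sec F V" "restrict s V = germ_section X F V m" by metis
      interpret MV: module "regular_ring X V" "sections F V" using module V by blast
      have o: "\<one>\<^bsub>regular_ring X U\<^esub> \<in> regular X U" "\<one>\<^bsub>regular_ring X V\<^esub> \<in> regular X V"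
        using RU.one_closed MV.R.one_closed by simp_all
      note r = restrict_sheafify_smult[OF U V(1) V(3) s]
      show "\<exists>V. x \<in> V \<and> restrict (\<one>\<^bsub>regular_ring X U\<^esub> \<odot>\<^bsub>sections SF U\<^esub> s) V = restrict s V"
        using V o by (intro exI[of _ V]) (simp add: r restrict_regular_one del: restrict_apply flip: germ_section_smult)
    qed
  qed
  show "restr SF U U s = s" if "s \<in> Sec SF U" for s
    using ext[OF that] by (simp add: extensional_restrict)
  fix V assume V: "V \<in> opens X"
  {
    assume VU: "V \<subseteq> U"
    show "restr SF U V s \<in> Sec SF V" if s: "s \<in> Sec SF U" for s
      unfolding sheafify_section_iff[OF V]
    proof (intro conjI ballI)
      fix x assume x: "x \<in> V"
      with VU have xU: "x \<in> U" by auto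
      obtain W m where "W \<in> opens X" "x \<in> W" "W \<subseteq> U" "W \<subseteq> V" "m \<in> Sec F W" "restrict s W = germ_section X F W m"
        using sheafify_local_subset[OF U s xU V x] by metis
      then show "\<exists>W\<in>opens X. x \<in> W \<and> W \<subseteq> V \<and> (\<exists>m\<in>Sec F W. restrict (restr SF U V s) W = germ_section X F W m)"
        by (metis restr_sheafify restrict_restrict inf.absorb_iff2)
    qed (simp add: sheafify_def)
    show "restr SF U V (s \<oplus>\<^bsub>sections SF U\<^esub> t) = restr SF U V s \<oplus>\<^bsub>sections SF V\<^esub> restr SF U V t" for s t
      using restrict_sheafify_add[OF VU] by simp
    show "restr SF U V (f \<odot>\<^bsub>sections SF U\<^esub> s) = restrict f V \<odot>\<^bsub>sections SF V\<^esub> restr SF U V s"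
      if "f \<in> regular X U" "s \<in> Sec SF U" for f s
      using restrict_sheafify_smult[OF U V VU that(2,1)] by simp
  }
  show "restr SF V W (restr SF U V s) = restr SF U W s" if "W \<subseteq> V \<and> V \<subseteq> U" for W s
    using that by (simp add: restrict_restrict Int_absorb1)
qed

end


section \<open>Presheaf morphisms, sheaves, and the universal property of sheafification\<close>

lemma presheaf_morD:
  assumes "presheaf_mor X F G \<phi>" "U \<in> opens X"
  shows "m \<in> Sec F U \<Longrightarrow> \<phi> U m \<in> Sec G U"
    and "\<lbrakk>m \<in> Sec F U; n \<in> Sec F U\<rbrakk> \<Longrightarrow> \<phi> U (m \<oplus>\<^bsub>sections F U\<^esub> n) = \<phi> U m \<oplus>\<^bsub>sections G U\<^esub> \<phi> U n"
    and "\<lbrakk>f \<in> regular X U; m \<in> Sec F U\<rbrakk> \<Longrightarrow> \<phi> U (f \<odot>\<^bsub>sections F U\<^esub> m) = f \<odot>\<^bsub>sections G U\<^esub> \<phi> U m"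
    and "\<lbrakk>V \<in> opens X; V \<subseteq> U; m \<in> Sec F U\<rbrakk> \<Longrightarrow> \<phi> V (restr F U V m) = restr G U V (\<phi> U m)"
  using assms by (auto simp: presheaf_mor_def semilinear_def)

lemma presheaf_mor_zero:
  assumes "presheaf_mod X F" "presheaf_mod X G" "presheaf_mor X F G \<phi>" "U \<in> opens X"
  shows "\<phi> U \<zero>\<^bsub>sections F U\<^esub> = \<zero>\<^bsub>sections G U\<^esub>"
proof -
  interpret MU: abelian_group "sections F U" using presheaf_mod.abelian_group assms by blast
  interpret NU: abelian_group "sections G U" using presheaf_mod.abelian_group assms by blast
  have "\<phi> U \<zero>\<^bsub>sections F U\<^esub> \<oplus>\<^bsub>sections G U\<^esub> \<phi> U \<zero>\<^bsub>sections F U\<^esub> = \<phi> U \<zero>\<^bsub>sections F U\<^esub>"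
    using presheaf_morD(2)[OF assms(3,4) MU.zero_closed MU.zero_closed] by simp
  then show ?thesis using presheaf_morD(1)[OF assms(3,4) MU.zero_closed] by (metis NU.add.r_cancel_one')
qed

lemma presheaf_mor_compose:
  assumes "presheaf_mor X F G \<phi>" "presheaf_mor X G H \<psi>"
  shows "presheaf_mor X F H (\<lambda>U m. \<psi> U (\<phi> U m))"
  unfolding presheaf_mor_def semilinear_def carrier_regular_ring
  using presheaf_morD[OF assms(1)] presheaf_morD[OF assms(2)] by simp

lemma presheaf_mor_sheaf_homs:
  assumes "presheaf_mod X F" "presheaf_mor X F G \<phi>"
  shows "ext_mor X F \<phi> \<in> sheaf_homs X X F G"
proof -
  interpret F: presheaf_mod X F by fact
  show ?thesis
    unfolding sheaf_homs_def
  proof (intro CollectI conjI ballI impI)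
    show "ext_mor X F \<phi> \<in> (\<Pi>\<^sub>E V\<in>{V \<in> opens X. V \<subseteq> X}. Sec F V \<rightarrow>\<^sub>E Sec G V)"
    proof -
      have "{V \<in> opens X. V \<subseteq> X} = opens X" using opens_subset by blast
      then show ?thesis using presheaf_morD(1)[OF assms(2)] by (auto simp: ext_mor_def PiE_iff)
    qed
    fix V assume V: "V \<in> opens X"
    interpret MV: module "regular_ring X V" "sections F V" using F.module V by blast
    show "ext_mor X F \<phi> V (m \<oplus>\<^bsub>sections F V\<^esub> n) = ext_mor X F \<phi> V m \<oplus>\<^bsub>sections G V\<^esub> ext_mor X F \<phi> V n"
      if "m \<in> Sec F V" "n \<in> Sec F V" for m n
      using that V presheaf_morD(2)[OF assms(2) V] by (simp add: ext_mor_def)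
    show "ext_mor X F \<phi> V (f \<odot>\<^bsub>sections F V\<^esub> m) = f \<odot>\<^bsub>sections G V\<^esub> ext_mor X F \<phi> V m"
      if "f \<in> regular X V" "m \<in> Sec F V" for f m
      using that V presheaf_morD(3)[OF assms(2) V] MV.smult_closed[of f m] by (simp add: ext_mor_def)
    fix W m assume W: "W \<in> opens X" "W \<subseteq> V \<and> V \<subseteq> X" and m: "m \<in> Sec F V"
    show "ext_mor X F \<phi> W (restr F V W m) = restr G V W (ext_mor X F \<phi> V m)"
      using V W m presheaf_morD(4)[OF assms(2) V] F.restr_closed[of V W m] by (simp add: ext_mor_def)
  qed
qed

lemma ext_mor_apply [simp]: "\<lbrakk>U \<in> opens X; m \<in> Sec F U\<rbrakk> \<Longrightarrow> ext_mor X F \<phi> U m = \<phi> U m"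
  by (simp add: ext_mor_def)

locale sheaf_mod =
  fixes X :: "'n::finite pt set" and F :: "('n pt, 'm) presheaf"
  assumes sheaf: "sheaf_of_modules X F"
begin

sublocale presheaf_mod X F
  using sheaf by unfold_locales (simp add: sheaf_of_modules_def)

text \<open>The cover consists of all open subsets on which the two sections agree; both are then
  gluings of one and the same family.\<close>

lemma section_eqI:
  assumes U: "U \<in> opens X" and m: "m \<in> Sec F U" "n \<in> Sec F U"
    and loc: "\<And>x. x \<in> U \<Longrightarrow> \<exists>V\<in>opens X. x \<in> V \<and> V \<subseteq> U \<and> restr F U V m = restr F U V n"
  shows "m = n"
proof -
  define \<U> where "\<U> = {V \<in> opens X. V \<subseteq> U \<and> restr F U V m = restr F U V n}"
  have un: "\<Union>\<U> = U" using loc unfolding \<U>_def by blast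
  have "\<exists>!k. k \<in> Sec F (\<Union>\<U>) \<and> (\<forall>V\<in>\<U>. restr F (\<Union>\<U>) V k = restr F U V m)"
  proof (rule sheaf[unfolded sheaf_of_modules_def, THEN conjunct2, rule_format], intro conjI ballI)
    show "\<U> \<subseteq> opens X" by (auto simp: \<U>_def)
    show "restr F U V m \<in> Sec F V" if "V \<in> \<U>" for V using that U m by (auto simp: \<U>_def)
    show "restr F V (V \<inter> W) (restr F U V m) = restr F W (V \<inter> W) (restr F U W m)" if "V \<in> \<U>" "W \<in> \<U>" for V W
      using that U m by (auto simp: \<U>_def restr_restr opens_Int)
  qed
  moreover have "m \<in> Sec F (\<Union>\<U>) \<and> (\<forall>V\<in>\<U>. restr F (\<Union>\<U>) V m = restr F U V m)"
     "n \<in> Sec F (\<Union>\<U>) \<and> (\<forall>V\<in>\<U>. restr F (\<Union>\<U>) V n = restr F U V m)"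
    using m un by (auto simp: \<U>_def)
  ultimately show ?thesis by blast
qed

lemma glue:
  assumes "\<U> \<subseteq> opens X" "\<And>V. V \<in> \<U> \<Longrightarrow> m V \<in> Sec F V"
    "\<And>V W. \<lbrakk>V \<in> \<U>; W \<in> \<U>\<rbrakk> \<Longrightarrow> restr F V (V \<inter> W) (m V) = restr F W (V \<inter> W) (m W)"
  obtains n where "n \<in> Sec F (\<Union>\<U>)" "\<And>V. V \<in> \<U> \<Longrightarrow> restr F (\<Union>\<U>) V n = m V"
proof -
  have "\<exists>!n. n \<in> Sec F (\<Union>\<U>) \<and> (\<forall>V\<in>\<U>. restr F (\<Union>\<U>) V n = m V)"
    by (rule sheaf[unfolded sheaf_of_modules_def, THEN conjunct2, rule_format]) (use assms in auto)
  then show thesis using that by blast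
qed

end

context presheaf_mod
begin

lemma restrict_germ_section_trans:
  assumes "restrict s V = germ_section X F V m" "V \<in> opens X" "W \<in> opens X" "W \<subseteq> V" "m \<in> Sec F V"
  shows "restrict s W = germ_section X F W (restr F V W m)"
  using restrict_germ_section[of W V m] assms by (metis restrict_restrict inf.absorb_iff2)

lemma germ_section_eqD:
  assumes "germ_section X F V m = germ_section X F V n" "V \<in> opens X" "n \<in> Sec F V" "x \<in> V"
  obtains W where "W \<in> opens X" "x \<in> W" "W \<subseteq> V" "restr F V W m = restr F V W n"
proof -
  have "germ X F x V m = germ X F x V n" using assms by (metis germ_section_at)
  then show thesis using germ_eqD assms that by metis
qed

text \<open>Where \<open>s\<close> is the germ section of \<open>m\<close>, the lift has to be
  \<open>\<phi> V m\<close>. This value is independent of \<open>m\<close>, since equal germ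
  sections agree near each point and \<open>G\<close> is separated; for the same reason the values
  match on overlaps and can be glued.\<close>

lemma sheafify_lift_exists:
  assumes G: "sheaf_of_modules X G" and \<phi>: "presheaf_mor X F G \<phi>"
  shows "\<exists>\<psi>. presheaf_mor X SF G \<psi> \<and> (\<forall>U\<in>opens X. \<forall>m\<in>Sec F U. \<psi> U (germ_section X F U m) = \<phi> U m)"
proof -
  interpret G: sheaf_mod X G by unfold_locales fact
  interpret S: presheaf_mod X SF by unfold_locales (rule presheaf_sheafify)
  note \<phi>D = presheaf_morD[OF \<phi>]
  have inj: "\<phi> V m = \<phi> V n"
    if V: "V \<in> opens X" and mn: "m \<in> Sec F V" "n \<in> Sec F V" and eq: "germ_section X F V m = germ_section X F V n" for V m n
  proof (rule G.section_eqI[OF V])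
    fix x assume "x \<in> V"
    then obtain W where W: "W \<in> opens X" "x \<in> W" "W \<subseteq> V" "restr F V W m = restr F V W n"
      using germ_section_eqD[OF eq V mn(2)] by metis
    then show "\<exists>W\<in>opens X. x \<in> W \<and> W \<subseteq> V \<and> restr G V W (\<phi> V m) = restr G V W (\<phi> V n)"
      using \<phi>D(4)[OF V, of W m] \<phi>D(4)[OF V, of W n] mn by (intro bexI[of _ W]) simp_all
  qed (use \<phi>D(1) V mn in auto)
  \<comment> \<open>The condition ranges over all local representatives of \<open>s\<close> at once,
    so it can later be applied to whichever representative is at hand.\<close>
  define lifts where "lifts U s n \<longleftrightarrow> n \<in> Sec G U \<and> (\<forall>V\<in>opens X. V \<subseteq> U \<longrightarrow>
     (\<forall>m\<in>Sec F V. restrict s V = germ_section X F V m \<longrightarrow> restr G U V n = \<phi> V m))" for U s n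
  have ex: "\<exists>n. lifts U s n" if U: "U \<in> opens X" and s: "s \<in> Sec SF U" for U s
  proof -
    define \<U> where "\<U> = {V \<in> opens X. V \<subseteq> U \<and> (\<exists>m\<in>Sec F V. restrict s V = germ_section X F V m)}"
    have un: "\<Union>\<U> = U"
    proof
      show "U \<subseteq> \<Union>\<U>"
      proof
        fix x assume "x \<in> U"
        then obtain V m where "V \<in> opens X" "x \<in> V" "V \<subseteq> U" "m \<in> Sec F V"
          "restrict s V = germ_section X F V m" using sheafify_local[OF U s] by metis
        then show "x \<in> \<Union>\<U>" unfolding \<U>_def by blast
      qed
    qed (auto simp: \<U>_def)
    have "\<exists>m. m \<in> Sec F V \<and> restrict s V = germ_section X F V m" if "V \<in> \<U>" for V
      using that by (auto simp: \<U>_def)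
    then obtain m where m: "\<And>V. V \<in> \<U> \<Longrightarrow> m V \<in> Sec F V \<and> restrict s V = germ_section X F V (m V)" by metis
    have open\<U>: "V \<in> opens X" if "V \<in> \<U>" for V using that by (auto simp: \<U>_def)
    obtain n where n: "n \<in> Sec G (\<Union>\<U>)" "\<And>V. V \<in> \<U> \<Longrightarrow> restr G (\<Union>\<U>) V n = \<phi> V (m V)"
    proof (rule G.glue[of \<U> "\<lambda>V. \<phi> V (m V)"])
      show "\<U> \<subseteq> opens X" using open\<U> by blast
      show "\<phi> V (m V) \<in> Sec G V" if "V \<in> \<U>" for V using that m open\<U> \<phi>D(1) by blast
      fix V W assume VW: "V \<in> \<U>" "W \<in> \<U>"
      then have o: "V \<in> opens X" "W \<in> opens X" "V \<inter> W \<in> opens X" using open\<U> opens_Int by blast+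
      have "germ_section X F (V \<inter> W) (restr F V (V \<inter> W) (m V)) = germ_section X F (V \<inter> W) (restr F W (V \<inter> W) (m W))"
        using restrict_germ_section_trans[of s V "m V" "V \<inter> W"] restrict_germ_section_trans[of s W "m W" "V \<inter> W"]
          m VW o by simp
      then have "\<phi> (V \<inter> W) (restr F V (V \<inter> W) (m V)) = \<phi> (V \<inter> W) (restr F W (V \<inter> W) (m W))"
        using inj[OF o(3)] o m VW by simp
      then show "restr G V (V \<inter> W) (\<phi> V (m V)) = restr G W (V \<inter> W) (\<phi> W (m W))"
        using \<phi>D(4)[of V "V \<inter> W" "m V"] \<phi>D(4)[of W "V \<inter> W" "m W"] o m VW by simp
    qed (rule that)
    have "restr G U V n = \<phi> V k" if "V \<in> opens X" "V \<subseteq> U" "k \<in> Sec F V" "restrict s V = germ_section X F V k" for V k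
    proof -
      have "V \<in> \<U>" using that by (auto simp: \<U>_def)
      then show ?thesis using n(2)[of V] un inj[of V k "m V"] m[of V] that by auto
    qed
    then have "lifts U s n" using n un by (auto simp: lifts_def)
    then show ?thesis ..
  qed
  \<comment> \<open>Conversely, to recognise the lift it is enough to test one representative near
    each point. In the form \<open>\<psi>I\<close> this gives additivity, linearity, naturality and
    the value on germ sections.\<close>
  have uniq: "n = k" if U: "U \<in> opens X" and s: "s \<in> Sec SF U" and n: "n \<in> Sec G U" and k: "lifts U s k"
    and loc: "\<And>x. x \<in> U \<Longrightarrow> \<exists>V\<in>opens X. x \<in> V \<and> V \<subseteq> U \<and>
       (\<exists>m\<in>Sec F V. restrict s V = germ_section X F V m \<and> restr G U V n = \<phi> V m)" for U s n k
  proof (rule G.section_eqI[OF U n])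
    show "k \<in> Sec G U" using k by (simp add: lifts_def)
    fix x assume "x \<in> U"
    then obtain V m where "V \<in> opens X" "x \<in> V" "V \<subseteq> U" "m \<in> Sec F V" "restrict s V = germ_section X F V m"
      "restr G U V n = \<phi> V m" using loc by metis
    then show "\<exists>V\<in>opens X. x \<in> V \<and> V \<subseteq> U \<and> restr G U V n = restr G U V k"
      using k by (auto simp: lifts_def)
  qed
  define \<psi> where "\<psi> U s = (SOME n. lifts U s n)" for U s
  have \<psi>: "lifts U s (\<psi> U s)" if "U \<in> opens X" "s \<in> Sec SF U" for U s
    unfolding \<psi>_def by (rule someI_ex[OF ex[OF that]])
  have \<psi>I: "n = \<psi> U s" if U: "U \<in> opens X" and s: "s \<in> Sec SF U" and n: "n \<in> Sec G U"
    and loc: "\<And>x. x \<in> U \<Longrightarrow> \<exists>V\<in>opens X. x \<in> V \<and> V \<subseteq> U \<and>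
       (\<exists>m\<in>Sec F V. restrict s V = germ_section X F V m \<and> restr G U V n = \<phi> V m)" for U s n
    using uniq[OF U s n \<psi>[OF U s] loc] .
  have \<psi>c: "\<psi> U s \<in> Sec G U" if "U \<in> opens X" "s \<in> Sec SF U" for U s
    using \<psi>[OF that] by (simp add: lifts_def)
  have \<psi>r: "restr G U V (\<psi> U s) = \<phi> V m"
    if "U \<in> opens X" "s \<in> Sec SF U" "V \<in> opens X" "V \<subseteq> U" "m \<in> Sec F V" "restrict s V = germ_section X F V m" for U s V m
    using \<psi>[OF that(1,2)] that(3-) by (simp add: lifts_def)
  have "presheaf_mor X SF G \<psi>"
    unfolding presheaf_mor_def semilinear_def carrier_regular_ring
  proof (intro ballI conjI impI)
    fix U assume U: "U \<in> opens X"
    interpret SU: module "regular_ring X U" "sections SF U" using S.module[OF U] .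
    interpret GU: module "regular_ring X U" "sections G U" using G.module[OF U] .
    show "\<psi> U s \<in> Sec G U" if "s \<in> Sec SF U" for s using \<psi>c[OF U that] .
    show "f \<in> regular X U" if "f \<in> regular X U" for f using that .
    show "\<psi> U (s \<oplus>\<^bsub>sections SF U\<^esub> t) = \<psi> U s \<oplus>\<^bsub>sections G U\<^esub> \<psi> U t" if st: "s \<in> Sec SF U" "t \<in> Sec SF U" for s t
    proof (rule \<psi>I[OF U, symmetric])
      show "s \<oplus>\<^bsub>sections SF U\<^esub> t \<in> Sec SF U" using st by simp
      show "\<psi> U s \<oplus>\<^bsub>sections G U\<^esub> \<psi> U t \<in> Sec G U" using st \<psi>c[OF U] by simp
      fix x assume "x \<in> U"
      with sheafify_local2[OF U st] obtain V m n where V: "V \<in> opens X" "x \<in> V" "V \<subseteq> U" and mn: "m \<in> Sec F V" "n \<in> Sec F V"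
          "restrict s V = germ_section X F V m" "restrict t V = germ_section X F V n" by metis
      interpret MV: module "regular_ring X V" "sections F V" using module V by blast
      show "\<exists>V\<in>opens X. x \<in> V \<and> V \<subseteq> U \<and> (\<exists>m\<in>Sec F V. restrict (s \<oplus>\<^bsub>sections SF U\<^esub> t) V = germ_section X F V m \<and>
          restr G U V (\<psi> U s \<oplus>\<^bsub>sections G U\<^esub> \<psi> U t) = \<phi> V m)"
        using V mn st U \<psi>c[OF U] \<psi>r[OF U _ V(1) V(3)]
        by (intro bexI[of _ V] conjI bexI[of _ "m \<oplus>\<^bsub>sections F V\<^esub> n"])
          (simp_all add: restrict_sheafify_add germ_section_add G.restr_add \<phi>D(2) del: restrict_apply)
    qed
    show "\<psi> U (f \<odot>\<^bsub>sections SF U\<^esub> s) = f \<odot>\<^bsub>sections G U\<^esub> \<psi> U s" if f: "f \<in> regular X U" and s: "s \<in> Sec SF U" for f s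
    proof (rule \<psi>I[OF U, symmetric])
      show "f \<odot>\<^bsub>sections SF U\<^esub> s \<in> Sec SF U" using s f by simp
      show "f \<odot>\<^bsub>sections G U\<^esub> \<psi> U s \<in> Sec G U" using s f \<psi>c[OF U] by simp
      fix x assume "x \<in> U"
      with sheafify_local[OF U s] obtain V m where V: "V \<in> opens X" "x \<in> V" "V \<subseteq> U" and m: "m \<in> Sec F V"
          "restrict s V = germ_section X F V m" by metis
      interpret MV: module "regular_ring X V" "sections F V" using module V by blast
      have fV: "restrict f V \<in> regular X V" using regular_restrict f V by blast
      show "\<exists>V\<in>opens X. x \<in> V \<and> V \<subseteq> U \<and> (\<exists>m\<in>Sec F V. restrict (f \<odot>\<^bsub>sections SF U\<^esub> s) V = germ_section X F V m \<and>
          restr G U V (f \<odot>\<^bsub>sections G U\<^esub> \<psi> U s) = \<phi> V m)"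
        using V m s U f fV \<psi>c[OF U] \<psi>r[OF U s V(1) V(3)]
        by (intro bexI[of _ V] conjI bexI[of _ "restrict f V \<odot>\<^bsub>sections F V\<^esub> m"])
          (simp_all add: restrict_sheafify_smult germ_section_smult G.restr_smult \<phi>D(3) del: restrict_apply)
    qed
    fix V s assume V: "V \<in> opens X" "V \<subseteq> U" and s: "s \<in> Sec SF U"
    have sV: "restrict s V \<in> Sec SF V" using S.restr_closed[OF U V s] by simp
    have "restr G U V (\<psi> U s) = \<psi> V (restrict s V)"
    proof (rule \<psi>I[OF V(1) sV])
      show "restr G U V (\<psi> U s) \<in> Sec G V" using U V \<psi>c[OF U s] by simp
      fix x assume x: "x \<in> V"
      with V have xU: "x \<in> U" by auto
      obtain W m where W: "W \<in> opens X" "x \<in> W" "W \<subseteq> U" "W \<subseteq> V" "m \<in> Sec F W" "restrict s W = germ_section X F W m"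
        using sheafify_local_subset[OF U s xU V(1) x] by metis
      then show "\<exists>W\<in>opens X. x \<in> W \<and> W \<subseteq> V \<and> (\<exists>m\<in>Sec F W. restrict (restrict s V) W = germ_section X F W m \<and>
          restr G V W (restr G U V (\<psi> U s)) = \<phi> W m)"
        using U V \<psi>c[OF U s] \<psi>r[OF U s W(1) W(3)]
        by (intro bexI[of _ W] conjI bexI[of _ m])
          (simp_all add: G.restr_restr restrict_restrict Int_absorb1 del: restrict_apply)
    qed
    then show "\<psi> V (restr SF U V s) = restr G U V (\<psi> U s)" by simp
  qed
  moreover have "\<psi> U (germ_section X F U m) = \<phi> U m" if U: "U \<in> opens X" and m: "m \<in> Sec F U" for U m
  proof (rule \<psi>I[OF U germ_section_closed[OF U m], symmetric])
    show c: "\<phi> U m \<in> Sec G U" using \<phi>D(1)[OF U m] .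
    show "\<exists>V\<in>opens X. x \<in> V \<and> V \<subseteq> U \<and> (\<exists>k\<in>Sec F V. restrict (germ_section X F U m) V = germ_section X F V k \<and>
        restr G U V (\<phi> U m) = \<phi> V k)" if "x \<in> U" for x
      using U m that c by (intro bexI[of _ U] conjI bexI[of _ m])
        (simp_all add: restrict_germ_section restr_self G.restr_self del: restrict_apply)
  qed
  ultimately show ?thesis by blast
qed

text \<open>Two representatives of a germ agree on a smaller neighbourhood, and
  \<open>\<phi>\<close> commutes with restriction, so the union that defines
  \<open>sheafify_hom\<close> has equal members.\<close>

lemma sheafify_hom_germ_section:
  assumes \<phi>: "presheaf_mor X F G \<phi>" and G: "presheaf_of_modules X G" and U: "U \<in> opens X" and m: "m \<in> Sec F U"
  shows "sheafify_hom X F G \<phi> U (germ_section X F U m) = germ_section X G U (\<phi> U m)"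
proof -
  interpret G: presheaf_mod X G by unfold_locales fact
  have "(\<Union>(V, n)\<in>germ X F x U m. germ X G x V (\<phi> V n)) = germ X G x U (\<phi> U m)" if x: "x \<in> U" for x
  proof -
    have "germ X G x V (\<phi> V n) = germ X G x U (\<phi> U m)" if Vn: "(V, n) \<in> germ X F x U m" for V n
    proof -
      obtain W where W: "W \<in> opens X" "x \<in> W" "W \<subseteq> U" "W \<subseteq> V" "restr F U W m = restr F V W n"
        using Vn by (auto simp: germ_def)
      note V = germ_memD[OF Vn]
      show ?thesis
        using W V U m presheaf_morD(1)[OF \<phi>] presheaf_morD(4)[OF \<phi> U, of W m] presheaf_morD(4)[OF \<phi> V(1), of W n]
        by (intro G.germ_eqI[of W]) auto
    qed
    then show ?thesis using germ_self[OF U x m] by fast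
  qed
  then show ?thesis
    using U germ_section_closed[OF U m] by (auto simp: sheafify_hom_def germ_section_def fun_eq_iff)
qed

lemma restrict_sheafify_hom:
  assumes "U \<in> opens X" "V \<in> opens X" "V \<subseteq> U" "s \<in> Sec SF U"
  shows "restrict (sheafify_hom X F G \<phi> U s) V = sheafify_hom X F G \<phi> V (restrict s V)"
proof -
  interpret S: presheaf_mod X SF by unfold_locales (rule presheaf_sheafify)
  have "restrict s V \<in> Sec SF V" using S.restr_closed[OF assms] by simp
  then show ?thesis using assms by (auto simp: sheafify_hom_def restrict_def fun_eq_iff)
qed

end


section \<open>The Zariski topology and regular functions\<close>

lemma homogeneous_const: "homogeneous 0 (\<lambda>v :: complex ^ 'n::finite. c)"
proof -
  have "{m :: 'n \<Rightarrow> nat. (\<Sum>i\<in>UNIV. m i) = 0} = {\<lambda>_. 0}" by (auto simp: fun_eq_iff)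
  then show ?thesis unfolding homogeneous_def by (intro exI[of _ "\<lambda>_. c"]) simp
qed

text \<open>The exponent vectors of total degree 1 are the unit vectors \<open>e k\<close>, so the
  sum over monomials is the sum over coordinates, reindexed along the injective map
  \<open>e\<close>.\<close>

lemma homogeneous_linear: "homogeneous 1 (\<lambda>v :: complex ^ 'n::finite. \<Sum>k\<in>UNIV. c k * v $ k)"
proof -
  define e :: "'n \<Rightarrow> 'n \<Rightarrow> nat" where "e k = (\<lambda>j. if j = k then 1 else 0)" for k
  have inj: "inj e" unfolding e_def by (rule injI) (metis zero_neq_one)
  have M: "{m :: 'n \<Rightarrow> nat. (\<Sum>i\<in>UNIV. m i) = 1} = range e"
  proof (intro equalityI subsetI)
    fix m :: "'n \<Rightarrow> nat" assume "m \<in> {m. (\<Sum>i\<in>UNIV. m i) = 1}"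
    then have "\<exists>k. m k = 1 \<and> (\<forall>j. k \<noteq> j \<longrightarrow> m j = 0)" using sum_eq_1_iff[of UNIV m] by simp
    then obtain k where "m k = 1" "\<And>j. k \<noteq> j \<Longrightarrow> m j = 0" by blast
    then have "m = e k" by (auto simp: e_def fun_eq_iff)
    then show "m \<in> range e" by blast
  qed (auto simp: e_def)
  have p: "(\<Prod>i\<in>UNIV. (v $ i) ^ e k i) = v $ k" for v :: "complex ^ 'n" and k
  proof -
    have "(\<Prod>i\<in>UNIV. (v $ i) ^ e k i) = (\<Prod>i\<in>UNIV. if i = k then v $ i else 1)"
      by (intro prod.cong) (auto simp: e_def)
    then show ?thesis by simp
  qed
  have "(\<Sum>k\<in>UNIV. c k * v $ k) = (\<Sum>m | (\<Sum>i\<in>UNIV. m i) = 1. c (inv_into UNIV e m) * (\<Prod>i\<in>UNIV. (v $ i) ^ m i))" for v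
    unfolding M by (simp add: sum.reindex[OF inj] p inv_f_f[OF inj])
  then show ?thesis unfolding homogeneous_def by (intro exI[of _ "\<lambda>m. c (inv_into UNIV e m)"]) blast
qed

lemma topspace_zariski_projective: "topspace zariski_projective \<subseteq> projective_space"
  unfolding zariski_projective_def topology_generated_by_topspace principal_open_def by blast

lemma openin_principal_open: "homogeneous d f \<Longrightarrow> openin zariski_projective (principal_open f)"
  unfolding zariski_projective_def by (rule topology_generated_by_Basis) blast

lemma opens_principal_open: "homogeneous d f \<Longrightarrow> principal_open f \<inter> X \<in> opens X"
  unfolding opens_def zariski_def
  using openin_principal_open openin_subtopology_Int by blast

lemma opens_locally:
  assumes "\<And>x. x \<in> S \<Longrightarrow> \<exists>T\<in>opens X. x \<in> T \<and> T \<subseteq> S"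
  shows "S \<in> opens X"
proof -
  have "openin (zariski X) S"
  proof (rule iffD2[OF openin_subopen], intro ballI)
    fix x assume "x \<in> S"
    then show "\<exists>T. openin (zariski X) T \<and> x \<in> T \<and> T \<subseteq> S" using assms[of x] by (auto simp: opens_def)
  qed
  then show ?thesis by (simp add: opens_def)
qed

lemma projective_space_nonzero:
  assumes "p \<in> projective_space" shows "\<exists>v. v \<in> p - {0}"
proof -
  obtain v where v: "p = range (\<lambda>a. a *s v)" "v \<noteq> 0" using assms by (auto simp: projective_space_def)
  have "1 *s v \<in> p" unfolding v(1) by (rule rangeI)
  then show ?thesis using v(2) by (intro exI[of _ v]) simp
qed

text \<open>If \<open>v\<close> and \<open>w\<close> span different lines, some 2 by 2 minor of the
  pair is nonzero. That minor, with \<open>w\<close> fixed and the other vector variable, is a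
  linear form that vanishes at \<open>w\<close> but not at \<open>v\<close>.\<close>

lemma projective_space_separated:
  fixes p q :: "'n::finite pt"
  assumes p: "p \<in> projective_space" and q: "q \<in> projective_space" and ne: "p \<noteq> q"
  shows "\<exists>f. homogeneous 1 f \<and> p \<in> principal_open f \<and> q \<notin> principal_open f"
proof -
  obtain v where v: "p = range (\<lambda>a. a *s v)" "v \<noteq> 0" using p by (auto simp: projective_space_def)
  obtain w where w: "q = range (\<lambda>a. a *s w)" "w \<noteq> 0" using q by (auto simp: projective_space_def)
  have "\<exists>i j. v $ i * w $ j \<noteq> v $ j * w $ i"
  proof (rule ccontr)
    assume "\<not> ?thesis"
    then have *: "v $ i * w $ j = v $ j * w $ i" for i j by blast
    obtain j where j: "w $ j \<noteq> 0" using w(2) by (auto simp: vec_eq_iff)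
    define c where "c = v $ j / w $ j"
    have vc: "v = c *s w" using *[of _ j] j by (auto simp: vec_eq_iff c_def field_simps)
    then have c: "c \<noteq> 0" using v(2) by auto
    have "range (\<lambda>a. a *s v) = range (\<lambda>a. a *s w)"
    proof (intro equalityI image_subsetI)
      fix a
      have "a *s v = (a * c) *s w" by (simp add: vc vector_smult_assoc)
      then show "a *s v \<in> range (\<lambda>a. a *s w)" by blast
      have "a *s w = (a / c) *s v" using c by (simp add: vc vector_smult_assoc)
      then show "a *s w \<in> range (\<lambda>a. a *s v)" by blast
    qed
    then show False using ne v w by simp
  qed
  then obtain i j where ij: "v $ i * w $ j \<noteq> v $ j * w $ i" by blast
  define f where "f = (\<lambda>u :: complex ^ 'n. w $ j * u $ i - w $ i * u $ j)"
  have "f = (\<lambda>u. \<Sum>k\<in>UNIV. ((if k = i then w $ j else 0) - (if k = j then w $ i else 0)) * u $ k)"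
    by (simp add: f_def left_diff_distrib sum_subtractf if_distrib[of "\<lambda>c. c * _"] cong: if_cong)
  then have hf: "homogeneous 1 f" using homogeneous_linear[of "\<lambda>k. (if k = i then w $ j else 0) - (if k = j then w $ i else 0)"] by simp
  have "f u \<noteq> 0" if u: "u \<in> p - {0}" for u
  proof -
    obtain a where a: "u = a *s v" using u unfolding v(1) by blast
    then have "a \<noteq> 0" using u by (auto simp: vec_eq_iff)
    have "f u = a * (v $ i * w $ j - v $ j * w $ i)" by (simp add: f_def a algebra_simps)
    then show ?thesis using \<open>a \<noteq> 0\<close> ij by simp
  qed
  then have "p \<in> principal_open f" using p by (simp add: principal_open_def)
  moreover have "q \<notin> principal_open f"
  proof -
    have "1 *s w \<in> q" unfolding w(1) by (rule rangeI)
    then have "w \<in> q - {0}" using w(2) by simp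
    moreover have "f w = 0" by (simp add: f_def)
    ultimately show ?thesis by (auto simp: principal_open_def)
  qed
  ultimately show ?thesis using hf by blast
qed

section \<open>Regular functions and their zero sets\<close>

lemma regularE:
  assumes "h \<in> regular X U" "x \<in> U"
  obtains W d f g where "W \<in> opens X" "x \<in> W" "W \<subseteq> U" "homogeneous d f" "homogeneous d g"
     "\<forall>p\<in>W. \<forall>v \<in> p - {0}. g v \<noteq> 0 \<and> h p = f v / g v"
proof -
  have "\<exists>W\<in>opens X. x \<in> W \<and> W \<subseteq> U \<and> (\<exists>d f g. homogeneous d f \<and> homogeneous d g \<and>
        (\<forall>p\<in>W. \<forall>v \<in> p - {0}. g v \<noteq> 0 \<and> h p = f v / g v))"
    using assms by (simp add: regular_def)
  then show thesis using that by (elim bexE exE conjE)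
qed

lemma regular_locally:
  assumes "h \<in> extensional U"
    and loc: "\<And>x. x \<in> U \<Longrightarrow> \<exists>V\<in>opens X. x \<in> V \<and> V \<subseteq> U \<and> restrict h V \<in> regular X V"
  shows "h \<in> regular X U"
  unfolding regular_def
proof (intro CollectI conjI ballI)
  fix x assume "x \<in> U"
  then obtain V where V: "V \<in> opens X" "x \<in> V" "V \<subseteq> U" "restrict h V \<in> regular X V" using loc by blast
  obtain W d f g where W: "W \<in> opens X" "x \<in> W" "W \<subseteq> V" "homogeneous d f" "homogeneous d g"
     "\<forall>p\<in>W. \<forall>v \<in> p - {0}. g v \<noteq> 0 \<and> restrict h V p = f v / g v"
    using regularE[OF V(4,2)] by metis
  then have "\<forall>p\<in>W. \<forall>v \<in> p - {0}. g v \<noteq> 0 \<and> h p = f v / g v" by (metis restrict_apply' subsetD)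
  then show "\<exists>V\<in>opens X. x \<in> V \<and> V \<subseteq> U \<and> (\<exists>d f g. homogeneous d f \<and> homogeneous d g \<and>
        (\<forall>p\<in>V. \<forall>v \<in> p - {0}. g v \<noteq> 0 \<and> h p = f v / g v))"
    using W(1,2) subset_trans[OF W(3) V(3)] W(4,5) by (intro bexI conjI exI)
qed fact

lemma regular_const: "U \<in> opens X \<Longrightarrow> (\<lambda>x\<in>U. c) \<in> regular X U"
  unfolding regular_def
proof (intro CollectI conjI ballI)
  fix x assume "U \<in> opens X" "x \<in> U"
  then show "\<exists>V\<in>opens X. x \<in> V \<and> V \<subseteq> U \<and> (\<exists>d f g. homogeneous d f \<and> homogeneous d g \<and>
        (\<forall>p\<in>V. \<forall>v \<in> p - {0}. g v \<noteq> 0 \<and> (\<lambda>x\<in>U. c) p = f v / g v))"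
    using homogeneous_const[of c] homogeneous_const[of 1]
    by (intro bexI[of _ U] conjI exI[of _ "0::nat"] exI[where x = "\<lambda>_. c"] exI[where x = "\<lambda>_. 1"])
      simp_all
qed simp

text \<open>Near each point \<open>h\<close> is a quotient f / g of forms with g nowhere zero, so
  its nonvanishing locus there is the principal open set of the numerator.\<close>

lemma regular_nonzero_open:
  assumes X: "X \<subseteq> projective_space" and U: "U \<in> opens X" and h: "h \<in> regular X U"
  shows "{x \<in> U. h x \<noteq> 0} \<in> opens X"
proof (rule opens_locally)
  fix x assume x: "x \<in> {x \<in> U. h x \<noteq> 0}"
  then have "x \<in> U" by simp
  from regularE[OF h this] obtain W d f g where W: "W \<in> opens X" "x \<in> W" "W \<subseteq> U"
     "homogeneous d f" "homogeneous d g" "\<forall>p\<in>W. \<forall>v \<in> p - {0}. g v \<noteq> 0 \<and> h p = f v / g v" by metis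
  have WX: "W \<subseteq> X" using opens_subset W(1) .
  have iff: "p \<in> principal_open f \<longleftrightarrow> h p \<noteq> 0" if p: "p \<in> W" for p
  proof -
    have "p \<in> projective_space" using p WX X by blast
    then show ?thesis
    proof (intro iffI)
      assume "p \<in> principal_open f"
      moreover obtain v where "v \<in> p - {0}" using projective_space_nonzero \<open>p \<in> projective_space\<close> by blast
      ultimately show "h p \<noteq> 0" using W(6) p by (auto simp: principal_open_def)
    next
      assume "h p \<noteq> 0"
      then have "f v \<noteq> 0" if "v \<in> p - {0}" for v using W(6) p that by auto
      then show "p \<in> principal_open f" using \<open>p \<in> projective_space\<close> by (simp add: principal_open_def)
    qed
  qed
  show "\<exists>T\<in>opens X. x \<in> T \<and> T \<subseteq> {x \<in> U. h x \<noteq> 0}"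
  proof (intro bexI conjI)
    show "W \<inter> (principal_open f \<inter> X) \<in> opens X" using opens_Int[OF W(1) opens_principal_open[OF W(4)]] .
    show "x \<in> W \<inter> (principal_open f \<inter> X)" using x W WX iff by blast
    show "W \<inter> (principal_open f \<inter> X) \<subseteq> {x \<in> U. h x \<noteq> 0}" using W iff by blast
  qed
qed

text \<open>One linear form is used for each point of \<open>D\<close> other than \<open>x\<close>.
  In \<open>ideal_generator\<close> this isolates \<open>x\<close> from the rest of
  \<open>D\<close>, so that a local parameter at \<open>x\<close> vanishes on all of
  \<open>D\<close> within the neighbourhood.\<close>

lemma finite_separated_nbhd:
  assumes "X \<subseteq> projective_space" "x \<in> X" "X \<in> opens X" "finite D" "D \<subseteq> X"
  shows "\<exists>W\<in>opens X. x \<in> W \<and> W \<inter> D \<subseteq> {x}"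
  using assms(4,5)
proof (induction D rule: finite_induct)
  case empty
  then show ?case using assms by blast
next
  case (insert y D)
  then obtain W where W: "W \<in> opens X" "x \<in> W" "W \<inter> D \<subseteq> {x}" by auto
  show ?case
  proof (cases "y = x")
    case True
    then show ?thesis using W by blast
  next
    case False
    then obtain f where f: "homogeneous 1 f" "x \<in> principal_open f" "y \<notin> principal_open f"
      using projective_space_separated[of x y] assms insert.prems by blast
    have "W \<inter> (principal_open f \<inter> X) \<in> opens X" using opens_Int W opens_principal_open f by blast
    then show ?thesis using W f assms(2) by (intro bexI[of _ "W \<inter> (principal_open f \<inter> X)"]) auto
  qed
qed

text \<open>The ring axioms of the regular functions are assumed rather than derived: they are part of the
  module axioms and so come with any sheaf of modules on \<open>X\<close>.\<close>

locale irreducible_variety =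
  fixes X :: "'n::finite pt set"
  assumes irreducible: "irreducible_closed zariski_projective X"
    and cring: "U \<in> opens X \<Longrightarrow> cring (regular_ring X U)"
begin

lemma closedin: "closedin zariski_projective X"
  using irreducible by (simp add: irreducible_closed_def)

lemma subset_projective_space: "X \<subseteq> projective_space"
  using closedin_subset[OF closedin] topspace_zariski_projective by blast

lemma X_open: "X \<in> opens X"
  using closedin_subset[OF closedin] unfolding opens_def zariski_def
  by (metis mem_Collect_eq openin_topspace topspace_subtopology_subset)

text \<open>Disjoint open sets would have complements that are closed and cover \<open>X\<close>; by
  irreducibility one complement would contain \<open>X\<close>.\<close>

lemma opens_meet:
  assumes U: "U \<in> opens X" "U \<noteq> {}" and V: "V \<in> opens X" "V \<noteq> {}"
  shows "U \<inter> V \<noteq> {}"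
proof
  assume UV: "U \<inter> V = {}"
  obtain S where S: "openin zariski_projective S" "U = S \<inter> X"
    using U by (auto simp: opens_def zariski_def openin_subtopology)
  obtain T where T: "openin zariski_projective T" "V = T \<inter> X"
    using V by (auto simp: opens_def zariski_def openin_subtopology)
  let ?A = "topspace zariski_projective - S" and ?B = "topspace zariski_projective - T"
  have "closedin zariski_projective ?A" "closedin zariski_projective ?B" using S T by auto
  moreover have "X \<subseteq> ?A \<union> ?B" using closedin_subset[OF closedin] UV S T by auto
  ultimately have "X \<subseteq> ?A \<or> X \<subseteq> ?B" using irreducible unfolding irreducible_closed_def by blast
  then show False using U V S T by auto
qed

lemma regular_add: "\<lbrakk>U \<in> opens X; f \<in> regular X U; g \<in> regular X U\<rbrakk> \<Longrightarrow> (\<lambda>x\<in>U. f x + g x) \<in> regular X U"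
  using cring[THEN cring.axioms(1), THEN ring.ring_simprules(1), of U f g] by (simp add: regular_ring_def)

lemma regular_mult: "\<lbrakk>U \<in> opens X; f \<in> regular X U; g \<in> regular X U\<rbrakk> \<Longrightarrow> (\<lambda>x\<in>U. f x * g x) \<in> regular X U"
  using cring[THEN cring.axioms(1), THEN ring.ring_simprules(5), of U f g] by (simp add: regular_ring_def)

text \<open>Otherwise the two nonvanishing loci are nonempty open sets, and they meet.\<close>

lemma regular_integral:
  assumes U: "U \<in> opens X" and fg: "f \<in> regular X U" "g \<in> regular X U"
    and z: "\<And>x. x \<in> U \<Longrightarrow> f x * g x = 0"
  shows "(\<forall>x\<in>U. f x = 0) \<or> (\<forall>x\<in>U. g x = 0)"
proof (rule ccontr)
  assume "\<not> ?thesis"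
  then have "{x \<in> U. f x \<noteq> 0} \<noteq> {}" "{x \<in> U. g x \<noteq> 0} \<noteq> {}" by auto
  moreover have "{x \<in> U. f x \<noteq> 0} \<in> opens X" "{x \<in> U. g x \<noteq> 0} \<in> opens X"
    using regular_nonzero_open[OF subset_projective_space U] fg by auto
  ultimately obtain x where "x \<in> {x \<in> U. f x \<noteq> 0} \<inter> {x \<in> U. g x \<noteq> 0}" using opens_meet by blast
  then show False using z by auto
qed

text \<open>The identity principle: the nonvanishing locus would be a nonempty open set disjoint
  from \<open>V\<close>.\<close>

lemma regular_vanishing:
  assumes U: "U \<in> opens X" "f \<in> regular X U" and V: "V \<in> opens X" "V \<subseteq> U" "V \<noteq> {}" "\<And>x. x \<in> V \<Longrightarrow> f x = 0"
    and x: "x \<in> U"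
  shows "f x = 0"
proof (rule ccontr)
  assume "f x \<noteq> 0"
  then have "{x \<in> U. f x \<noteq> 0} \<inter> V \<noteq> {}"
    using opens_meet regular_nonzero_open[OF subset_projective_space U] V x by blast
  then show False using V by auto
qed

section \<open>The structure sheaf and the ideal sheaf of \<open>D\<close>\<close>

lemma structure_sheaf_simps [simp]:
  "Sec (structure_sheaf X) U = regular X U"
  "f \<oplus>\<^bsub>sections (structure_sheaf X) U\<^esub> g = (\<lambda>x\<in>U. f x + g x)"
  "f \<odot>\<^bsub>sections (structure_sheaf X) U\<^esub> g = (\<lambda>x\<in>U. f x * g x)"
  "\<zero>\<^bsub>sections (structure_sheaf X) U\<^esub> = (\<lambda>x\<in>U. 0)"
  "restr (structure_sheaf X) U V f = restrict f V"
  by (simp_all add: structure_sheaf_def)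

lemma module_structure_sheaf:
  assumes U: "U \<in> opens X" shows "module (regular_ring X U) (sections (structure_sheaf X) U)"
proof -
  interpret R: cring "regular_ring X U" using cring[OF U] .
  have ops: "f \<oplus>\<^bsub>regular_ring X U\<^esub> g = (\<lambda>x\<in>U. f x + g x)" "f \<otimes>\<^bsub>regular_ring X U\<^esub> g = (\<lambda>x\<in>U. f x * g x)"
    "\<zero>\<^bsub>regular_ring X U\<^esub> = (\<lambda>x\<in>U. 0)" "\<one>\<^bsub>regular_ring X U\<^esub> = (\<lambda>x\<in>U. 1)" for f g
    by (simp_all add: regular_ring_def)
  show ?thesis
  proof (rule moduleI[OF cring[OF U]])
    show "abelian_group (sections (structure_sheaf X) U)"
    proof (rule abelian_groupI)
      fix f assume f: "f \<in> Sec (structure_sheaf X) U"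
      show "\<exists>g\<in>Sec (structure_sheaf X) U. g \<oplus>\<^bsub>sections (structure_sheaf X) U\<^esub> f = \<zero>\<^bsub>sections (structure_sheaf X) U\<^esub>"
        using f R.l_neg[of f] R.a_inv_closed[of f] unfolding structure_sheaf_simps ops by auto
    qed (use R.a_closed R.a_assoc R.a_comm R.l_zero R.zero_closed in \<open>simp_all add: ops del: restrict_apply\<close>)
  qed (use R.l_distr R.r_distr R.m_assoc R.l_one R.m_closed in \<open>simp_all add: ops del: restrict_apply\<close>)
qed

lemma presheaf_structure_sheaf: "presheaf_of_modules X (structure_sheaf X)"
  unfolding presheaf_of_modules_def
proof (intro conjI ballI impI)
  show "module (regular_ring X U) (sections (structure_sheaf X) U)" if "U \<in> opens X" for U
    using module_structure_sheaf that .
  show "restr (structure_sheaf X) U U f = f" if "f \<in> Sec (structure_sheaf X) U" for U f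
    using that by (simp add: regular_def extensional_restrict)
  show "restr (structure_sheaf X) U V f \<in> Sec (structure_sheaf X) V"
    if "V \<in> opens X" "V \<subseteq> U" "f \<in> Sec (structure_sheaf X) U" for U V f
    using that regular_restrict[of f X U V] by simp
qed (auto simp: restrict_def fun_eq_iff)

lemma sheaf_structure_sheaf: "sheaf_of_modules X (structure_sheaf X)"
  unfolding sheaf_of_modules_def
proof (intro conjI allI impI presheaf_structure_sheaf)
  fix \<U> m
  assume "\<U> \<subseteq> opens X \<and> (\<forall>U\<in>\<U>. m U \<in> Sec (structure_sheaf X) U) \<and>
     (\<forall>U\<in>\<U>. \<forall>V\<in>\<U>. restr (structure_sheaf X) U (U \<inter> V) (m U) = restr (structure_sheaf X) V (U \<inter> V) (m V))"
  then have op: "\<U> \<subseteq> opens X" and m: "\<And>U. U \<in> \<U> \<Longrightarrow> m U \<in> regular X U"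
    and eq: "\<And>U V. \<lbrakk>U \<in> \<U>; V \<in> \<U>\<rbrakk> \<Longrightarrow> restrict (m U) (U \<inter> V) = restrict (m V) (U \<inter> V)" by auto
  have ext: "m U \<in> extensional U" if "U \<in> \<U>" for U using m[OF that] by (simp add: regular_def)
  \<comment> \<open>The value at a point is read off from an arbitrary member of the cover through
    it; agreement on intersections makes the choice irrelevant.\<close>
  define n where "n = (\<lambda>x\<in>\<Union>\<U>. m (SOME U. U \<in> \<U> \<and> x \<in> U) x)"
  have n: "n x = m U x" if U: "U \<in> \<U>" "x \<in> U" for U x
  proof -
    let ?V = "SOME U. U \<in> \<U> \<and> x \<in> U"
    have V: "?V \<in> \<U> \<and> x \<in> ?V" by (rule someI[of _ U]) (use U in simp)
    have "restrict (m ?V) (?V \<inter> U) x = restrict (m U) (?V \<inter> U) x" using eq[of ?V U] V U by simp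
    then have "m ?V x = m U x" using V U by simp
    then show ?thesis unfolding n_def using U by auto
  qed
  have nU: "restrict n U = m U" if "U \<in> \<U>" for U
    using n[OF that] ext[OF that] by (auto simp: fun_eq_iff restrict_def extensional_def)
  have "n \<in> regular X (\<Union>\<U>)"
  proof (rule regular_locally)
    fix x assume "x \<in> \<Union>\<U>"
    then obtain U where "U \<in> \<U>" "x \<in> U" by blast
    then show "\<exists>V\<in>opens X. x \<in> V \<and> V \<subseteq> \<Union>\<U> \<and> restrict n V \<in> regular X V"
      using op nU m by (intro bexI[of _ U]) auto
  qed (simp add: n_def)
  moreover have "k = n" if k: "k \<in> regular X (\<Union>\<U>)" "\<And>U. U \<in> \<U> \<Longrightarrow> restrict k U = m U" for k
  proof (rule extensionalityI[of _ "\<Union>\<U>"])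
    show "k \<in> extensional (\<Union>\<U>)" using k(1) by (simp add: regular_def)
    show "n \<in> extensional (\<Union>\<U>)" by (simp add: n_def)
    fix x assume "x \<in> \<Union>\<U>"
    then obtain U where U: "U \<in> \<U>" "x \<in> U" by blast
    then show "k x = n x" using n[OF U] k(2)[OF U(1)] by (metis restrict_apply')
  qed
  ultimately show "\<exists>!n. n \<in> Sec (structure_sheaf X) (\<Union>\<U>) \<and> (\<forall>U\<in>\<U>. restr (structure_sheaf X) (\<Union>\<U>) U n = m U)"
    using nU unfolding structure_sheaf_simps by blast
qed

lemma ideal_sheaf_simps [simp]:
  "Sec (ideal_sheaf X D) U = {f \<in> regular X U. \<forall>x \<in> D \<inter> U. f x = 0}"
  "f \<oplus>\<^bsub>sections (ideal_sheaf X D) U\<^esub> g = (\<lambda>x\<in>U. f x + g x)"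
  "f \<odot>\<^bsub>sections (ideal_sheaf X D) U\<^esub> g = (\<lambda>x\<in>U. f x * g x)"
  "\<zero>\<^bsub>sections (ideal_sheaf X D) U\<^esub> = (\<lambda>x\<in>U. 0)"
  "restr (ideal_sheaf X D) U V f = restrict f V"
  by (simp_all add: ideal_sheaf_def sub_presheaf_def structure_sheaf_def)

lemma presheaf_ideal_sheaf: "presheaf_of_modules X (ideal_sheaf X D)"
  unfolding presheaf_of_modules_def
proof (intro conjI ballI impI)
  fix U assume U: "U \<in> opens X"
  interpret O: module "regular_ring X U" "sections (structure_sheaf X) U" using module_structure_sheaf[OF U] .
  \<comment> \<open>The abstract negative of the module has to be computed pointwise before it can
    be seen to vanish on \<open>D\<close> with \<open>f\<close>.\<close>
  have neg: "\<ominus>\<^bsub>sections (structure_sheaf X) U\<^esub> f = (\<lambda>x\<in>U. - 1 * f x)" if "f \<in> regular X U" for f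
  proof (rule O.minus_equality)
    have "(\<lambda>x\<in>U. (\<lambda>x\<in>U. - 1) x * f x) \<in> regular X U" using U that by (intro regular_mult regular_const)
    moreover have "(\<lambda>x\<in>U. (\<lambda>x\<in>U. - 1) x * f x) = (\<lambda>x\<in>U. - 1 * f x)" by (auto simp: restrict_def fun_eq_iff)
    ultimately show "(\<lambda>x\<in>U. - 1 * f x) \<in> Sec (structure_sheaf X) U" by simp
  qed (use that in \<open>auto simp: restrict_def\<close>)
  have "submodule (Sec (ideal_sheaf X D) U) (regular_ring X U) (sections (structure_sheaf X) U)"
  proof (rule O.submoduleI)
    show "Sec (ideal_sheaf X D) U \<subseteq> Sec (structure_sheaf X) U" by auto
    show "\<zero>\<^bsub>sections (structure_sheaf X) U\<^esub> \<in> Sec (ideal_sheaf X D) U"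
      using regular_const[OF U, of 0] by auto
    show "\<ominus>\<^bsub>sections (structure_sheaf X) U\<^esub> f \<in> Sec (ideal_sheaf X D) U"
      if "f \<in> Sec (ideal_sheaf X D) U" for f
      using that neg[of f] O.a_inv_closed[of f] by auto
  qed (use U in \<open>auto simp: regular_add regular_mult\<close>)
  from submodule.submodule_is_module[OF this module_structure_sheaf[OF U]]
  show "module (regular_ring X U) (sections (ideal_sheaf X D) U)"
    by (simp add: ideal_sheaf_def sub_presheaf_def)
  show "restr (ideal_sheaf X D) U U f = f" if "f \<in> Sec (ideal_sheaf X D) U" for f
    using that by (simp add: regular_def extensional_restrict)
  show "restr (ideal_sheaf X D) U V f \<in> Sec (ideal_sheaf X D) V"
    if "V \<in> opens X" "V \<subseteq> U" "f \<in> Sec (ideal_sheaf X D) U" for V f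
    using that regular_restrict[of f X U V] by auto
qed (auto simp: restrict_def fun_eq_iff)

end


section \<open>The tangent and canonical sheaves\<close>

lemma operator_sheaf_simps [simp]:
  "Sec (operator_sheaf X A H) U = H U"
  "restr (operator_sheaf X A H) U V \<phi> = restrict \<phi> {W \<in> opens X. W \<subseteq> V}"
  by (simp_all add: operator_sheaf_def)

lemma operator_sheaf_apply:
  assumes "V \<in> opens X" "V \<subseteq> U" "a \<in> A V" "x \<in> V"
  shows "(\<phi> \<oplus>\<^bsub>sections (operator_sheaf X A H) U\<^esub> \<psi>) V a x = \<phi> V a x + \<psi> V a x"
    "(f \<odot>\<^bsub>sections (operator_sheaf X A H) U\<^esub> \<phi>) V a x = f x * \<phi> V a x"
    "\<zero>\<^bsub>sections (operator_sheaf X A H) U\<^esub> V a x = 0"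
  using assms by (simp_all add: operator_sheaf_def)

lemma operator_eqI:
  assumes "\<phi> \<in> (\<Pi>\<^sub>E V\<in>I. A V \<rightarrow>\<^sub>E extensional V)" "\<psi> \<in> (\<Pi>\<^sub>E V\<in>I. A V \<rightarrow>\<^sub>E extensional V)"
    and eq: "\<And>V a x. \<lbrakk>V \<in> I; a \<in> A V; x \<in> V\<rbrakk> \<Longrightarrow> \<phi> V a x = \<psi> V a x"
  shows "\<phi> = \<psi>"
proof (rule PiE_ext[OF assms(1,2)])
  fix V assume V: "V \<in> I"
  have c: "\<phi> V \<in> A V \<rightarrow>\<^sub>E extensional V" "\<psi> V \<in> A V \<rightarrow>\<^sub>E extensional V" using assms V by (auto simp: PiE_iff)
  show "\<phi> V = \<psi> V"
  proof (rule PiE_ext[OF c])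
    fix a assume a: "a \<in> A V"
    then have "\<phi> V a \<in> extensional V" "\<psi> V a \<in> extensional V" using c by (auto simp: PiE_iff)
    then show "\<phi> V a = \<psi> V a" by (rule extensionalityI) (use eq V a in blast)
  qed
qed

context irreducible_variety
begin

text \<open>Shared by the tangent sheaf and by dual sheaves. The operations are pointwise, so once
  \<open>H U\<close> is closed under them each module axiom is an identity between complex
  numbers.\<close>

lemma module_operator_sheaf:
  assumes U: "U \<in> opens X"
    and sub: "H U \<subseteq> (\<Pi>\<^sub>E V\<in>{V \<in> opens X. V \<subseteq> U}. A V \<rightarrow>\<^sub>E extensional V)"
    and zero: "\<zero>\<^bsub>sections (operator_sheaf X A H) U\<^esub> \<in> H U"
    and add: "\<And>\<phi> \<psi>. \<lbrakk>\<phi> \<in> H U; \<psi> \<in> H U\<rbrakk> \<Longrightarrow> \<phi> \<oplus>\<^bsub>sections (operator_sheaf X A H) U\<^esub> \<psi> \<in> H U"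
    and smult: "\<And>f \<phi>. \<lbrakk>f \<in> regular X U; \<phi> \<in> H U\<rbrakk> \<Longrightarrow> f \<odot>\<^bsub>sections (operator_sheaf X A H) U\<^esub> \<phi> \<in> H U"
  shows "module (regular_ring X U) (sections (operator_sheaf X A H) U)"
proof -
  let ?M = "sections (operator_sheaf X A H) U"
  interpret R: cring "regular_ring X U" using cring[OF U] .
  have eqI: "\<phi> = \<psi>" if "\<phi> \<in> H U" "\<psi> \<in> H U"
    "\<And>V a x. \<lbrakk>V \<in> opens X; V \<subseteq> U; a \<in> A V; x \<in> V\<rbrakk> \<Longrightarrow> \<phi> V a x = \<psi> V a x" for \<phi> \<psi>
    by (rule operator_eqI[OF subsetD[OF sub that(1)] subsetD[OF sub that(2)]]) (use that(3) in auto)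
  have ops: "(f \<oplus>\<^bsub>regular_ring X U\<^esub> g) x = f x + g x" "(f \<otimes>\<^bsub>regular_ring X U\<^esub> g) x = f x * g x"
    "\<one>\<^bsub>regular_ring X U\<^esub> x = 1" if "V \<subseteq> U" "x \<in> V" for f g x V
    using that by (auto simp: regular_ring_def)
  have cl: "f \<oplus>\<^bsub>regular_ring X U\<^esub> g \<in> regular X U" "f \<otimes>\<^bsub>regular_ring X U\<^esub> g \<in> regular X U" if "f \<in> regular X U" "g \<in> regular X U" for f g
    using that R.a_closed R.m_closed by simp_all
  have one: "\<one>\<^bsub>regular_ring X U\<^esub> \<in> regular X U" using R.one_closed by simp
  note app = operator_sheaf_apply
  show ?thesis
  proof (rule moduleI[OF cring[OF U]])
    show "abelian_group ?M"
    proof (rule abelian_groupI; unfold operator_sheaf_simps)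
      fix \<phi> assume \<phi>: "\<phi> \<in> H U"
      let ?m = "(\<lambda>x\<in>U. - 1) \<odot>\<^bsub>?M\<^esub> \<phi>"
      have m: "?m \<in> H U" using smult[OF regular_const[OF U] \<phi>] .
      have "?m \<oplus>\<^bsub>?M\<^esub> \<phi> = \<zero>\<^bsub>?M\<^esub>"
        by (rule eqI) (use add m \<phi> zero in \<open>auto simp: app subset_eq\<close>)
      with m show "\<exists>\<psi>\<in>H U. \<psi> \<oplus>\<^bsub>?M\<^esub> \<phi> = \<zero>\<^bsub>?M\<^esub>" by blast
      show "\<zero>\<^bsub>?M\<^esub> \<oplus>\<^bsub>?M\<^esub> \<phi> = \<phi>" by (rule eqI) (use add zero \<phi> in \<open>auto simp: app\<close>)
      fix \<psi> assume \<psi>: "\<psi> \<in> H U"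
      show "\<phi> \<oplus>\<^bsub>?M\<^esub> \<psi> = \<psi> \<oplus>\<^bsub>?M\<^esub> \<phi>" by (rule eqI) (use add \<psi> \<phi> in \<open>auto simp: app\<close>)
      fix \<eta> assume \<eta>: "\<eta> \<in> H U"
      show "(\<phi> \<oplus>\<^bsub>?M\<^esub> \<psi>) \<oplus>\<^bsub>?M\<^esub> \<eta> = \<phi> \<oplus>\<^bsub>?M\<^esub> (\<psi> \<oplus>\<^bsub>?M\<^esub> \<eta>)" by (rule eqI) (use add \<psi> \<phi> \<eta> in \<open>auto simp: app\<close>)
    qed (use add zero in auto)
  next
    fix \<phi> assume "\<phi> \<in> carrier ?M"
    then have \<phi>: "\<phi> \<in> H U" by simp
    show "\<one>\<^bsub>regular_ring X U\<^esub> \<odot>\<^bsub>?M\<^esub> \<phi> = \<phi>" by (rule eqI) (use smult \<phi> one in \<open>auto simp: app ops\<close>)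
    fix f assume "f \<in> carrier (regular_ring X U)"
    then have f: "f \<in> regular X U" by simp
    show "f \<odot>\<^bsub>?M\<^esub> \<phi> \<in> carrier ?M" using smult[OF f \<phi>] by simp
    {
      fix \<psi> assume "\<psi> \<in> carrier ?M"
      then have \<psi>: "\<psi> \<in> H U" by simp
      show "f \<odot>\<^bsub>?M\<^esub> (\<phi> \<oplus>\<^bsub>?M\<^esub> \<psi>) = f \<odot>\<^bsub>?M\<^esub> \<phi> \<oplus>\<^bsub>?M\<^esub> f \<odot>\<^bsub>?M\<^esub> \<psi>"
        by (rule eqI) (use smult add \<phi> \<psi> f in \<open>auto simp: app algebra_simps\<close>)
    }
    fix g assume "g \<in> carrier (regular_ring X U)"
    then have g: "g \<in> regular X U" by simp
    show "(f \<oplus>\<^bsub>regular_ring X U\<^esub> g) \<odot>\<^bsub>?M\<^esub> \<phi> = f \<odot>\<^bsub>?M\<^esub> \<phi> \<oplus>\<^bsub>?M\<^esub> g \<odot>\<^bsub>?M\<^esub> \<phi>"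
      by (rule eqI) (use smult add \<phi> f g cl in \<open>auto simp: app ops algebra_simps\<close>)
    show "(f \<otimes>\<^bsub>regular_ring X U\<^esub> g) \<odot>\<^bsub>?M\<^esub> \<phi> = f \<odot>\<^bsub>?M\<^esub> (g \<odot>\<^bsub>?M\<^esub> \<phi>)"
      by (rule eqI) (use smult \<phi> f g cl in \<open>auto simp: app ops\<close>)
  qed
qed

text \<open>Sums, multiples and restrictions of derivations appear as nested restricted functions.
  Here the conditions are pointwise ones on the unrestricted expression \<open>d\<close>, and the
  bookkeeping about domains is done once.\<close>

lemma derivationsI:
  assumes U: "U \<in> opens X"
    and reg: "\<And>V f. \<lbrakk>V \<in> opens X; V \<subseteq> U; f \<in> regular X V\<rbrakk> \<Longrightarrow> (\<lambda>x\<in>V. d V f x) \<in> regular X V"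
    and add: "\<And>V f g x. \<lbrakk>V \<in> opens X; V \<subseteq> U; f \<in> regular X V; g \<in> regular X V; x \<in> V\<rbrakk> \<Longrightarrow>
       d V (\<lambda>y\<in>V. f y + g y) x = d V f x + d V g x"
    and mult: "\<And>V f g x. \<lbrakk>V \<in> opens X; V \<subseteq> U; f \<in> regular X V; g \<in> regular X V; x \<in> V\<rbrakk> \<Longrightarrow>
       d V (\<lambda>y\<in>V. f y * g y) x = f x * d V g x + g x * d V f x"
    and scale: "\<And>V a f x. \<lbrakk>V \<in> opens X; V \<subseteq> U; f \<in> regular X V; x \<in> V\<rbrakk> \<Longrightarrow>
       d V (\<lambda>y\<in>V. a * f y) x = a * d V f x"
    and restr: "\<And>V W f x. \<lbrakk>V \<in> opens X; W \<in> opens X; W \<subseteq> V; V \<subseteq> U; f \<in> regular X V; x \<in> W\<rbrakk> \<Longrightarrow>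
       d W (restrict f W) x = d V f x"
  shows "(\<lambda>V\<in>{V \<in> opens X. V \<subseteq> U}. \<lambda>f\<in>regular X V. \<lambda>x\<in>V. d V f x) \<in> derivations X U"
  unfolding derivations_def
proof (intro CollectI conjI ballI allI impI)
  let ?d = "\<lambda>V\<in>{V \<in> opens X. V \<subseteq> U}. \<lambda>f\<in>regular X V. \<lambda>x\<in>V. d V f x"
  show "?d \<in> (\<Pi>\<^sub>E V\<in>{V \<in> opens X. V \<subseteq> U}. regular X V \<rightarrow>\<^sub>E regular X V)"
    using reg by (simp add: PiE_iff del: restrict_apply) (simp add: restrict_apply')
  fix V assume V: "V \<in> opens X"
  {
    assume VU: "V \<subseteq> U"
    {
      fix f g x assume fg: "f \<in> regular X V" "g \<in> regular X V" and x: "x \<in> V"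
      show "?d V (\<lambda>y\<in>V. f y + g y) x = ?d V f x + ?d V g x"
        using add[OF V VU fg x] regular_add[OF V fg] V VU fg x by (simp add: restrict_apply' del: restrict_apply)
      show "?d V (\<lambda>y\<in>V. f y * g y) x = f x * ?d V g x + g x * ?d V f x"
        using mult[OF V VU fg x] regular_mult[OF V fg] V VU fg x by (simp add: restrict_apply' del: restrict_apply)
    }
    fix a f x assume f: "f \<in> regular X V" and x: "x \<in> V"
    have "(\<lambda>y\<in>V. (\<lambda>y\<in>V. a) y * f y) \<in> regular X V" using regular_mult[OF V regular_const[OF V] f] .
    moreover have "(\<lambda>y\<in>V. (\<lambda>y\<in>V. a) y * f y) = (\<lambda>y\<in>V. a * f y)" by (auto simp: restrict_def)
    ultimately have "(\<lambda>y\<in>V. a * f y) \<in> regular X V" by simp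
    then show "?d V (\<lambda>y\<in>V. a * f y) x = a * ?d V f x"
      using scale[OF V VU f x] V VU f x by (simp add: restrict_apply' del: restrict_apply)
  }
  fix W f assume W: "W \<in> opens X" "W \<subseteq> V \<and> V \<subseteq> U" and f: "f \<in> regular X V"
  have fW: "restrict f W \<in> regular X W" using regular_restrict f W by blast
  have VI: "V \<in> {V \<in> opens X. V \<subseteq> U}" "W \<in> {V \<in> opens X. V \<subseteq> U}" using V W by auto
  have "?d W (restrict f W) = (\<lambda>x\<in>W. d W (restrict f W) x)" using VI fW by (simp add: restrict_apply' del: restrict_apply)
  also have "\<dots> = restrict (\<lambda>x\<in>V. d V f x) W"
    using restr[OF V W(1) _ _ f] W by (auto simp: restrict_def fun_eq_iff)
  also have "(\<lambda>x\<in>V. d V f x) = ?d V f" using VI f by (simp add: restrict_apply' del: restrict_apply)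
  finally show "?d W (restrict f W) = restrict (?d V f) W" .
qed

lemma derivationsD:
  assumes \<delta>: "\<delta> \<in> derivations X U" and V: "V \<in> opens X" "V \<subseteq> U" and f: "f \<in> regular X V"
  shows "\<delta> V f \<in> regular X V"
    and "\<lbrakk>g \<in> regular X V; x \<in> V\<rbrakk> \<Longrightarrow> \<delta> V (\<lambda>y\<in>V. f y + g y) x = \<delta> V f x + \<delta> V g x"
    and "\<lbrakk>g \<in> regular X V; x \<in> V\<rbrakk> \<Longrightarrow> \<delta> V (\<lambda>y\<in>V. f y * g y) x = f x * \<delta> V g x + g x * \<delta> V f x"
    and "x \<in> V \<Longrightarrow> \<delta> V (\<lambda>y\<in>V. a * f y) x = a * \<delta> V f x"
    and "\<lbrakk>W \<in> opens X; W \<subseteq> V\<rbrakk> \<Longrightarrow> \<delta> W (restrict f W) = restrict (\<delta> V f) W"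
proof -
  have P: "\<delta> \<in> (\<Pi>\<^sub>E V\<in>{V \<in> opens X. V \<subseteq> U}. regular X V \<rightarrow>\<^sub>E regular X V)"
    using \<delta> unfolding derivations_def by (elim CollectE conjE)
  show "\<delta> V f \<in> regular X V" using P V f by (auto simp: PiE_iff)
qed (use \<delta> V f in \<open>simp_all add: derivations_def\<close>)

lemma derivations_PiE:
  "derivations X U \<subseteq> (\<Pi>\<^sub>E V\<in>{V \<in> opens X. V \<subseteq> U}. regular X V \<rightarrow>\<^sub>E extensional V)"
proof
  fix \<delta> assume "\<delta> \<in> derivations X U"
  then have "\<delta> \<in> (\<Pi>\<^sub>E V\<in>{V \<in> opens X. V \<subseteq> U}. regular X V \<rightarrow>\<^sub>E regular X V)" unfolding derivations_def by (elim CollectE conjE)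
  then show "\<delta> \<in> (\<Pi>\<^sub>E V\<in>{V \<in> opens X. V \<subseteq> U}. regular X V \<rightarrow>\<^sub>E extensional V)"
    by (auto simp: PiE_iff regular_def)
qed

lemma presheaf_tangent_sheaf: "presheaf_of_modules X (tangent_sheaf X)"
  unfolding presheaf_of_modules_def
proof (intro conjI ballI impI)
  let ?T = "tangent_sheaf X"
  fix U assume U: "U \<in> opens X"
  show "module (regular_ring X U) (sections ?T U)"
    unfolding tangent_sheaf_def
  proof (rule module_operator_sheaf[where H = "derivations X" and A = "regular X", OF U derivations_PiE])
    show "\<zero>\<^bsub>sections (operator_sheaf X (regular X) (derivations X)) U\<^esub> \<in> derivations X U"
      unfolding operator_sheaf_def by simp (rule derivationsI[OF U], simp_all add: regular_const)
  next
    fix \<delta> \<epsilon> assume \<delta>: "\<delta> \<in> derivations X U" and \<epsilon>: "\<epsilon> \<in> derivations X U"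
    have "(\<lambda>V\<in>{V \<in> opens X. V \<subseteq> U}. \<lambda>f\<in>regular X V. \<lambda>x\<in>V. \<delta> V f x + \<epsilon> V f x) \<in> derivations X U"
      by (rule derivationsI[OF U])
        (simp_all add: derivationsD[OF \<delta>] derivationsD[OF \<epsilon>] regular_add algebra_simps del: restrict_apply,
         simp_all)
    then show "\<delta> \<oplus>\<^bsub>sections (operator_sheaf X (regular X) (derivations X)) U\<^esub> \<epsilon> \<in> derivations X U"
      unfolding operator_sheaf_def by simp
  next
    fix h \<delta> assume h: "h \<in> regular X U" and \<delta>: "\<delta> \<in> derivations X U"
    have "(\<lambda>V\<in>{V \<in> opens X. V \<subseteq> U}. \<lambda>f\<in>regular X V. \<lambda>x\<in>V. h x * \<delta> V f x) \<in> derivations X U"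
    proof (rule derivationsI[OF U])
      fix V f assume V: "V \<in> opens X" "V \<subseteq> U" and f: "f \<in> regular X V"
      have "(\<lambda>x\<in>V. restrict h V x * \<delta> V f x) \<in> regular X V"
        using regular_mult[OF V(1) regular_restrict[OF h V] derivationsD(1)[OF \<delta> V f]] .
      moreover have "(\<lambda>x\<in>V. restrict h V x * \<delta> V f x) = (\<lambda>x\<in>V. h x * \<delta> V f x)" by (auto simp: restrict_def)
      ultimately show "(\<lambda>x\<in>V. h x * \<delta> V f x) \<in> regular X V" by simp
    qed (simp_all add: derivationsD[OF \<delta>] algebra_simps del: restrict_apply, simp_all)
    then show "h \<odot>\<^bsub>sections (operator_sheaf X (regular X) (derivations X)) U\<^esub> \<delta> \<in> derivations X U"
      unfolding operator_sheaf_def by simp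
  qed
  show "restr ?T U U \<delta> = \<delta>" if "\<delta> \<in> Sec ?T U" for \<delta>
    using that derivations_PiE[of U] by (auto simp: tangent_sheaf_def PiE_iff extensional_restrict subset_eq)
  fix V assume V: "V \<in> opens X"
  {
    assume VU: "V \<subseteq> U"
    then have sub: "{W \<in> opens X. W \<subseteq> V} \<subseteq> {W \<in> opens X. W \<subseteq> U}" by auto
    show "restr ?T U V \<delta> \<in> Sec ?T V" if "\<delta> \<in> Sec ?T U" for \<delta>
    proof -
      have \<delta>: "\<delta> \<in> derivations X U" using that by (simp add: tangent_sheaf_def)
      have W: "W \<subseteq> U" if "W \<subseteq> V" for W using that VU by auto
      have "(\<lambda>W\<in>{W \<in> opens X. W \<subseteq> V}. \<lambda>f\<in>regular X W. \<lambda>x\<in>W. \<delta> W f x) \<in> derivations X V"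
      proof (rule derivationsI[OF V])
        fix W f assume "W \<in> opens X" "W \<subseteq> V" "f \<in> regular X W"
        then have "\<delta> W f \<in> regular X W" using derivationsD(1)[OF \<delta> _ W] by blast
        then show "restrict (\<delta> W f) W \<in> regular X W" by (simp add: regular_def extensional_restrict)
      qed (simp_all add: derivationsD[OF \<delta> _ W] del: restrict_apply, simp_all)
      \<comment> \<open>\<open>derivationsI\<close> delivers a function restricted in each argument.
        A derivation is extensional at every level, so this is the same as restricting only the
        family index.\<close>
      moreover have "(\<lambda>W\<in>{W \<in> opens X. W \<subseteq> V}. \<lambda>f\<in>regular X W. \<lambda>x\<in>W. \<delta> W f x) = restrict \<delta> {W \<in> opens X. W \<subseteq> V}"
      proof (rule restrict_ext)
        fix W assume "W \<in> {W \<in> opens X. W \<subseteq> V}"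
        then have "\<delta> W \<in> regular X W \<rightarrow>\<^sub>E extensional W" using subsetD[OF derivations_PiE \<delta>] sub by (auto simp: PiE_iff)
        then show "(\<lambda>f\<in>regular X W. \<lambda>x\<in>W. \<delta> W f x) = \<delta> W"
          by (intro PiE_ext[of _ "regular X W" "\<lambda>_. extensional W"]) (auto simp: extensional_restrict PiE_iff)
      qed
      ultimately show ?thesis by (simp add: tangent_sheaf_def)
    qed
    show "restr ?T U V (\<delta> \<oplus>\<^bsub>sections ?T U\<^esub> \<epsilon>) = restr ?T U V \<delta> \<oplus>\<^bsub>sections ?T V\<^esub> restr ?T U V \<epsilon>"
      if "\<delta> \<in> Sec ?T U" "\<epsilon> \<in> Sec ?T U" for \<delta> \<epsilon>
      using VU by (auto simp: tangent_sheaf_def operator_sheaf_def restrict_def fun_eq_iff)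
    show "restr ?T U V (f \<odot>\<^bsub>sections ?T U\<^esub> \<delta>) = restrict f V \<odot>\<^bsub>sections ?T V\<^esub> restr ?T U V \<delta>"
      if "f \<in> regular X U" "\<delta> \<in> Sec ?T U" for f \<delta>
      using VU by (auto simp: tangent_sheaf_def operator_sheaf_def restrict_def fun_eq_iff)
  }
  show "restr ?T V W (restr ?T U V \<delta>) = restr ?T U W \<delta>" if "W \<subseteq> V \<and> V \<subseteq> U" for W \<delta>
    using that by (auto simp: tangent_sheaf_def restrict_def fun_eq_iff)
qed

text \<open>The counterpart of \<open>derivationsI\<close> for linear forms: pointwise conditions on
  \<open>d\<close>, with the domains handled once.\<close>

lemma sheaf_homs_structureI:
  assumes F: "presheaf_of_modules X F" and U: "U \<in> opens X"
    and reg: "\<And>V m. \<lbrakk>V \<in> opens X; V \<subseteq> U; m \<in> Sec F V\<rbrakk> \<Longrightarrow> (\<lambda>x\<in>V. d V m x) \<in> regular X V"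
    and add: "\<And>V m n x. \<lbrakk>V \<in> opens X; V \<subseteq> U; m \<in> Sec F V; n \<in> Sec F V; x \<in> V\<rbrakk> \<Longrightarrow>
       d V (m \<oplus>\<^bsub>sections F V\<^esub> n) x = d V m x + d V n x"
    and smult: "\<And>V f m x. \<lbrakk>V \<in> opens X; V \<subseteq> U; f \<in> regular X V; m \<in> Sec F V; x \<in> V\<rbrakk> \<Longrightarrow>
       d V (f \<odot>\<^bsub>sections F V\<^esub> m) x = f x * d V m x"
    and restr: "\<And>V W m x. \<lbrakk>V \<in> opens X; W \<in> opens X; W \<subseteq> V; V \<subseteq> U; m \<in> Sec F V; x \<in> W\<rbrakk> \<Longrightarrow>
       d W (restr F V W m) x = d V m x"
  shows "(\<lambda>V\<in>{V \<in> opens X. V \<subseteq> U}. \<lambda>m\<in>Sec F V. \<lambda>x\<in>V. d V m x) \<in> sheaf_homs X U F (structure_sheaf X)"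
  unfolding sheaf_homs_def
proof (intro CollectI conjI ballI allI impI)
  interpret F: presheaf_mod X F by unfold_locales fact
  let ?d = "\<lambda>V\<in>{V \<in> opens X. V \<subseteq> U}. \<lambda>m\<in>Sec F V. \<lambda>x\<in>V. d V m x"
  show "?d \<in> (\<Pi>\<^sub>E V\<in>{V \<in> opens X. V \<subseteq> U}. Sec F V \<rightarrow>\<^sub>E Sec (structure_sheaf X) V)"
    using reg by (simp add: PiE_iff del: restrict_apply) (simp add: restrict_apply')
  fix V assume V: "V \<in> opens X"
  interpret MV: module "regular_ring X V" "sections F V" using F.module V by blast
  {
    assume VU: "V \<subseteq> U"
    show "?d V (m \<oplus>\<^bsub>sections F V\<^esub> n) = ?d V m \<oplus>\<^bsub>sections (structure_sheaf X) V\<^esub> ?d V n"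
      if "m \<in> Sec F V" "n \<in> Sec F V" for m n
      using that V VU add[OF V VU that] by (auto simp: restrict_def fun_eq_iff)
    show "?d V (f \<odot>\<^bsub>sections F V\<^esub> m) = f \<odot>\<^bsub>sections (structure_sheaf X) V\<^esub> ?d V m"
      if f: "f \<in> regular X V" and m: "m \<in> Sec F V" for f m
      using MV.smult_closed[of f m] f m V VU smult[OF V VU f m] by (auto simp: restrict_def fun_eq_iff)
  }
  fix W m assume W: "W \<in> opens X" "W \<subseteq> V \<and> V \<subseteq> U" and m: "m \<in> Sec F V"
  then have "restr F V W m \<in> Sec F W" using V F.restr_closed by blast
  then show "?d W (restr F V W m) = restr (structure_sheaf X) V W (?d V m)"
    using V W m restr[OF V W(1) _ _ m] by (auto simp: restrict_def fun_eq_iff)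
qed

text \<open>For the tangent sheaf this gives the module of differentials, in which combinations of
  basis differentials are formed.\<close>

lemma module_dual_sheaf:
  assumes F: "presheaf_of_modules X F" and U: "U \<in> opens X"
  shows "module (regular_ring X U) (sections (dual_sheaf X F) U)"
  unfolding dual_sheaf_def
proof (rule module_operator_sheaf[OF U])
  interpret F: presheaf_mod X F by unfold_locales fact
  let ?O = "structure_sheaf X" and ?H = "\<lambda>U. sheaf_homs X U F (structure_sheaf X)"
  show "?H U \<subseteq> (\<Pi>\<^sub>E V\<in>{V \<in> opens X. V \<subseteq> U}. Sec F V \<rightarrow>\<^sub>E extensional V)"
  proof
    fix \<phi> assume "\<phi> \<in> ?H U"
    then have "\<phi> \<in> (\<Pi>\<^sub>E V\<in>{V \<in> opens X. V \<subseteq> U}. Sec F V \<rightarrow>\<^sub>E Sec ?O V)" unfolding sheaf_homs_def by (elim CollectE conjE)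
    then show "\<phi> \<in> (\<Pi>\<^sub>E V\<in>{V \<in> opens X. V \<subseteq> U}. Sec F V \<rightarrow>\<^sub>E extensional V)"
      by (auto simp: PiE_iff regular_def)
  qed
  show "\<zero>\<^bsub>sections (operator_sheaf X (Sec F) ?H) U\<^esub> \<in> ?H U"
    unfolding operator_sheaf_def by simp (rule sheaf_homs_structureI[OF F U], simp_all add: regular_const)
  have D: "\<phi> V m \<in> regular X V" "\<And>n x. \<lbrakk>n \<in> Sec F V; x \<in> V\<rbrakk> \<Longrightarrow> \<phi> V (m \<oplus>\<^bsub>sections F V\<^esub> n) x = \<phi> V m x + \<phi> V n x"
      "\<And>f x. \<lbrakk>f \<in> regular X V; x \<in> V\<rbrakk> \<Longrightarrow> \<phi> V (f \<odot>\<^bsub>sections F V\<^esub> m) x = f x * \<phi> V m x"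
      "\<And>W x. \<lbrakk>W \<in> opens X; W \<subseteq> V; x \<in> W\<rbrakk> \<Longrightarrow> \<phi> W (restr F V W m) x = \<phi> V m x"
    if \<phi>: "\<phi> \<in> ?H U" and V: "V \<in> opens X" "V \<subseteq> U" "m \<in> Sec F V" for \<phi> V m
  proof -
    have "\<phi> \<in> (\<Pi>\<^sub>E V\<in>{V \<in> opens X. V \<subseteq> U}. Sec F V \<rightarrow>\<^sub>E Sec ?O V)" using \<phi> unfolding sheaf_homs_def by (elim CollectE conjE)
    then show "\<phi> V m \<in> regular X V" using V by (auto simp: PiE_iff)
  qed (use \<phi> V in \<open>simp_all add: sheaf_homs_def\<close>)
  fix \<phi> assume \<phi>: "\<phi> \<in> ?H U"
  {
    fix \<psi> assume \<psi>: "\<psi> \<in> ?H U"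
    have "(\<lambda>V\<in>{V \<in> opens X. V \<subseteq> U}. \<lambda>m\<in>Sec F V. \<lambda>x\<in>V. \<phi> V m x + \<psi> V m x) \<in> ?H U"
      by (rule sheaf_homs_structureI[OF F U])
        (simp_all add: D[OF \<phi>] D[OF \<psi>] regular_add algebra_simps del: restrict_apply)
    then show "\<phi> \<oplus>\<^bsub>sections (operator_sheaf X (Sec F) ?H) U\<^esub> \<psi> \<in> ?H U"
      unfolding operator_sheaf_def by simp
  }
  fix h assume h: "h \<in> regular X U"
  have "(\<lambda>V\<in>{V \<in> opens X. V \<subseteq> U}. \<lambda>m\<in>Sec F V. \<lambda>x\<in>V. h x * \<phi> V m x) \<in> ?H U"
  proof (rule sheaf_homs_structureI[OF F U])
    fix V m assume V: "V \<in> opens X" "V \<subseteq> U" and m: "m \<in> Sec F V"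
    have "(\<lambda>x\<in>V. restrict h V x * \<phi> V m x) \<in> regular X V"
      using regular_mult[OF V(1) regular_restrict[OF h V] D(1)[OF \<phi> V m]] .
    moreover have "(\<lambda>x\<in>V. restrict h V x * \<phi> V m x) = (\<lambda>x\<in>V. h x * \<phi> V m x)" by (auto simp: restrict_def)
    ultimately show "(\<lambda>x\<in>V. h x * \<phi> V m x) \<in> regular X V" by simp
  qed (simp_all add: D[OF \<phi>] algebra_simps del: restrict_apply)
  then show "h \<odot>\<^bsub>sections (operator_sheaf X (Sec F) ?H) U\<^esub> \<phi> \<in> ?H U"
    unfolding operator_sheaf_def by simp
qed

end


section \<open>Contraction of vector fields with a differential\<close>

locale smooth_pair = irreducible_variety X for X :: "'n::finite pt set" +
  fixes D :: "'n pt set"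
  assumes local_parameters: "x \<in> X \<Longrightarrow> \<exists>U t. local_parameter X x U t"
    and finite_D: "finite D" and D_subset: "D \<subseteq> X"
begin

abbreviation "TX \<equiv> tangent_sheaf X"
abbreviation "IX \<equiv> ideal_sheaf X D"
abbreviation "OX \<equiv> structure_sheaf X"
abbreviation "PX \<equiv> tensor_presheaf X (tangent_sheaf X) (ideal_sheaf X D)"
abbreviation "LX \<equiv> log_tangent_sheaf X D"

sublocale T: presheaf_mod X TX by unfold_locales (rule presheaf_tangent_sheaf)
sublocale I: presheaf_mod X IX by unfold_locales (rule presheaf_ideal_sheaf)
sublocale O: sheaf_mod X OX by unfold_locales (rule sheaf_structure_sheaf)
sublocale TI: tensor_presheaves X TX IX by unfold_locales
sublocale P: presheaf_mod X PX by unfold_locales (rule TI.presheaf_tensor)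

lemma LX_eq: "LX = sheafify X PX" by (simp add: log_tangent_sheaf_def tensor_sheaf_def)

sublocale L: presheaf_mod X LX
  by unfold_locales (simp add: LX_eq P.presheaf_sheafify)

lemma Sec_TX [simp]: "Sec TX U = derivations X U"
  by (simp add: tangent_sheaf_def)

lemma TX_apply:
  assumes "V \<in> opens X" "V \<subseteq> U" "f \<in> regular X V" "x \<in> V"
  shows "(\<delta> \<oplus>\<^bsub>sections TX U\<^esub> \<epsilon>) V f x = \<delta> V f x + \<epsilon> V f x"
    "(h \<odot>\<^bsub>sections TX U\<^esub> \<delta>) V f x = h x * \<delta> V f x"
    "\<zero>\<^bsub>sections TX U\<^esub> V f x = 0"
  unfolding tangent_sheaf_def by (rule operator_sheaf_apply[OF assms(1,2), of f "regular X", OF assms(3,4)])+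

lemma restr_TX_apply: "\<lbrakk>W \<in> opens X; W \<subseteq> V\<rbrakk> \<Longrightarrow> restr TX U V \<delta> W = \<delta> W"
  by (simp add: tangent_sheaf_def)

lemma TX_eqI:
  assumes "\<delta> \<in> derivations X U" "\<epsilon> \<in> derivations X U"
    "\<And>V f x. \<lbrakk>V \<in> opens X; V \<subseteq> U; f \<in> regular X V; x \<in> V\<rbrakk> \<Longrightarrow> \<delta> V f x = \<epsilon> V f x"
  shows "\<delta> = \<epsilon>"
  by (rule operator_eqI[OF subsetD[OF derivations_PiE assms(1)] subsetD[OF derivations_PiE assms(2)]])
    (use assms(3) in auto)

section \<open>Derivations and the ideal of \<open>D\<close> near a point\<close>

lemma derivation_const:
  assumes \<delta>: "\<delta> \<in> derivations X U" and V: "V \<in> opens X" "V \<subseteq> U" "x \<in> V"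
  shows "\<delta> V (\<lambda>y\<in>V. c) x = 0"
proof -
  have o: "(\<lambda>y\<in>V. 1) \<in> regular X V" using regular_const V by blast
  \<comment> \<open>The Leibniz rule for 1 = 1 * 1 gives \<delta>(1) = 2 \<delta>(1).\<close>
  have "(\<lambda>y\<in>V. (\<lambda>y\<in>V. 1) y * (\<lambda>y\<in>V. 1) y) = (\<lambda>y\<in>V. 1 :: complex)" by (auto simp: restrict_def)
  then have 1: "\<delta> V (\<lambda>y\<in>V. 1) x = 0"
    using derivationsD(3)[OF \<delta> V(1,2) o o V(3)] V(3) by (simp add: restrict_apply' del: restrict_apply)
  have "(\<lambda>y\<in>V. c * (\<lambda>y\<in>V. 1) y) = (\<lambda>y\<in>V. c)" by (auto simp: restrict_def)
  then show ?thesis using derivationsD(4)[OF \<delta> V(1,2) o V(3), of c] 1 by simp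
qed

text \<open>The function f - f(x) vanishes at x, hence equals t k near x, and the Leibniz rule at x
  leaves k(x) times the derivative of t because t(x) = 0. What matters is the order of the
  quantifiers: the factor depends on \<open>f\<close> and \<open>x\<close> but serves all
  derivations simultaneously.\<close>

lemma derivation_local_parameter:
  assumes t: "local_parameter X x U0 t" and V: "V \<in> opens X" "x \<in> V" and f: "f \<in> regular X V"
  shows "\<exists>c. \<forall>U \<delta>. \<delta> \<in> derivations X U \<and> V \<subseteq> U \<longrightarrow> \<delta> V f x = c * \<delta> (V \<inter> U0) (restrict t (V \<inter> U0)) x"
proof -
  have t': "U0 \<in> opens X" "x \<in> U0" "t \<in> regular X U0" "t x = 0" using t by (auto simp: local_parameter_def)
  define h where "h = (\<lambda>y\<in>V. f y + (\<lambda>y\<in>V. - f x) y)"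
  have h: "h \<in> regular X V" "h x = 0" using regular_add[OF V(1) f regular_const[OF V(1)]] V(2) by (auto simp: h_def)
  obtain W k where W: "W \<in> opens X" "k \<in> regular X W" "x \<in> W" "W \<subseteq> U0 \<inter> V" "\<forall>y\<in>W. h y = t y * k y"
    using t V(1,2) h unfolding local_parameter_def by metis
  let ?N = "V \<inter> U0"
  have N: "?N \<in> opens X" using opens_Int V t' by blast
  have tN: "restrict t ?N \<in> regular X ?N" using regular_restrict[OF t'(3) N] by blast
  have tW: "restrict t W \<in> regular X W" using regular_restrict[OF t'(3) W(1)] W by blast
  have "\<delta> V f x = k x * \<delta> ?N (restrict t ?N) x" if \<delta>: "\<delta> \<in> derivations X U" and VU: "V \<subseteq> U" for U \<delta>
  proof -
    have WU: "W \<subseteq> U" "W \<subseteq> V" "W \<subseteq> ?N" "?N \<subseteq> U" using W VU by auto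
    have "f y = t y * k y + f x" if "y \<in> W" for y
    proof -
      have "h y = f y - f x" using subsetD[OF WU(2) that] by (simp add: h_def)
      then show ?thesis using W(5) that by (simp add: algebra_simps)
    qed
    then have "restrict f W = (\<lambda>y\<in>W. (\<lambda>y\<in>W. restrict t W y * k y) y + (\<lambda>y\<in>W. f x) y)"
      by (auto simp: restrict_def fun_eq_iff)
    then have "\<delta> W (restrict f W) x = \<delta> W (\<lambda>y\<in>W. restrict t W y * k y) x + \<delta> W (\<lambda>y\<in>W. f x) x"
      using derivationsD(2)[OF \<delta> W(1) WU(1) regular_mult[OF W(1) tW W(2)] regular_const[OF W(1)] W(3)] by simp
    also have "\<dots> = k x * \<delta> W (restrict t W) x"
      using derivationsD(3)[OF \<delta> W(1) WU(1) tW W(2) W(3)] derivation_const[OF \<delta> W(1) WU(1) W(3)] t'(4) W(3)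
      by (simp add: restrict_apply' del: restrict_apply)
    also have "restrict t W = restrict (restrict t ?N) W" using WU by (simp add: restrict_restrict Int_absorb1)
    finally show ?thesis
      using derivationsD(5)[OF \<delta> V(1) VU f W(1) WU(2)] derivationsD(5)[OF \<delta> N WU(4) tN W(1) WU(3)] W(3)
      by (simp add: restrict_apply' del: restrict_apply)
  qed
  then show ?thesis by blast
qed

text \<open>On a smooth curve derivations are determined by their value on a local parameter, so any two
  of them are proportional at each point.\<close>

lemma derivations_proportional:
  assumes \<delta>: "\<delta> \<in> derivations X U" "\<epsilon> \<in> derivations X U" and V: "V \<in> opens X" "V \<subseteq> U" "x \<in> V"
    and fg: "f \<in> regular X V" "g \<in> regular X V"
  shows "\<delta> V f x * \<epsilon> V g x = \<epsilon> V f x * \<delta> V g x"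
proof -
  have "x \<in> X" using V opens_subset by blast
  then obtain U0 t where t: "local_parameter X x U0 t" using local_parameters by blast
  obtain c where c: "\<And>U \<delta>. \<lbrakk>\<delta> \<in> derivations X U; V \<subseteq> U\<rbrakk> \<Longrightarrow> \<delta> V f x = c * \<delta> (V \<inter> U0) (restrict t (V \<inter> U0)) x"
    using derivation_local_parameter[OF t V(1,3) fg(1)] by blast
  obtain e where e: "\<And>U \<delta>. \<lbrakk>\<delta> \<in> derivations X U; V \<subseteq> U\<rbrakk> \<Longrightarrow> \<delta> V g x = e * \<delta> (V \<inter> U0) (restrict t (V \<inter> U0)) x"
    using derivation_local_parameter[OF t V(1,3) fg(2)] by blast
  show ?thesis
    unfolding c[OF \<delta>(1) V(2)] c[OF \<delta>(2) V(2)] e[OF \<delta>(1) V(2)] e[OF \<delta>(2) V(2)] by (simp add: algebra_simps)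
qed

text \<open>Near a point \<open>x\<close> of \<open>D\<close> the ideal of \<open>D\<close> is generated by a local parameter, elsewhere by 1.\<close>

lemma ideal_generator:
  assumes x: "x \<in> X"
  shows "\<exists>W t. W \<in> opens X \<and> x \<in> W \<and> t \<in> Sec IX W \<and> (\<forall>V\<in>opens X. \<forall>h\<in>Sec IX V. x \<in> V \<longrightarrow>
     (\<exists>W'\<in>opens X. \<exists>k\<in>regular X W'. x \<in> W' \<and> W' \<subseteq> V \<inter> W \<and> (\<forall>y\<in>W'. h y = k y * t y)))"
proof -
  obtain N where N: "N \<in> opens X" "x \<in> N" "N \<inter> D \<subseteq> {x}"
    using finite_separated_nbhd[OF subset_projective_space x X_open finite_D D_subset] by blast
  show ?thesis
  proof (cases "x \<in> D")
    case True
    obtain U0 t where t: "local_parameter X x U0 t" using local_parameters x by blast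
    have t': "U0 \<in> opens X" "x \<in> U0" "t \<in> regular X U0" "t x = 0" using t by (auto simp: local_parameter_def)
    let ?W = "U0 \<inter> N"
    have W: "?W \<in> opens X" using opens_Int t' N by blast
    have tW: "restrict t ?W \<in> Sec IX ?W"
      using regular_restrict[OF t'(3) W] t'(4) N by (auto simp: restrict_apply' simp del: restrict_apply)
    have "\<exists>W'\<in>opens X. \<exists>k\<in>regular X W'. x \<in> W' \<and> W' \<subseteq> V \<inter> ?W \<and> (\<forall>y\<in>W'. h y = k y * restrict t ?W y)"
      if V: "V \<in> opens X" "x \<in> V" and h: "h \<in> Sec IX V" for V h
    proof -
      have "h \<in> regular X V" "h x = 0" using h True V by auto
      then obtain W' k where W': "W' \<in> opens X" "k \<in> regular X W'" "x \<in> W'" "W' \<subseteq> U0 \<inter> V" "\<forall>y\<in>W'. h y = t y * k y"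
        using t V unfolding local_parameter_def by metis
      have o: "W' \<inter> N \<in> opens X" using opens_Int W' N by blast
      have "restrict k (W' \<inter> N) \<in> regular X (W' \<inter> N)" using regular_restrict[OF W'(2) o] by blast
      then show ?thesis using W' N o
        by (intro bexI[of _ "W' \<inter> N"] bexI[of _ "restrict k (W' \<inter> N)"]) auto
    qed
    then show ?thesis using W tW t' N by (intro exI[of _ ?W] exI[of _ "restrict t ?W"]) blast
  next
    case False
    have t: "(\<lambda>x\<in>N. 1) \<in> Sec IX N" using regular_const[OF N(1)] N False by auto
    have "\<exists>W'\<in>opens X. \<exists>k\<in>regular X W'. x \<in> W' \<and> W' \<subseteq> V \<inter> N \<and> (\<forall>y\<in>W'. h y = k y * (\<lambda>x\<in>N. 1) y)"
      if V: "V \<in> opens X" "x \<in> V" and h: "h \<in> Sec IX V" for V h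
    proof -
      have o: "V \<inter> N \<in> opens X" using opens_Int V N by blast
      have "restrict h (V \<inter> N) \<in> regular X (V \<inter> N)" using regular_restrict[OF _ o] h by auto
      then show ?thesis using V N o
        by (intro bexI[of _ "V \<inter> N"] bexI[of _ "restrict h (V \<inter> N)"]) auto
    qed
    then show ?thesis using N t by (intro exI[of _ N] exI[of _ "\<lambda>x\<in>N. 1"]) blast
  qed
qed

text \<open>Near \<open>x\<close> a section of T \<otimes> I is a single pure tensor with a
  prescribed second factor. In \<delta> \<otimes> h write h = k t and move k to the derivation; sums
  of such tensors collapse because t is the same in all of them. Thus a section of the tensor
  product is governed near \<open>x\<close> by one derivation.\<close>

lemma tensor_ideal_local:
  assumes W: "W \<in> opens X" "x \<in> W" and t: "t \<in> Sec IX W"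
    and gen: "\<And>V h. \<lbrakk>V \<in> opens X; h \<in> Sec IX V; x \<in> V\<rbrakk> \<Longrightarrow>
     \<exists>W'\<in>opens X. \<exists>k\<in>regular X W'. x \<in> W' \<and> W' \<subseteq> V \<inter> W \<and> (\<forall>y\<in>W'. h y = k y * t y)"
    and U: "U \<in> opens X" "x \<in> U" and C: "C \<in> Sec PX U"
  shows "\<exists>V\<in>opens X. x \<in> V \<and> V \<subseteq> U \<inter> W \<and>
     (\<exists>\<delta>\<in>derivations X V. restr PX U V C = TI.pure_sec V \<delta> (restrict t V))"
proof -
  interpret TU: tensor "regular_ring X U" "sections TX U" "sections IX U" by (rule TI.tensor_sections[OF U(1)])
  have "C \<in> carrier TU.TM" using C by simp
  then show ?thesis
  proof (induction rule: TU.tensor_induct)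
    case (pure \<delta> h)
    then obtain V k where V: "V \<in> opens X" "k \<in> regular X V" "x \<in> V" "V \<subseteq> U \<inter> W" "\<forall>y\<in>V. h y = k y * t y"
      using gen[OF U(1) pure(2) U(2)] by blast
    interpret TV: tensor "regular_ring X V" "sections TX V" "sections IX V" by (rule TI.tensor_sections[OF V(1)])
    have VU: "V \<subseteq> U" "V \<subseteq> W" using V by auto
    have tV: "restrict t V \<in> Sec IX V" using I.restr_closed[OF W(1) V(1) VU(2) t] by simp
    have \<delta>V: "restr TX U V \<delta> \<in> Sec TX V" using T.restr_closed[OF U(1) V(1) VU(1) pure(1)] .
    have "restrict h V = k \<odot>\<^bsub>sections IX V\<^esub> restrict t V" using V(5) by (auto simp: restrict_def)
    then have "restr PX U V (TI.pure_sec U \<delta> h) = TI.pure_sec V (restr TX U V \<delta>) (k \<odot>\<^bsub>sections IX V\<^esub> restrict t V)"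
      using TI.restr_pure[OF U(1) V(1) VU(1) pure] by simp
    also have "\<dots> = TI.pure_sec V (k \<odot>\<^bsub>sections TX V\<^esub> restr TX U V \<delta>) (restrict t V)"
      using TV.pure_balanced[of k] V(2) \<delta>V tV by simp
    finally show ?case
      using V TV.M.smult_closed[of k "restr TX U V \<delta>"] \<delta>V
      by (intro bexI[of _ V] conjI bexI[of _ "k \<odot>\<^bsub>sections TX V\<^esub> restr TX U V \<delta>"]) (simp_all del: restrict_apply)
  next
    case (add C C')
    then obtain V \<delta> where V: "V \<in> opens X" "x \<in> V" "V \<subseteq> U \<inter> W" and \<delta>: "\<delta> \<in> derivations X V"
      "restr PX U V C = TI.pure_sec V \<delta> (restrict t V)" by blast
    from add obtain V' \<delta>' where V': "V' \<in> opens X" "x \<in> V'" "V' \<subseteq> U \<inter> W" and \<delta>': "\<delta>' \<in> derivations X V'"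
      "restr PX U V' C' = TI.pure_sec V' \<delta>' (restrict t V')" by blast
    let ?V = "V \<inter> V'"
    have o: "?V \<in> opens X" using opens_Int V V' by blast
    interpret TV: tensor "regular_ring X ?V" "sections TX ?V" "sections IX ?V" by (rule TI.tensor_sections[OF o])
    have sub: "?V \<subseteq> U" "?V \<subseteq> V" "?V \<subseteq> V'" "V \<subseteq> U" "V' \<subseteq> U" "V \<subseteq> W" "V' \<subseteq> W" "?V \<subseteq> W" using V V' by auto
    have CC: "C \<in> Sec PX U" "C' \<in> Sec PX U" using add by simp_all
    have tV: "restrict t V \<in> Sec IX V" "restrict t V' \<in> Sec IX V'" "restrict t ?V \<in> Sec IX ?V"
      using I.restr_closed[OF W(1) V(1) sub(6) t] I.restr_closed[OF W(1) V'(1) sub(7) t]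
        I.restr_closed[OF W(1) o sub(8) t] by simp_all
    let ?d = "restr TX V ?V \<delta>" and ?d' = "restr TX V' ?V \<delta>'"
    have d: "?d \<in> Sec TX ?V" "?d' \<in> Sec TX ?V"
      using T.restr_closed[OF V(1) o sub(2), of \<delta>] T.restr_closed[OF V'(1) o sub(3), of \<delta>'] \<delta> \<delta>' by simp_all
    have "restr PX U ?V C = restr PX V ?V (restr PX U V C)"
      using P.restr_restr[OF U(1) V(1) o sub(2) sub(4) CC(1)] by simp
    also have "\<dots> = TI.pure_sec ?V ?d (restrict t ?V)"
      using TI.restr_pure[OF V(1) o sub(2), of \<delta> "restrict t V"] \<delta> tV by (simp add: restrict_restrict Int_absorb1)
    finally have 1: "restr PX U ?V C = TI.pure_sec ?V ?d (restrict t ?V)" .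
    have "restr PX U ?V C' = restr PX V' ?V (restr PX U V' C')"
      using P.restr_restr[OF U(1) V'(1) o sub(3) sub(5) CC(2)] by simp
    also have "\<dots> = TI.pure_sec ?V ?d' (restrict t ?V)"
      using TI.restr_pure[OF V'(1) o sub(3), of \<delta>' "restrict t V'"] \<delta>' tV by (simp add: restrict_restrict Int_absorb1)
    finally have 2: "restr PX U ?V C' = TI.pure_sec ?V ?d' (restrict t ?V)" .
    have "restr PX U ?V (C \<oplus>\<^bsub>TU.TM\<^esub> C') = TI.pure_sec ?V (?d \<oplus>\<^bsub>sections TX ?V\<^esub> ?d') (restrict t ?V)"
      using P.restr_add[OF U(1) o sub(1) CC] TV.pure_add_left[OF d tV(3)] by (simp add: 1 2)
    then show ?case
      using o V V' TV.M.a_closed[OF d] by (intro bexI[of _ ?V] conjI bexI[of _ "?d \<oplus>\<^bsub>sections TX ?V\<^esub> ?d'"])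
        (auto simp del: restrict_apply)
  qed
qed

end

section \<open>Contraction with a fixed differential\<close>

locale contraction = smooth_pair X D for X D :: "'n::finite pt set" +
  fixes w
  assumes w: "w \<in> Sec (canonical_sheaf X) X"
begin

lemma w_hom: "w \<in> sheaf_homs X X TX OX"
  using w by (simp add: canonical_sheaf_def dual_sheaf_def)

lemma w_mor: "presheaf_mor X TX OX w"
  using w_hom by (rule sheaf_homs_presheaf_mor)

lemma w_closed: "\<lbrakk>U \<in> opens X; \<delta> \<in> derivations X U\<rbrakk> \<Longrightarrow> w U \<delta> \<in> regular X U"
  using presheaf_morD(1)[OF w_mor, of U \<delta>] by simp

lemma w_restr: "\<lbrakk>U \<in> opens X; V \<in> opens X; V \<subseteq> U; \<delta> \<in> derivations X U\<rbrakk> \<Longrightarrow> w V (restr TX U V \<delta>) = restrict (w U \<delta>) V"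
  using presheaf_morD(4)[OF w_mor, of U V \<delta>] by simp

text \<open>By \<open>derivations_proportional\<close>, the derivations \<epsilon>(f) \<delta> and
  \<delta>(f) \<epsilon> over \<open>V\<close> agree at every point. Applying the linear map
  \<open>w\<close> to this equality gives the claim.\<close>

lemma w_proportional:
  assumes U: "U \<in> opens X" and \<delta>: "\<delta> \<in> derivations X U" "\<epsilon> \<in> derivations X U" and V: "V \<in> opens X" "V \<subseteq> U"
    and f: "f \<in> regular X V" and x: "x \<in> V"
  shows "w U \<delta> x * \<epsilon> V f x = w U \<epsilon> x * \<delta> V f x"
proof -
  let ?d = "restr TX U V \<delta>" and ?e = "restr TX U V \<epsilon>"
  interpret TV: module "regular_ring X V" "sections TX V" by (rule T.module[OF V(1)])
  have d: "?d \<in> Sec TX V" "?e \<in> Sec TX V" using T.restr_closed[OF U V] \<delta> by simp_all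
  have r: "\<delta> V f \<in> regular X V" "\<epsilon> V f \<in> regular X V" using derivationsD(1) \<delta> V f by blast+
  have "\<epsilon> V f \<odot>\<^bsub>sections TX V\<^esub> ?d = \<delta> V f \<odot>\<^bsub>sections TX V\<^esub> ?e"
  proof (rule TX_eqI)
    show "\<epsilon> V f \<odot>\<^bsub>sections TX V\<^esub> ?d \<in> derivations X V" "\<delta> V f \<odot>\<^bsub>sections TX V\<^esub> ?e \<in> derivations X V"
      using TV.smult_closed[of "\<epsilon> V f" ?d] TV.smult_closed[of "\<delta> V f" ?e] r d by simp_all
    fix W g y assume W: "W \<in> opens X" "W \<subseteq> V" and g: "g \<in> regular X W" and y: "y \<in> W"
    have fW: "restrict f W \<in> regular X W" using regular_restrict[OF f W] .
    have "\<delta> V f y = \<delta> W (restrict f W) y" "\<epsilon> V f y = \<epsilon> W (restrict f W) y"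
      using derivationsD(5)[OF _ V f W] \<delta> y by simp_all
    moreover have "W \<subseteq> U" using W V by auto
    ultimately show "(\<epsilon> V f \<odot>\<^bsub>sections TX V\<^esub> ?d) W g y = (\<delta> V f \<odot>\<^bsub>sections TX V\<^esub> ?e) W g y"
      using derivations_proportional[OF \<delta>(2,1) W(1) _ y fW g] TX_apply(2)[OF W g y]
      by (simp add: restr_TX_apply[OF W])
  qed
  then have "w V (\<epsilon> V f \<odot>\<^bsub>sections TX V\<^esub> ?d) x = w V (\<delta> V f \<odot>\<^bsub>sections TX V\<^esub> ?e) x" by simp
  then show ?thesis
    using presheaf_morD(3)[OF w_mor V(1) r(2) d(1)] presheaf_morD(3)[OF w_mor V(1) r(1) d(2)]
      w_restr[OF U V \<delta>(1)] w_restr[OF U V \<delta>(2)] x by (simp add: mult.commute)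
qed

text \<open>The rank-one property in the form that passes to tensor products: an equality of
  derivations, obtained by testing \<open>w_proportional\<close> on all functions.\<close>

lemma w_smult_swap:
  assumes U: "U \<in> opens X" and \<delta>: "\<delta> \<in> derivations X U" "\<epsilon> \<in> derivations X U"
  shows "w U \<delta> \<odot>\<^bsub>sections TX U\<^esub> \<epsilon> = w U \<epsilon> \<odot>\<^bsub>sections TX U\<^esub> \<delta>"
proof (rule TX_eqI)
  interpret TU: module "regular_ring X U" "sections TX U" by (rule T.module[OF U])
  show "w U \<delta> \<odot>\<^bsub>sections TX U\<^esub> \<epsilon> \<in> derivations X U" "w U \<epsilon> \<odot>\<^bsub>sections TX U\<^esub> \<delta> \<in> derivations X U"
    using TU.smult_closed[of "w U \<delta>" \<epsilon>] TU.smult_closed[of "w U \<epsilon>" \<delta>] w_closed[OF U] \<delta> by simp_all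
  fix V f x assume V: "V \<in> opens X" "V \<subseteq> U" and f: "f \<in> regular X V" and x: "x \<in> V"
  show "(w U \<delta> \<odot>\<^bsub>sections TX U\<^esub> \<epsilon>) V f x = (w U \<epsilon> \<odot>\<^bsub>sections TX U\<^esub> \<delta>) V f x"
    using w_proportional[OF U \<delta> V f x] TX_apply(2)[OF V f x] by simp
qed

text \<open>A nonzero \<delta> has \<delta>(f) nonzero somewhere. For any \<epsilon>,
  proportionality gives w(\<epsilon>) \<delta>(f) = w(\<delta>) \<epsilon>(f) = 0, and since
  \<delta>(f) cannot vanish on a nonempty open set, w(\<epsilon>) = 0. Hence w = 0.\<close>

lemma w_injective:
  assumes nz: "w \<noteq> \<zero>\<^bsub>sections (canonical_sheaf X) X\<^esub>"
    and U: "U \<in> opens X" and \<delta>: "\<delta> \<in> derivations X U" and z: "\<And>x. x \<in> U \<Longrightarrow> w U \<delta> x = 0"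
  shows "\<delta> = \<zero>\<^bsub>sections TX U\<^esub>"
proof (rule ccontr)
  assume ne: "\<delta> \<noteq> \<zero>\<^bsub>sections TX U\<^esub>"
  interpret TU: module "regular_ring X U" "sections TX U" by (rule T.module[OF U])
  have "\<exists>V f x. V \<in> opens X \<and> V \<subseteq> U \<and> f \<in> regular X V \<and> x \<in> V \<and> \<delta> V f x \<noteq> 0"
  proof (rule ccontr)
    assume "\<not> ?thesis"
    then have v: "\<delta> V f x = 0" if "V \<in> opens X" "V \<subseteq> U" "f \<in> regular X V" "x \<in> V" for V f x
      using that by blast
    have "\<delta> = \<zero>\<^bsub>sections TX U\<^esub>"
      by (rule TX_eqI[OF \<delta>]) (use TU.zero_closed v TX_apply(3) in auto)
    then show False using ne by blast
  qed
  then obtain V f x where V: "V \<in> opens X" "V \<subseteq> U" and f: "f \<in> regular X V" and x: "x \<in> V" "\<delta> V f x \<noteq> 0"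
    by blast
  have \<delta>f: "\<delta> V f \<in> regular X V" using derivationsD(1)[OF \<delta> V f] .
  \<comment> \<open>\<open>S\<close> is unrelated to \<open>U\<close> and \<open>V\<close>;
    irreducibility makes it meet \<open>V\<close>. Vanishing is proved on the intersection, where f
    is available, and spread over \<open>S\<close> by the identity principle.\<close>
  have w0: "w S \<epsilon> y = 0" if S: "S \<in> opens X" and \<epsilon>: "\<epsilon> \<in> derivations X S" and y: "y \<in> S" for S \<epsilon> y
  proof -
    let ?W = "V \<inter> S"
    have W: "?W \<in> opens X" and Wne: "?W \<noteq> {}" using opens_Int V S opens_meet[of V S] x y by auto
    have sub: "?W \<subseteq> U" "?W \<subseteq> V" "?W \<subseteq> S" using V by auto
    let ?d = "restr TX U ?W \<delta>" and ?e = "restr TX S ?W \<epsilon>"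
    have de: "?d \<in> derivations X ?W" "?e \<in> derivations X ?W"
      using T.restr_closed[OF U W sub(1), of \<delta>] T.restr_closed[OF S W sub(3), of \<epsilon>] \<delta> \<epsilon> by simp_all
    have fW: "restrict f ?W \<in> regular X ?W" using regular_restrict[OF f W sub(2)] .
    have r: "restrict (w S \<epsilon>) ?W \<in> regular X ?W" "restrict (\<delta> V f) ?W \<in> regular X ?W"
      using regular_restrict[OF w_closed[OF S \<epsilon>] W sub(3)] regular_restrict[OF \<delta>f W sub(2)] .
    have "restrict (w S \<epsilon>) ?W p * restrict (\<delta> V f) ?W p = 0" if p: "p \<in> ?W" for p
    proof -
      have "w ?W ?d p * ?e ?W (restrict f ?W) p = w ?W ?e p * ?d ?W (restrict f ?W) p"
        using w_proportional[OF W de W subset_refl fW p] .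
      moreover have "w ?W ?d p = 0" using w_restr[OF U W sub(1) \<delta>] z p sub by auto
      moreover have "w ?W ?e = restrict (w S \<epsilon>) ?W" using w_restr[OF S W sub(3) \<epsilon>] .
      moreover have "?d ?W (restrict f ?W) = restrict (\<delta> V f) ?W"
        using derivationsD(5)[OF \<delta> V f W sub(2)] restr_TX_apply[OF W subset_refl] by simp
      ultimately show ?thesis by simp
    qed
    then have "(\<forall>p\<in>?W. restrict (w S \<epsilon>) ?W p = 0) \<or> (\<forall>p\<in>?W. restrict (\<delta> V f) ?W p = 0)"
      using regular_integral[OF W r] by blast
    moreover have "\<not> (\<forall>p\<in>?W. restrict (\<delta> V f) ?W p = 0)"
      using regular_vanishing[OF V(1) \<delta>f W sub(2) Wne _ x(1)] x(2) by auto
    ultimately have "\<forall>p\<in>?W. w S \<epsilon> p = 0" by auto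
    then show "w S \<epsilon> y = 0" using regular_vanishing[OF S w_closed[OF S \<epsilon>] W sub(3) Wne _ y] by blast
  qed
  have "w = \<zero>\<^bsub>sections (canonical_sheaf X) X\<^esub>"
  proof (rule operator_eqI[of _ "{V \<in> opens X. V \<subseteq> X}" "derivations X"])
    have "w \<in> (\<Pi>\<^sub>E V\<in>{V \<in> opens X. V \<subseteq> X}. Sec TX V \<rightarrow>\<^sub>E Sec OX V)"
      using w_hom unfolding sheaf_homs_def by (elim CollectE conjE)
    then show "w \<in> (\<Pi>\<^sub>E V\<in>{V \<in> opens X. V \<subseteq> X}. derivations X V \<rightarrow>\<^sub>E extensional V)"
      by (auto simp: PiE_iff regular_def)
    show "\<zero>\<^bsub>sections (canonical_sheaf X) X\<^esub> \<in> (\<Pi>\<^sub>E V\<in>{V \<in> opens X. V \<subseteq> X}. derivations X V \<rightarrow>\<^sub>E extensional V)"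
      by (auto simp: canonical_sheaf_def dual_sheaf_def operator_sheaf_def)
    fix V \<epsilon> p assume "V \<in> {V \<in> opens X. V \<subseteq> X}" "\<epsilon> \<in> derivations X V" "p \<in> V"
    then show "w V \<epsilon> p = \<zero>\<^bsub>sections (canonical_sheaf X) X\<^esub> V \<epsilon> p"
      using w0 operator_sheaf_apply(3)[of V X X \<epsilon> "Sec TX" p] by (simp add: canonical_sheaf_def dual_sheaf_def)
  qed
  then show False using nz by blast
qed

text \<open>The contraction of logarithmic fields: the inclusion of T(-D) into T followed by
  \<open>w\<close>. It is characterised by its values on pure tensors rather than constructed,
  because it comes out of two universal properties.\<close>

definition contracts where
  "contracts lam \<longleftrightarrow> presheaf_mor X LX OX lam \<and> (\<forall>U\<in>opens X. \<forall>\<delta>\<in>derivations X U. \<forall>h\<in>Sec IX U.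
     lam U (germ_section X PX U (TI.pure_sec U \<delta> h)) = (\<lambda>x\<in>U. w U \<delta> x * h x))"

text \<open>The bilinear form w(\<delta>) h lifts to the tensor presheaf and then, since the
  structure sheaf is a sheaf, to the sheafification.\<close>

lemma contracts_exists: "\<exists>lam. contracts lam"
proof -
  let ?b = "\<lambda>U \<delta> h. \<lambda>x\<in>U. w U \<delta> x * h x"
  have "\<exists>l. presheaf_mor X PX OX l \<and>
     (\<forall>U\<in>opens X. \<forall>\<delta>\<in>Sec TX U. \<forall>h\<in>Sec IX U. l U (TI.pure_sec U \<delta> h) = ?b U \<delta> h)"
  proof (rule TI.tensor_lift_presheaf_exists[OF presheaf_structure_sheaf])
    fix U m h assume U: "U \<in> opens X" and m: "m \<in> Sec TX U" and h: "h \<in> Sec IX U"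
    have wm: "w U m \<in> regular X U" using w_closed U m by simp
    then show "?b U m h \<in> Sec OX U" using h regular_mult[OF U] by simp
    {
      fix m' assume "m' \<in> Sec TX U"
      then show "?b U (m \<oplus>\<^bsub>sections TX U\<^esub> m') h = ?b U m h \<oplus>\<^bsub>sections OX U\<^esub> ?b U m' h"
        using presheaf_morD(2)[OF w_mor U m] by (auto simp: restrict_def algebra_simps)
    next
      fix h' show "?b U m (h \<oplus>\<^bsub>sections IX U\<^esub> h') = ?b U m h \<oplus>\<^bsub>sections OX U\<^esub> ?b U m h'"
        by (auto simp: restrict_def algebra_simps)
    next
      fix a assume a: "a \<in> regular X U"
      show "?b U (a \<odot>\<^bsub>sections TX U\<^esub> m) h = a \<odot>\<^bsub>sections OX U\<^esub> ?b U m h"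
        using presheaf_morD(3)[OF w_mor U a m] by (auto simp: restrict_def algebra_simps)
      show "?b U m (a \<odot>\<^bsub>sections IX U\<^esub> h) = a \<odot>\<^bsub>sections OX U\<^esub> ?b U m h"
        by (auto simp: restrict_def algebra_simps)
    next
      fix V assume V: "V \<in> opens X" "V \<subseteq> U"
      show "restr OX U V (?b U m h) = ?b V (restr TX U V m) (restr IX U V h)"
        using w_restr[OF U V] m V by (auto simp: restrict_def fun_eq_iff)
    }
  qed
  then obtain l where l: "presheaf_mor X PX OX l"
    "\<forall>U\<in>opens X. \<forall>\<delta>\<in>Sec TX U. \<forall>h\<in>Sec IX U. l U (TI.pure_sec U \<delta> h) = ?b U \<delta> h" by blast
  obtain lam where lam: "presheaf_mor X (sheafify X PX) OX lam"
    "\<forall>U\<in>opens X. \<forall>m\<in>Sec PX U. lam U (germ_section X PX U m) = l U m"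
    using P.sheafify_lift_exists[OF sheaf_structure_sheaf l(1)] by blast
  have "contracts lam"
    unfolding contracts_def LX_eq
  proof (intro conjI ballI lam(1))
    fix U \<delta> h assume U: "U \<in> opens X" and d: "\<delta> \<in> derivations X U" "h \<in> Sec IX U"
    interpret TU: tensor "regular_ring X U" "sections TX U" "sections IX U" by (rule TI.tensor_sections[OF U])
    show "lam U (germ_section X PX U (TI.pure_sec U \<delta> h)) = ?b U \<delta> h"
      using lam(2) l(2) U d TU.pure_closed[of \<delta> h] by simp
  qed
  then show ?thesis by (rule exI[of contracts lam])
qed

end


section \<open>Local equality of sections, and finite sums in tensor products\<close>

lemma (in presheaf_mod) sheafify_section_eqI:
  assumes "U \<in> opens X" "s \<in> Sec SF U" "t \<in> Sec SF U"
    and "\<And>x. x \<in> U \<Longrightarrow> \<exists>V. x \<in> V \<and> restrict s V = restrict t V"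
  shows "s = t"
  by (rule sheafify_eqI[of s U t]) (use assms in \<open>auto simp: sheafify_section_iff\<close>)

lemma (in tensor) pure_finsum_left:
  assumes "finite A" "\<And>i. i \<in> A \<Longrightarrow> m i \<in> carrier M" "n \<in> carrier N"
  shows "(\<Oplus>\<^bsub>M\<^esub>i\<in>A. m i) \<bowtie> n = (\<Oplus>\<^bsub>TM\<^esub>i\<in>A. m i \<bowtie> n)"
  using assms(1,2)
proof (induction A rule: finite_induct)
  case empty
  then show ?case using assms(3) by (simp add: pure_zero_left)
next
  case (insert j A)
  have "(\<Oplus>\<^bsub>M\<^esub>i\<in>insert j A. m i) = m j \<oplus>\<^bsub>M\<^esub> (\<Oplus>\<^bsub>M\<^esub>i\<in>A. m i)"
    using insert by (intro M.finsum_insert) auto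
  moreover have "(\<Oplus>\<^bsub>TM\<^esub>i\<in>insert j A. m i \<bowtie> n) = m j \<bowtie> n \<oplus>\<^bsub>TM\<^esub> (\<Oplus>\<^bsub>TM\<^esub>i\<in>A. m i \<bowtie> n)"
    using insert assms(3) by (intro TM.finsum_insert) auto
  moreover have "(\<Oplus>\<^bsub>M\<^esub>i\<in>A. m i) \<in> carrier M" using insert by (intro M.finsum_closed) auto
  ultimately show ?case using insert assms(3) by (simp add: pure_add_left)
qed

text \<open>Coefficients of the left factor are moved to the right by balancing, so each generator
  carries one element of \<open>N\<close>. It is applied with \<open>e\<close> a local frame of
  \<open>E\<close>.\<close>

lemma (in tensor) tensor_generators:
  assumes e: "\<And>i. i < (r::nat) \<Longrightarrow> e i \<in> carrier M"
    and gen: "\<And>m. m \<in> carrier M \<Longrightarrow> \<exists>a. (\<forall>i<r. a i \<in> carrier R) \<and> m = (\<Oplus>\<^bsub>M\<^esub>i\<in>{..<r}. a i \<odot>\<^bsub>M\<^esub> e i)"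
    and C: "C \<in> carrier TM"
  shows "\<exists>s. (\<forall>i<r. s i \<in> carrier N) \<and> C = (\<Oplus>\<^bsub>TM\<^esub>i\<in>{..<r}. e i \<bowtie> s i)"
  using C
proof (induction rule: tensor_induct)
  case (pure m n)
  obtain a where a: "\<And>i. i < r \<Longrightarrow> a i \<in> carrier R" "m = (\<Oplus>\<^bsub>M\<^esub>i\<in>{..<r}. a i \<odot>\<^bsub>M\<^esub> e i)"
    using gen[OF pure(1)] by blast
  have "m \<bowtie> n = (\<Oplus>\<^bsub>TM\<^esub>i\<in>{..<r}. (a i \<odot>\<^bsub>M\<^esub> e i) \<bowtie> n)"
    unfolding a(2) by (rule pure_finsum_left) (use a e pure in auto)
  also have "\<dots> = (\<Oplus>\<^bsub>TM\<^esub>i\<in>{..<r}. e i \<bowtie> (a i \<odot>\<^bsub>N\<^esub> n))"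
    by (rule TM.finsum_cong') (use a e pure in \<open>auto simp: pure_balanced\<close>)
  finally show ?case using a pure by (intro exI[of _ "\<lambda>i. a i \<odot>\<^bsub>N\<^esub> n"]) auto
next
  case (add C C')
  then obtain s s' where s: "\<And>i. i < r \<Longrightarrow> s i \<in> carrier N" "C = (\<Oplus>\<^bsub>TM\<^esub>i\<in>{..<r}. e i \<bowtie> s i)"
    and s': "\<And>i. i < r \<Longrightarrow> s' i \<in> carrier N" "C' = (\<Oplus>\<^bsub>TM\<^esub>i\<in>{..<r}. e i \<bowtie> s' i)" by blast
  have "C \<oplus>\<^bsub>TM\<^esub> C' = (\<Oplus>\<^bsub>TM\<^esub>i\<in>{..<r}. e i \<bowtie> s i \<oplus>\<^bsub>TM\<^esub> e i \<bowtie> s' i)"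
    unfolding s(2) s'(2) by (rule TM.finsum_addf[symmetric]) (use s s' e in auto)
  also have "\<dots> = (\<Oplus>\<^bsub>TM\<^esub>i\<in>{..<r}. e i \<bowtie> (s i \<oplus>\<^bsub>N\<^esub> s' i))"
    by (rule TM.finsum_cong') (use s s' e in \<open>auto simp: pure_add_right\<close>)
  finally show ?case using s s' by (intro exI[of _ "\<lambda>i. s i \<oplus>\<^bsub>N\<^esub> s' i"]) auto
qed

lemma presheaf_mor_finsum:
  assumes F: "presheaf_mod X F" and G: "presheaf_mod X G" and \<phi>: "presheaf_mor X F G \<phi>" and U: "U \<in> opens X"
    and A: "finite A" "\<And>i. i \<in> A \<Longrightarrow> s i \<in> Sec F U"
  shows "\<phi> U (\<Oplus>\<^bsub>sections F U\<^esub>i\<in>A. s i) = (\<Oplus>\<^bsub>sections G U\<^esub>i\<in>A. \<phi> U (s i))"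
  using A
proof (induction A rule: finite_induct)
  case empty
  interpret M: abelian_group "sections F U" using presheaf_mod.abelian_group[OF F U] .
  interpret N: abelian_group "sections G U" using presheaf_mod.abelian_group[OF G U] .
  show ?case using presheaf_mor_zero[OF F G \<phi> U] by simp
next
  case (insert j A)
  interpret M: abelian_group "sections F U" using presheaf_mod.abelian_group[OF F U] .
  interpret N: abelian_group "sections G U" using presheaf_mod.abelian_group[OF G U] .
  note D = presheaf_morD(1,2)[OF \<phi> U]
  have "(\<Oplus>\<^bsub>sections F U\<^esub>i\<in>insert j A. s i) = s j \<oplus>\<^bsub>sections F U\<^esub> (\<Oplus>\<^bsub>sections F U\<^esub>i\<in>A. s i)"
    using insert by (intro M.finsum_insert) auto
  moreover have "(\<Oplus>\<^bsub>sections G U\<^esub>i\<in>insert j A. \<phi> U (s i)) = \<phi> U (s j) \<oplus>\<^bsub>sections G U\<^esub> (\<Oplus>\<^bsub>sections G U\<^esub>i\<in>A. \<phi> U (s i))"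
    using insert D by (intro N.finsum_insert) auto
  moreover have "(\<Oplus>\<^bsub>sections F U\<^esub>i\<in>A. s i) \<in> Sec F U" using insert by (intro M.finsum_closed) auto
  ultimately show ?case using insert D by simp
qed

section \<open>Symmetry and injectivity of the contraction of logarithmic fields\<close>

locale contraction_form = contraction X D w for X D :: "'n::finite pt set" and w +
  fixes lam
  assumes lam: "contracts lam"
begin

lemma lam_mor: "presheaf_mor X LX OX lam"
  using lam by (simp add: contracts_def)

lemma lam_pure: "\<lbrakk>U \<in> opens X; \<delta> \<in> derivations X U; h \<in> Sec IX U\<rbrakk> \<Longrightarrow>
  lam U (germ_section X PX U (TI.pure_sec U \<delta> h)) = (\<lambda>x\<in>U. w U \<delta> x * h x)"
  using lam by (simp add: contracts_def)

lemma lam_closed: "\<lbrakk>U \<in> opens X; s \<in> Sec LX U\<rbrakk> \<Longrightarrow> lam U s \<in> regular X U"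
  using presheaf_morD(1)[OF lam_mor] by simp

lemma germ_section_PX: "\<lbrakk>U \<in> opens X; C \<in> Sec PX U\<rbrakk> \<Longrightarrow> germ_section X PX U C \<in> Sec LX U"
  unfolding LX_eq by (rule P.germ_section_closed)

lemma lam_add: "\<lbrakk>U \<in> opens X; C \<in> Sec PX U; C' \<in> Sec PX U\<rbrakk> \<Longrightarrow>
  lam U (germ_section X PX U (C \<oplus>\<^bsub>sections PX U\<^esub> C')) =
  lam U (germ_section X PX U C) \<oplus>\<^bsub>regular_ring X U\<^esub> lam U (germ_section X PX U C')"
  using presheaf_morD(2)[OF lam_mor, of U "germ_section X PX U C" "germ_section X PX U C'"] germ_section_PX
  by (simp add: P.germ_section_add LX_eq regular_ring_def del: sections_tensor_presheaf)

lemma lam_restrict: "\<lbrakk>U \<in> opens X; V \<in> opens X; V \<subseteq> U; s \<in> Sec LX U\<rbrakk> \<Longrightarrow> restrict (lam U s) V = lam V (restrict s V)"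
  using presheaf_morD(4)[OF lam_mor, of U V s] by (simp add: LX_eq)

text \<open>Both sides are additive in each of \<open>C\<close> and \<open>C'\<close>, so two
  inductions reduce to pure tensors, and there \<open>w_smult_swap\<close> applies.\<close>

lemma lam_swap_presheaf:
  assumes U: "U \<in> opens X" and C: "C \<in> Sec PX U" "C' \<in> Sec PX U"
  shows "lam U (germ_section X PX U C) \<odot>\<^bsub>sections PX U\<^esub> C' = lam U (germ_section X PX U C') \<odot>\<^bsub>sections PX U\<^esub> C"
proof -
  interpret TU: tensor "regular_ring X U" "sections TX U" "sections IX U" by (rule TI.tensor_sections[OF U])
  let ?l = "\<lambda>C. lam U (germ_section X PX U C)"
  have cl: "?l C \<in> carrier (regular_ring X U)" if "C \<in> carrier TU.TM" for C
    using lam_closed[OF U germ_section_PX[OF U, of C]] that by simp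
  have ladd: "?l (C \<oplus>\<^bsub>TU.TM\<^esub> C') = ?l C \<oplus>\<^bsub>regular_ring X U\<^esub> ?l C'" if "C \<in> carrier TU.TM" "C' \<in> carrier TU.TM" for C C'
    using lam_add[OF U, of C C'] that by simp
  have pp: "?l (TU.pt \<delta> h) \<odot>\<^bsub>TU.TM\<^esub> TU.pt \<epsilon> k = ?l (TU.pt \<epsilon> k) \<odot>\<^bsub>TU.TM\<^esub> TU.pt \<delta> h"
    if d: "\<delta> \<in> Sec TX U" "\<epsilon> \<in> Sec TX U" and h: "h \<in> Sec IX U" "k \<in> Sec IX U" for \<delta> \<epsilon> h k
  proof -
    \<comment> \<open>A normal form: all of h is moved to the second factor, which becomes the
      product hk and is symmetric. The exchange of the two tensors is thereby left to the
      derivations alone.\<close>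
    have aux: "?l (TU.pt \<delta> h) \<odot>\<^bsub>TU.TM\<^esub> TU.pt \<epsilon> k = TU.pt (w U \<delta> \<odot>\<^bsub>sections TX U\<^esub> \<epsilon>) (\<lambda>x\<in>U. h x * k x)"
      if d: "\<delta> \<in> Sec TX U" "\<epsilon> \<in> Sec TX U" and h: "h \<in> Sec IX U" "k \<in> Sec IX U" for \<delta> \<epsilon> h k
    proof -
      have wr: "w U \<delta> \<in> carrier (regular_ring X U)" "h \<in> carrier (regular_ring X U)"
        using w_closed[OF U] d h by simp_all
      have "?l (TU.pt \<delta> h) = w U \<delta> \<otimes>\<^bsub>regular_ring X U\<^esub> h"
        using lam_pure[OF U _ h(1), of \<delta>] d by (simp add: regular_ring_def)
      also have "\<dots> = h \<otimes>\<^bsub>regular_ring X U\<^esub> w U \<delta>" using TU.M.R.m_comm wr by blast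
      finally have "?l (TU.pt \<delta> h) \<odot>\<^bsub>TU.TM\<^esub> TU.pt \<epsilon> k = (h \<otimes>\<^bsub>regular_ring X U\<^esub> w U \<delta>) \<odot>\<^bsub>TU.TM\<^esub> TU.pt \<epsilon> k" by simp
      also have "\<dots> = TU.pt (h \<odot>\<^bsub>sections TX U\<^esub> (w U \<delta> \<odot>\<^bsub>sections TX U\<^esub> \<epsilon>)) k"
        using TU.smult_pure[OF TU.M.R.m_closed[OF wr(2,1)] d(2) h(2)] TU.M.smult_assoc1[OF wr(2,1) d(2)] by simp
      also have "\<dots> = TU.pt (w U \<delta> \<odot>\<^bsub>sections TX U\<^esub> \<epsilon>) (h \<odot>\<^bsub>sections IX U\<^esub> k)"
        using TU.pure_balanced[OF wr(2) _ h(2)] TU.M.smult_closed[OF wr(1) d(2)] by blast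
      finally show ?thesis by simp
    qed
    have "(\<lambda>x\<in>U. h x * k x) = (\<lambda>x\<in>U. k x * h x)" by (simp add: mult.commute)
    then show ?thesis
      using aux[OF d h] aux[OF d(2,1) h(2,1)] w_smult_swap[OF U, of \<delta> \<epsilon>] d by simp
  qed
  have pC: "?l (TU.pt \<delta> h) \<odot>\<^bsub>TU.TM\<^esub> C' = ?l C' \<odot>\<^bsub>TU.TM\<^esub> TU.pt \<delta> h"
    if d: "\<delta> \<in> Sec TX U" and h: "h \<in> Sec IX U" and "C' \<in> carrier TU.TM" for \<delta> h C'
    using that(3)
  proof (induction rule: TU.tensor_induct)
    case (pure \<epsilon> k)
    then show ?case using pp d h by blast
  next
    case (add C C')
    then show ?case using TU.pure_closed[OF d h] cl ladd by (simp add: TU.TM.smult_r_distr TU.TM.smult_l_distr)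
  qed
  have "C \<in> carrier TU.TM" "C' \<in> carrier TU.TM" using C by simp_all
  then have "?l C \<odot>\<^bsub>TU.TM\<^esub> C' = ?l C' \<odot>\<^bsub>TU.TM\<^esub> C"
  proof (induction rule: TU.tensor_induct)
    case (pure \<delta> h)
    then show ?case using pC by blast
  next
    case (add C1 C2)
    then show ?case using cl ladd by (simp add: TU.TM.smult_r_distr TU.TM.smult_l_distr)
  qed
  then show ?thesis by simp
qed

lemma lam_swap:
  assumes U: "U \<in> opens X" and s: "s \<in> Sec LX U" "t \<in> Sec LX U"
  shows "lam U s \<odot>\<^bsub>sections LX U\<^esub> t = lam U t \<odot>\<^bsub>sections LX U\<^esub> s"
proof -
  interpret LU: module "regular_ring X U" "sections LX U" by (rule L.module[OF U])
  have cl: "lam U s \<odot>\<^bsub>sections LX U\<^esub> t \<in> Sec LX U" "lam U t \<odot>\<^bsub>sections LX U\<^esub> s \<in> Sec LX U"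
    using lam_closed[OF U] s by simp_all
  show ?thesis
  proof (rule P.sheafify_section_eqI[OF U, folded LX_eq, OF cl])
    fix x assume "x \<in> U"
    with P.sheafify_local2[OF U, folded LX_eq, OF s] obtain V C C' where V: "V \<in> opens X" "x \<in> V" "V \<subseteq> U"
      and C: "C \<in> Sec PX V" "C' \<in> Sec PX V"
      "restrict s V = germ_section X PX V C" "restrict t V = germ_section X PX V C'" by metis
    have lc: "lam V (germ_section X PX V C) \<in> regular X V" "lam V (germ_section X PX V C') \<in> regular X V"
      using lam_closed[OF V(1)] germ_section_PX[OF V(1)] C by blast+
    note r = P.restrict_sheafify_smult[OF U V(1) V(3), folded LX_eq]
    have "restrict (lam U s \<odot>\<^bsub>sections LX U\<^esub> t) V = restrict (lam U t \<odot>\<^bsub>sections LX U\<^esub> s) V"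
      unfolding r[OF s(2) lam_closed[OF U s(1)]] r[OF s(1) lam_closed[OF U s(2)]]
        lam_restrict[OF U V(1) V(3) s(1)] lam_restrict[OF U V(1) V(3) s(2)] C(3,4)
      using P.germ_section_smult[OF V(1) C(2) lc(1), folded LX_eq] P.germ_section_smult[OF V(1) C(1) lc(2), folded LX_eq]
        lam_swap_presheaf[OF V(1) C(1,2)] by simp
    then show "\<exists>V. x \<in> V \<and> restrict (lam U s \<odot>\<^bsub>sections LX U\<^esub> t) V = restrict (lam U t \<odot>\<^bsub>sections LX U\<^esub> s) V"
      using V by blast
  qed
qed

text \<open>By \<open>tensor_ideal_local\<close> the section is near each point a single pure tensor
  \<delta> \<otimes> t, so a vanishing contraction is a vanishing product of two regular functions,
  and irreducibility kills one of the factors.\<close>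

lemma lam_injective:
  assumes nz: "w \<noteq> \<zero>\<^bsub>sections (canonical_sheaf X) X\<^esub>"
    and U: "U \<in> opens X" and s: "s \<in> Sec LX U" and z: "lam U s = (\<lambda>x\<in>U. 0)"
  shows "s = \<zero>\<^bsub>sections LX U\<^esub>"
proof -
  interpret LU: module "regular_ring X U" "sections LX U" by (rule L.module[OF U])
  show ?thesis
  proof (rule P.sheafify_section_eqI[OF U, folded LX_eq, OF s LU.zero_closed])
    fix x assume x: "x \<in> U"
    then have xX: "x \<in> X" using U opens_subset by blast
    from P.sheafify_local[OF U, folded LX_eq, OF s x] obtain V0 C where V0: "V0 \<in> opens X" "x \<in> V0" "V0 \<subseteq> U"
      and C: "C \<in> Sec PX V0" "restrict s V0 = germ_section X PX V0 C" by metis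
    from ideal_generator[OF xX] obtain W t where W: "W \<in> opens X" "x \<in> W" and t: "t \<in> Sec IX W"
      and gen: "\<forall>V\<in>opens X. \<forall>h\<in>Sec IX V. x \<in> V \<longrightarrow>
         (\<exists>W'\<in>opens X. \<exists>k\<in>regular X W'. x \<in> W' \<and> W' \<subseteq> V \<inter> W \<and> (\<forall>y\<in>W'. h y = k y * t y))"
      by (elim exE conjE)
    obtain V \<delta> where V: "V \<in> opens X" "x \<in> V" "V \<subseteq> V0" "V \<subseteq> W" and \<delta>: "\<delta> \<in> derivations X V"
      "restr PX V0 V C = TI.pure_sec V \<delta> (restrict t V)"
      using tensor_ideal_local[OF W t gen[rule_format] V0(1,2) C(1)] by auto
    interpret TV: tensor "regular_ring X V" "sections TX V" "sections IX V" by (rule TI.tensor_sections[OF V(1)])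
    have VU: "V \<subseteq> U" using V V0 by auto
    have tV: "restrict t V \<in> Sec IX V" using I.restr_closed[OF W(1) V(1,4) t] by simp
    have sV: "restrict s V = germ_section X PX V (TI.pure_sec V \<delta> (restrict t V))"
      using P.restrict_germ_section_trans[OF C(2) V0(1) V(1,3) C(1)] \<delta>(2) by simp
    have "lam V (restrict s V) = restrict (\<lambda>x\<in>U. 0) V"
      using lam_restrict[OF U V(1) VU s] z by simp
    then have "(\<lambda>x\<in>V. w V \<delta> x * restrict t V x) = restrict (\<lambda>x\<in>U. 0) V"
      using lam_pure[OF V(1) \<delta>(1) tV] sV by simp
    then have prod0: "w V \<delta> y * restrict t V y = 0" if "y \<in> V" for y
      using that VU by (metis (no_types, lifting) restrict_apply' subsetD)
    \<comment> \<open>The second case does not occur on a curve, but it is harmless: \<open>\<delta> \<otimes> 0 = 0\<close>.\<close>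
    have "(\<forall>y\<in>V. w V \<delta> y = 0) \<or> (\<forall>y\<in>V. restrict t V y = 0)"
    proof (rule regular_integral[OF V(1) w_closed[OF V(1) \<delta>(1)] _ prod0])
      show "restrict t V \<in> regular X V" using tV by simp
    qed
    then have "TI.pure_sec V \<delta> (restrict t V) = \<zero>\<^bsub>sections PX V\<^esub>"
    proof
      assume "\<forall>y\<in>V. w V \<delta> y = 0"
      then have "\<delta> = \<zero>\<^bsub>sections TX V\<^esub>" using w_injective[OF nz V(1) \<delta>(1)] by blast
      then show ?thesis using TV.pure_zero_left[OF tV] by simp
    next
      assume "\<forall>y\<in>V. restrict t V y = 0"
      then have "restrict t V = \<zero>\<^bsub>sections IX V\<^esub>" by (auto simp: restrict_def fun_eq_iff)
      then show ?thesis using TV.pure_zero_right[of \<delta>] \<delta>(1) by simp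
    qed
    then have "restrict s V = \<zero>\<^bsub>sections LX V\<^esub>" unfolding sV LX_eq P.zero_sheafify by simp
    also have "\<dots> = restrict \<zero>\<^bsub>sections LX U\<^esub> V" using L.restr_zero[OF U V(1) VU] by (simp add: LX_eq)
    finally show "\<exists>V. x \<in> V \<and> restrict s V = restrict \<zero>\<^bsub>sections LX U\<^esub> V" using V by blast
  qed
qed

end

section \<open>Contraction with coefficients in a vector bundle\<close>

locale contraction_bundle = contraction_form X D w lam + E: sheaf_mod X E
  for X D :: "'n::finite pt set" and w lam and E :: "('n pt, 'm) presheaf"
begin

abbreviation "MX \<equiv> tensor_presheaf X E (log_tangent_sheaf X D)"
abbreviation "EL \<equiv> tensor_sheaf X E (log_tangent_sheaf X D)"

sublocale EL: tensor_presheaves X E LX by unfold_locales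
sublocale M: presheaf_mod X MX by unfold_locales (rule EL.presheaf_tensor)

lemma EL_eq: "EL = sheafify X MX" by (simp add: tensor_sheaf_def)

sublocale S: presheaf_mod X EL by unfold_locales (simp add: EL_eq M.presheaf_sheafify)

text \<open>The map id \<otimes> \<open>lam\<close> from E \<otimes> T to E \<otimes> O, followed by
  the identification of the latter with E; again it is pinned down by pure tensors.\<close>

definition bundle_contracts where
  "bundle_contracts c \<longleftrightarrow> presheaf_mor X EL E c \<and> (\<forall>U\<in>opens X. \<forall>m\<in>Sec E U. \<forall>s\<in>Sec LX U.
     c U (germ_section X MX U (EL.pure_sec U m s)) = lam U s \<odot>\<^bsub>sections E U\<^esub> m)"

lemma bundle_contracts_exists: "\<exists>c. bundle_contracts c"
proof -
  let ?b = "\<lambda>U m s. lam U s \<odot>\<^bsub>sections E U\<^esub> m"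
  have "\<exists>l. presheaf_mor X MX E l \<and>
     (\<forall>U\<in>opens X. \<forall>m\<in>Sec E U. \<forall>s\<in>Sec LX U. l U (EL.pure_sec U m s) = ?b U m s)"
  proof (rule EL.tensor_lift_presheaf_exists[OF E.presheaf])
    fix U m s assume U: "U \<in> opens X" and m: "m \<in> Sec E U" and s: "s \<in> Sec LX U"
    interpret EU: module "regular_ring X U" "sections E U" by (rule E.module[OF U])
    have ls: "lam U s \<in> carrier (regular_ring X U)" using lam_closed[OF U s] by simp
    show "?b U m s \<in> Sec E U" using m ls by simp
    {
      fix m' assume "m' \<in> Sec E U"
      then show "?b U (m \<oplus>\<^bsub>sections E U\<^esub> m') s = ?b U m s \<oplus>\<^bsub>sections E U\<^esub> ?b U m' s"
        using m ls by (simp add: EU.smult_r_distr)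
    next
      fix s' assume s': "s' \<in> Sec LX U"
      have ls': "lam U s' \<in> carrier (regular_ring X U)" using lam_closed[OF U s'] by simp
      have "lam U (s \<oplus>\<^bsub>sections LX U\<^esub> s') = lam U s \<oplus>\<^bsub>regular_ring X U\<^esub> lam U s'"
        using presheaf_morD(2)[OF lam_mor U s s'] by (simp add: regular_ring_def)
      then show "?b U m (s \<oplus>\<^bsub>sections LX U\<^esub> s') = ?b U m s \<oplus>\<^bsub>sections E U\<^esub> ?b U m s'"
        using EU.smult_l_distr[OF ls ls' m] by simp
    next
      fix a assume "a \<in> regular X U"
      then have a: "a \<in> carrier (regular_ring X U)" by simp
      show "?b U (a \<odot>\<^bsub>sections E U\<^esub> m) s = a \<odot>\<^bsub>sections E U\<^esub> ?b U m s"
        using EU.smult_assoc1[OF a ls m] EU.smult_assoc1[OF ls a m] EU.R.m_comm[OF a ls] by simp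
      have "lam U (a \<odot>\<^bsub>sections LX U\<^esub> s) = a \<otimes>\<^bsub>regular_ring X U\<^esub> lam U s"
        using presheaf_morD(3)[OF lam_mor U _ s, of a] a by (simp add: regular_ring_def)
      then show "?b U m (a \<odot>\<^bsub>sections LX U\<^esub> s) = a \<odot>\<^bsub>sections E U\<^esub> ?b U m s"
        using EU.smult_assoc1[OF a ls m] by simp
    next
      fix V assume V: "V \<in> opens X" "V \<subseteq> U"
      show "restr E U V (?b U m s) = ?b V (restr E U V m) (restr LX U V s)"
        using E.restr_smult[OF U V _ m, of "lam U s"] ls presheaf_morD(4)[OF lam_mor U V s] by simp
    }
  qed
  then obtain l where l: "presheaf_mor X MX E l"
    "\<forall>U\<in>opens X. \<forall>m\<in>Sec E U. \<forall>s\<in>Sec LX U. l U (EL.pure_sec U m s) = ?b U m s" by blast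
  obtain c where c: "presheaf_mor X (sheafify X MX) E c"
    "\<forall>U\<in>opens X. \<forall>m\<in>Sec MX U. c U (germ_section X MX U m) = l U m"
    using M.sheafify_lift_exists[OF E.sheaf l(1)] by blast
  have "bundle_contracts c"
    unfolding bundle_contracts_def EL_eq
  proof (intro conjI ballI c(1))
    fix U m s assume U: "U \<in> opens X" and m: "m \<in> Sec E U" "s \<in> Sec LX U"
    interpret TU: tensor "regular_ring X U" "sections E U" "sections LX U" by (rule EL.tensor_sections[OF U])
    show "c U (germ_section X MX U (EL.pure_sec U m s)) = ?b U m s"
      using c(2) l(2) U m TU.pure_closed[of m s] by simp
  qed
  then show ?thesis by (rule exI[of bundle_contracts c])
qed

end


locale bundle_contraction = contraction_bundle X D w lam E
  for X D :: "'n::finite pt set" and w lam and E :: "('n pt, 'm) presheaf" +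
  fixes c
  assumes c: "bundle_contracts c"
begin

lemma c_mor: "presheaf_mor X EL E c"
  using c by (simp add: bundle_contracts_def)

lemma c_pure: "\<lbrakk>U \<in> opens X; m \<in> Sec E U; s \<in> Sec LX U\<rbrakk> \<Longrightarrow>
   c U (germ_section X MX U (EL.pure_sec U m s)) = lam U s \<odot>\<^bsub>sections E U\<^esub> m"
  using c by (simp add: bundle_contracts_def)

lemma germ_section_MX: "\<lbrakk>U \<in> opens X; C \<in> Sec MX U\<rbrakk> \<Longrightarrow> germ_section X MX U C \<in> Sec EL U"
  unfolding EL_eq by (rule M.germ_section_closed)

lemma c_add: "\<lbrakk>U \<in> opens X; C \<in> Sec MX U; C' \<in> Sec MX U\<rbrakk> \<Longrightarrow>
  c U (germ_section X MX U (C \<oplus>\<^bsub>sections MX U\<^esub> C')) =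
  c U (germ_section X MX U C) \<oplus>\<^bsub>sections E U\<^esub> c U (germ_section X MX U C')"
  using presheaf_morD(2)[OF c_mor, of U "germ_section X MX U C" "germ_section X MX U C'"] germ_section_MX
  by (simp add: M.germ_section_add EL_eq del: sections_tensor_presheaf)

lemma c_closed: "\<lbrakk>U \<in> opens X; S \<in> Sec EL U\<rbrakk> \<Longrightarrow> c U S \<in> Sec E U"
  using presheaf_morD(1)[OF c_mor] .

lemma c_restrict: "\<lbrakk>U \<in> opens X; V \<in> opens X; V \<subseteq> U; S \<in> Sec EL U\<rbrakk> \<Longrightarrow> restr E U V (c U S) = c V (restrict S V)"
  using presheaf_morD(4)[OF c_mor, of U V S] by (simp add: EL_eq)

text \<open>For C = m \<otimes> t: lam(s) (m \<otimes> t) = m \<otimes> lam(s) t = m \<otimes>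
  lam(t) s = (lam(t) m) \<otimes> s, where the middle equality is \<open>lam_swap\<close>. In effect
  the factor of \<open>C\<close> in the line bundle is exchanged for \<open>s\<close>.\<close>

lemma lam_smult_presheaf:
  assumes U: "U \<in> opens X" and s: "s \<in> Sec LX U" and C: "C \<in> Sec MX U"
  shows "lam U s \<odot>\<^bsub>sections MX U\<^esub> C = EL.pure_sec U (c U (germ_section X MX U C)) s"
proof -
  interpret TU: tensor "regular_ring X U" "sections E U" "sections LX U" by (rule EL.tensor_sections[OF U])
  have lr: "lam U t \<in> carrier (regular_ring X U)" if "t \<in> Sec LX U" for t using lam_closed[OF U that] by simp
  have cc: "c U (germ_section X MX U C) \<in> Sec E U" if "C \<in> carrier TU.TM" for C
    using c_closed[OF U germ_section_MX[OF U, of C]] that by simp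
  have "C \<in> carrier TU.TM" using C by simp
  then have "lam U s \<odot>\<^bsub>TU.TM\<^esub> C = TU.pt (c U (germ_section X MX U C)) s"
  proof (induction rule: TU.tensor_induct)
    case (pure m t)
    have "lam U s \<odot>\<^bsub>TU.TM\<^esub> TU.pt m t = TU.pt m (lam U s \<odot>\<^bsub>sections LX U\<^esub> t)"
      using TU.smult_pure[OF lr[OF s] pure] TU.pure_balanced[OF lr[OF s] pure] by simp
    also have "\<dots> = TU.pt m (lam U t \<odot>\<^bsub>sections LX U\<^esub> s)" using lam_swap[OF U s pure(2)] by simp
    also have "\<dots> = TU.pt (lam U t \<odot>\<^bsub>sections E U\<^esub> m) s"
      using TU.pure_balanced[OF lr[OF pure(2)] pure(1) s] by simp
    finally show ?case using c_pure[OF U pure] by simp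
  next
    case (add C C')
    then show ?case using lr[OF s] cc s c_add[OF U, of C C']
      by (simp add: TU.TM.smult_r_distr TU.pure_add_left)
  qed
  then show ?thesis by simp
qed

lemma lam_smult:
  assumes U: "U \<in> opens X" and s: "s \<in> Sec LX U" and Q: "Q \<in> Sec EL U"
  shows "lam U s \<odot>\<^bsub>sections EL U\<^esub> Q = germ_section X MX U (EL.pure_sec U (c U Q) s)"
proof -
  interpret SU: module "regular_ring X U" "sections EL U" by (rule S.module[OF U])
  interpret TU: tensor "regular_ring X U" "sections E U" "sections LX U" by (rule EL.tensor_sections[OF U])
  have pc: "EL.pure_sec U (c U Q) s \<in> Sec MX U" using c_closed[OF U Q] s by simp
  have cl: "lam U s \<odot>\<^bsub>sections EL U\<^esub> Q \<in> Sec EL U" "germ_section X MX U (EL.pure_sec U (c U Q) s) \<in> Sec EL U"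
    using lam_closed[OF U s] Q germ_section_MX[OF U pc] by simp_all
  show ?thesis
  proof (rule M.sheafify_section_eqI[OF U, folded EL_eq, OF cl])
    fix x assume "x \<in> U"
    with M.sheafify_local[OF U, folded EL_eq, OF Q] obtain V C where V: "V \<in> opens X" "x \<in> V" "V \<subseteq> U"
      and C: "C \<in> Sec MX V" "restrict Q V = germ_section X MX V C" by metis
    have sV: "restrict s V \<in> Sec LX V" using L.restr_closed[OF U V(1,3) s] by (simp add: LX_eq)
    have "restrict (lam U s \<odot>\<^bsub>sections EL U\<^esub> Q) V = restrict (lam U s) V \<odot>\<^bsub>sections EL V\<^esub> restrict Q V"
      using M.restrict_sheafify_smult[OF U V(1,3), folded EL_eq, OF Q lam_closed[OF U s]] .
    also have "\<dots> = germ_section X MX V (lam V (restrict s V) \<odot>\<^bsub>sections MX V\<^esub> C)"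
      using M.germ_section_smult[OF V(1) C(1) lam_closed[OF V(1) sV], folded EL_eq] lam_restrict[OF U V(1,3) s] C(2) by simp
    also have "\<dots> = germ_section X MX V (EL.pure_sec V (c V (restrict Q V)) (restrict s V))"
      using lam_smult_presheaf[OF V(1) sV C(1)] C(2) by simp
    also have "\<dots> = germ_section X MX V (restr MX U V (EL.pure_sec U (c U Q) s))"
      using EL.restr_pure[OF U V(1,3) c_closed[OF U Q] s] c_restrict[OF U V(1,3) Q] by (simp add: LX_eq)
    also have "\<dots> = restrict (germ_section X MX U (EL.pure_sec U (c U Q) s)) V"
      using M.restrict_germ_section[OF V(1,3) U pc] by simp
    finally show "\<exists>V. x \<in> V \<and> restrict (lam U s \<odot>\<^bsub>sections EL U\<^esub> Q) V = restrict (germ_section X MX U (EL.pure_sec U (c U Q) s)) V"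
      using V by blast
  qed
qed

text \<open>The contraction of a co-Higgs field with a differential commutes with the field: by
  \<open>lam_swap\<close>, two sections of the line bundle can be contracted in either order.\<close>

lemma contracted_field_End:
  assumes \<Phi>: "\<Phi> \<in> cohiggs_fields X D E"
  shows "ext_mor X E (\<lambda>U m. c U (\<Phi> U m)) \<in> cohiggs_End X D E \<Phi>" (is "?f \<in> _")
proof -
  have \<Phi>m: "presheaf_mor X E EL \<Phi>" using \<Phi> unfolding cohiggs_fields_def by (rule sheaf_homs_presheaf_mor)
  note \<Phi>D = presheaf_morD[OF \<Phi>m]
  have f: "?f \<in> sheaf_homs X X E E"
    by (rule presheaf_mor_sheaf_homs[OF E.presheaf_mod_axioms presheaf_mor_compose[OF \<Phi>m c_mor]])
  have fm: "presheaf_mor X E E ?f" using f by (rule sheaf_homs_presheaf_mor)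
  let ?h = "EL.map_left ?f"
  have hm: "presheaf_mor X MX MX ?h" using EL.map_left_mor[OF fm] .
  note hD = presheaf_morD[OF hm]
  \<comment> \<open>On m \<otimes> s the left side is c(\<Phi> m) \<otimes> s, which
    \<open>lam_smult\<close> rewrites as lam(s) \<Phi>(m); linearity of \<Phi> then moves the scalar
    inside, giving \<Phi>(c(m \<otimes> s)).\<close>
  have key: "germ_section X MX V (?h V C) = \<Phi> V (c V (germ_section X MX V C))"
    if V: "V \<in> opens X" and C: "C \<in> Sec MX V" for V C
  proof -
    interpret TV: tensor "regular_ring X V" "sections E V" "sections LX V" by (rule EL.tensor_sections[OF V])
    have "C \<in> carrier TV.TM" using C by simp
    then show ?thesis
    proof (induction rule: TV.tensor_induct)
      case (pure m s)
      have "germ_section X MX V (?h V (TV.pt m s)) = germ_section X MX V (TV.pt (c V (\<Phi> V m)) s)"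
        using EL.map_left_pure[OF fm V pure] V pure by simp
      also have "\<dots> = lam V s \<odot>\<^bsub>sections EL V\<^esub> \<Phi> V m"
        using lam_smult[OF V pure(2) \<Phi>D(1)[OF V pure(1)]] by simp
      also have "\<dots> = \<Phi> V (lam V s \<odot>\<^bsub>sections E V\<^esub> m)"
        using \<Phi>D(3)[OF V lam_closed[OF V pure(2)] pure(1)] by simp
      finally show ?case using c_pure[OF V pure] by simp
    next
      case (add C C')
      then have C: "C \<in> Sec MX V" "C' \<in> Sec MX V" by simp_all
      have "germ_section X MX V (?h V (C \<oplus>\<^bsub>sections MX V\<^esub> C')) =
          germ_section X MX V (?h V C) \<oplus>\<^bsub>sections EL V\<^esub> germ_section X MX V (?h V C')"
        using hD(2)[OF V C] M.germ_section_add[OF V hD(1)[OF V C(1)] hD(1)[OF V C(2)]] by (simp add: EL_eq)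
      also have "\<dots> = \<Phi> V (c V (germ_section X MX V (C \<oplus>\<^bsub>sections MX V\<^esub> C')))"
        using add(3,4) \<Phi>D(2)[OF V c_closed[OF V germ_section_MX[OF V C(1)]] c_closed[OF V germ_section_MX[OF V C(2)]]]
          c_add[OF V C] by simp
      finally show ?case by simp
    qed
  qed
  \<comment> \<open>This holds for all sections S of E \<otimes> T. Commutation with the field is
    the case S = \<Phi> m, where \<Phi>(c(\<Phi> m)) is \<Phi> applied to the contracted
    field.\<close>
  have id: "tensor_id X E LX ?f U S = \<Phi> U (c U S)" if U: "U \<in> opens X" and S: "S \<in> Sec EL U" for U S
  proof (rule M.sheafify_eqI[of _ U])
    show "tensor_id X E LX ?f U S \<in> extensional U"
      using U S by (simp add: tensor_id_def sheafify_hom_def EL_eq)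
    show "\<Phi> U (c U S) \<in> extensional U"
      using \<Phi>D(1)[OF U c_closed[OF U S]] M.sheafify_section_iff[OF U] by (simp add: EL_eq)
    fix x assume "x \<in> U"
    with M.sheafify_local[OF U, folded EL_eq, OF S] obtain V C where V: "V \<in> opens X" "x \<in> V" "V \<subseteq> U"
      and C: "C \<in> Sec MX V" "restrict S V = germ_section X MX V C" by metis
    have "restrict (tensor_id X E LX ?f U S) V = sheafify_hom X MX MX ?h V (restrict S V)"
      unfolding tensor_id_def by (rule M.restrict_sheafify_hom[OF U V(1,3)]) (use S in \<open>simp add: EL_eq\<close>)
    also have "\<dots> = germ_section X MX V (?h V C)"
      unfolding C(2) by (rule M.sheafify_hom_germ_section[OF hm M.presheaf V(1) C(1)])
    also have "\<dots> = \<Phi> V (restr E U V (c U S))"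
      using key[OF V(1) C(1)] c_restrict[OF U V(1,3) S] C(2) by simp
    also have "\<dots> = restrict (\<Phi> U (c U S)) V"
      using \<Phi>D(4)[OF U V(1,3) c_closed[OF U S]] by (simp add: EL_eq)
    finally show "\<exists>V. x \<in> V \<and> restrict (tensor_id X E LX ?f U S) V = restrict (\<Phi> U (c U S)) V"
      using V by blast
  qed
  show ?thesis
    unfolding cohiggs_End_def
  proof (intro CollectI conjI ballI f)
    fix U m assume U: "U \<in> opens X" and m: "m \<in> Sec E U"
    show "tensor_id X E LX ?f U (\<Phi> U m) = \<Phi> U (?f U m)"
      using id[OF U \<Phi>D(1)[OF U m]] U m by simp
  qed
qed

text \<open>In a local frame e of E the section is a sum of e_i \<otimes> s_i, and its contraction
  is the sum of lam(s_i) e_i. Uniqueness of coefficients in the frame gives lam(s_i) = 0 for each i,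
  and \<open>lam_injective\<close> gives s_i = 0.\<close>

lemma c_injective:
  assumes nz: "w \<noteq> \<zero>\<^bsub>sections (canonical_sheaf X) X\<^esub>" and vb: "vector_bundle X r E"
    and U: "U \<in> opens X" and S: "S \<in> Sec EL U" and z: "c U S = \<zero>\<^bsub>sections E U\<^esub>"
  shows "S = \<zero>\<^bsub>sections EL U\<^esub>"
proof -
  interpret SU: module "regular_ring X U" "sections EL U" by (rule S.module[OF U])
  show ?thesis
  proof (rule M.sheafify_section_eqI[OF U, folded EL_eq, OF S SU.zero_closed])
    fix x assume x: "x \<in> U"
    then have "x \<in> X" using U opens_subset by blast
    then obtain W e where W: "x \<in> W" "frame X E r W e" using vb unfolding vector_bundle_def by blast
    then have Wo: "W \<in> opens X" and eW: "\<And>i. i < r \<Longrightarrow> e i \<in> Sec E W"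
      and fr: "\<And>V m. \<lbrakk>V \<in> opens X; V \<subseteq> W; m \<in> Sec E V\<rbrakk> \<Longrightarrow> \<exists>!a. a \<in> {..<r} \<rightarrow>\<^sub>E regular X V \<and>
        m = (\<Oplus>\<^bsub>sections E V\<^esub>i\<in>{..<r}. a i \<odot>\<^bsub>sections E V\<^esub> restr E W V (e i))"
      by (simp_all add: frame_def)
    from M.sheafify_local_subset[OF U, folded EL_eq, OF S x Wo W(1)] obtain V C where V: "V \<in> opens X" "x \<in> V" "V \<subseteq> U" "V \<subseteq> W"
      and C: "C \<in> Sec MX V" "restrict S V = germ_section X MX V C" by metis
    interpret TV: tensor "regular_ring X V" "sections E V" "sections LX V" by (rule EL.tensor_sections[OF V(1)])
    let ?e = "\<lambda>i. restr E W V (e i)"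
    have e: "?e i \<in> Sec E V" if "i < r" for i using E.restr_closed[OF Wo V(1,4) eW[OF that]] .
    have gen: "\<exists>a. (\<forall>i<r. a i \<in> carrier (regular_ring X V)) \<and>
        m = (\<Oplus>\<^bsub>sections E V\<^esub>i\<in>{..<r}. a i \<odot>\<^bsub>sections E V\<^esub> ?e i)" if "m \<in> Sec E V" for m
      using ex1_implies_ex[OF fr[OF V(1,4) that]] by (auto simp: PiE_iff)
    have "C \<in> carrier TV.TM" using C(1) by simp
    from TV.tensor_generators[OF e gen this] obtain s where s: "\<And>i. i < r \<Longrightarrow> s i \<in> Sec LX V"
      and Cs: "C = (\<Oplus>\<^bsub>TV.TM\<^esub>i\<in>{..<r}. TV.pt (?e i) (s i))" by blast
    let ?c = "\<lambda>U C. c U (germ_section X MX U C)"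
    have germ_mor: "presheaf_mor X MX EL (germ_section X MX)"
      unfolding presheaf_mor_def semilinear_def carrier_regular_ring
      using germ_section_MX M.germ_section_add M.germ_section_smult M.restrict_germ_section
      by (simp add: EL_eq del: sections_tensor_presheaf)
    have cm: "presheaf_mor X MX E ?c" by (rule presheaf_mor_compose[OF germ_mor c_mor])
    have l: "lam V (s i) \<in> regular X V" if "i < r" for i using lam_closed[OF V(1) s[OF that]] .
    have "?c V C = (\<Oplus>\<^bsub>sections E V\<^esub>i\<in>{..<r}. ?c V (TV.pt (?e i) (s i)))"
      unfolding Cs sections_tensor_presheaf[symmetric]
      by (rule presheaf_mor_finsum[OF M.presheaf_mod_axioms E.presheaf_mod_axioms cm V(1)]) (use e s in auto)
    also have "\<dots> = (\<Oplus>\<^bsub>sections E V\<^esub>i\<in>{..<r}. lam V (s i) \<odot>\<^bsub>sections E V\<^esub> ?e i)"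
      by (rule TV.M.M.finsum_cong') (use c_pure[OF V(1) e s] l e in auto)
    finally have cC: "?c V C = (\<Oplus>\<^bsub>sections E V\<^esub>i\<in>{..<r}. lam V (s i) \<odot>\<^bsub>sections E V\<^esub> ?e i)" .
    have cC0: "?c V C = \<zero>\<^bsub>sections E V\<^esub>"
      using c_restrict[OF U V(1,3) S] z E.restr_zero[OF U V(1,3)] C(2) by simp
    have zsum: "\<zero>\<^bsub>sections E V\<^esub> = (\<Oplus>\<^bsub>sections E V\<^esub>i\<in>{..<r}. (\<lambda>x\<in>V. 0) \<odot>\<^bsub>sections E V\<^esub> ?e i)"
    proof -
      have "(\<lambda>x\<in>V. 0) \<odot>\<^bsub>sections E V\<^esub> ?e i = \<zero>\<^bsub>sections E V\<^esub>" if "i < r" for i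
        using TV.M.smult_l_null[OF e[OF that]] by (simp add: regular_ring_def)
      then have "(\<Oplus>\<^bsub>sections E V\<^esub>i\<in>{..<r}. (\<lambda>x\<in>V. 0) \<odot>\<^bsub>sections E V\<^esub> ?e i) =
          (\<Oplus>\<^bsub>sections E V\<^esub>i\<in>{..<r}. \<zero>\<^bsub>sections E V\<^esub>)"
        by (intro TV.M.M.finsum_cong') auto
      then show ?thesis by simp
    qed
    \<comment> \<open>Both coefficient families are cut off outside the index range, since the
      uniqueness in \<open>frame\<close> is stated for extensional families.\<close>
    let ?a = "\<lambda>i\<in>{..<r}. lam V (s i)" and ?b = "\<lambda>i\<in>{..<r}. \<lambda>x\<in>V. 0 :: complex"
    have "?a \<in> {..<r} \<rightarrow>\<^sub>E regular X V" "?b \<in> {..<r} \<rightarrow>\<^sub>E regular X V"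
      using l regular_const[OF V(1)] by auto
    moreover have "\<zero>\<^bsub>sections E V\<^esub> = (\<Oplus>\<^bsub>sections E V\<^esub>i\<in>{..<r}. ?a i \<odot>\<^bsub>sections E V\<^esub> ?e i)"
      unfolding cC0[symmetric] cC by (rule TV.M.M.finsum_cong') (use l e in auto)
    moreover have "\<zero>\<^bsub>sections E V\<^esub> = (\<Oplus>\<^bsub>sections E V\<^esub>i\<in>{..<r}. ?b i \<odot>\<^bsub>sections E V\<^esub> ?e i)"
      by (subst zsum, rule TV.M.M.finsum_cong') (use regular_const[OF V(1)] e in auto)
    ultimately have ab: "?a = ?b" using fr[OF V(1,4) TV.M.M.zero_closed] by blast
    have "lam V (s i) = (\<lambda>x\<in>V. 0)" if "i < r" for i using fun_cong[OF ab, of i] that by simp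
    then have "s i = \<zero>\<^bsub>sections LX V\<^esub>" if "i < r" for i using lam_injective[OF nz V(1) s[OF that]] that by blast
    then have "TV.pt (?e i) (s i) = \<zero>\<^bsub>TV.TM\<^esub>" if "i < r" for i using TV.pure_zero_right[OF e[OF that]] that by simp
    then have "C = (\<Oplus>\<^bsub>TV.TM\<^esub>i\<in>{..<r}. \<zero>\<^bsub>TV.TM\<^esub>)" unfolding Cs by (intro TV.TM.finsum_cong') auto
    then have "restrict S V = \<zero>\<^bsub>sections EL V\<^esub>" unfolding C(2) EL_eq M.zero_sheafify by simp
    also have "\<dots> = restrict \<zero>\<^bsub>sections EL U\<^esub> V" using S.restr_zero[OF U V(1,3)] by (simp add: EL_eq)
    finally show "\<exists>V. x \<in> V \<and> restrict S V = restrict \<zero>\<^bsub>sections EL U\<^esub> V" using V by blast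
  qed
qed

end

section \<open>Linear dependence of the contraction on the differential\<close>

lemma lam_linear_combination:
  assumes A: "contraction_form X D w0 lam0" and B: "contraction_form X D w1 lam1" and C: "contraction_form X D w2 lam2"
    and w: "\<And>U \<delta> x. \<lbrakk>U \<in> opens X; \<delta> \<in> derivations X U; x \<in> U\<rbrakk> \<Longrightarrow> w2 U \<delta> x = a * w0 U \<delta> x + b * w1 U \<delta> x"
    and U: "U \<in> opens X" and s: "s \<in> Sec (log_tangent_sheaf X D) U" and x: "x \<in> U"
  shows "lam2 U s x = a * lam0 U s x + b * lam1 U s x"
proof -
  interpret A: contraction_form X D w0 lam0 by fact
  interpret B: contraction_form X D w1 lam1 by fact
  interpret C: contraction_form X D w2 lam2 by fact
  from A.P.sheafify_local[OF U, folded A.LX_eq, OF s x] obtain V Z where V: "V \<in> opens X" "x \<in> V" "V \<subseteq> U"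
    and Z: "Z \<in> Sec A.PX V" "restrict s V = germ_section X A.PX V Z" by metis
  interpret TV: tensor "regular_ring X V" "sections A.TX V" "sections A.IX V" by (rule A.TI.tensor_sections[OF V(1)])
  have "Z \<in> carrier TV.TM" using Z by simp
  then have "lam2 V (germ_section X A.PX V Z) x = a * lam0 V (germ_section X A.PX V Z) x + b * lam1 V (germ_section X A.PX V Z) x"
  proof (induction rule: TV.tensor_induct)
    case (pure \<delta> h)
    then have d: "\<delta> \<in> derivations X V" by simp
    show ?case
      using A.lam_pure[OF V(1) d pure(2)] B.lam_pure[OF V(1) d pure(2)] C.lam_pure[OF V(1) d pure(2)] w[OF V(1) d V(2)] V(2)
      by (simp add: algebra_simps)
  next
    case (add Z Z')
    then have Z: "Z \<in> Sec A.PX V" "Z' \<in> Sec A.PX V" by simp_all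
    have ring: "(f \<oplus>\<^bsub>regular_ring X V\<^esub> g) x = f x + g x" for f g using V(2) by (simp add: regular_ring_def)
    show ?case
      using add(3,4) A.lam_add[OF V(1) Z] B.lam_add[OF V(1) Z] C.lam_add[OF V(1) Z]
      by (simp add: ring algebra_simps)
  qed
  moreover have "lam2 U s x = lam2 V (restrict s V) x" "lam1 U s x = lam1 V (restrict s V) x" "lam0 U s x = lam0 V (restrict s V) x"
    using A.lam_restrict[OF U V(1,3) s, symmetric] B.lam_restrict[OF U V(1,3) s, symmetric]
      C.lam_restrict[OF U V(1,3) s, symmetric] V(2) by simp_all
  ultimately show ?thesis using Z(2) by simp
qed

text \<open>The three contractions come from separate existence statements, so their linear relation
  is not built in. It is recovered from their values on pure tensors, locally, and then carried to
  \<open>U\<close> because \<open>E\<close> is a sheaf.\<close>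

lemma contraction_linear_combination:
  assumes A: "bundle_contraction X D w0 lam0 E c0" and B: "bundle_contraction X D w1 lam1 E c1" and C: "bundle_contraction X D w2 lam2 E c2"
    and w: "\<And>U \<delta> x. \<lbrakk>U \<in> opens X; \<delta> \<in> derivations X U; x \<in> U\<rbrakk> \<Longrightarrow> w2 U \<delta> x = a * w0 U \<delta> x + b * w1 U \<delta> x"
    and U: "U \<in> opens X" and S: "S \<in> Sec (tensor_sheaf X E (log_tangent_sheaf X D)) U"
  shows "c2 U S = (\<lambda>x\<in>U. a) \<odot>\<^bsub>sections E U\<^esub> c0 U S \<oplus>\<^bsub>sections E U\<^esub> (\<lambda>x\<in>U. b) \<odot>\<^bsub>sections E U\<^esub> c1 U S"
proof -
  interpret A: bundle_contraction X D w0 lam0 E c0 by fact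
  interpret B: bundle_contraction X D w1 lam1 E c1 by fact
  interpret C: bundle_contraction X D w2 lam2 E c2 by fact
  have const: "(\<lambda>x\<in>V. k) \<in> carrier (regular_ring X V)" if "V \<in> opens X" for V and k :: complex
    using regular_const[OF that] by simp
  interpret EU: module "regular_ring X U" "sections E U" by (rule A.E.module[OF U])
  let ?r = "\<lambda>U S. (\<lambda>x\<in>U. a) \<odot>\<^bsub>sections E U\<^esub> c0 U S \<oplus>\<^bsub>sections E U\<^esub> (\<lambda>x\<in>U. b) \<odot>\<^bsub>sections E U\<^esub> c1 U S"
  show ?thesis
  proof (rule A.E.section_eqI[OF U C.c_closed[OF U S]])
    show "?r U S \<in> Sec E U" using const[OF U] A.c_closed[OF U S] B.c_closed[OF U S] by simp
    fix x assume x: "x \<in> U"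
    from A.M.sheafify_local[OF U, folded A.EL_eq, OF S x] obtain V Z where V: "V \<in> opens X" "x \<in> V" "V \<subseteq> U"
      and Z: "Z \<in> Sec A.MX V" "restrict S V = germ_section X A.MX V Z" by metis
    interpret EV: module "regular_ring X V" "sections E V" by (rule A.E.module[OF V(1)])
    interpret TV: tensor "regular_ring X V" "sections E V" "sections A.LX V" by (rule A.EL.tensor_sections[OF V(1)])
    have "Z \<in> carrier TV.TM" using Z by simp
    then have "c2 V (germ_section X A.MX V Z) = ?r V (germ_section X A.MX V Z)"
    proof (induction rule: TV.tensor_induct)
      case (pure m s)
      have l: "lam0 V s \<in> carrier (regular_ring X V)" "lam1 V s \<in> carrier (regular_ring X V)" "lam2 V s \<in> carrier (regular_ring X V)"
        using A.lam_closed[OF V(1) pure(2)] B.lam_closed[OF V(1) pure(2)] C.lam_closed[OF V(1) pure(2)] by simp_all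
      have "lam2 V s = (\<lambda>x\<in>V. a * lam0 V s x + b * lam1 V s x)"
        using lam_linear_combination[OF A.contraction_form_axioms B.contraction_form_axioms C.contraction_form_axioms w V(1) pure(2)] l(3)
        by (auto simp: regular_def extensional_def restrict_def fun_eq_iff)
      then have "lam2 V s = ((\<lambda>x\<in>V. a) \<otimes>\<^bsub>regular_ring X V\<^esub> lam0 V s) \<oplus>\<^bsub>regular_ring X V\<^esub> ((\<lambda>x\<in>V. b) \<otimes>\<^bsub>regular_ring X V\<^esub> lam1 V s)"
        by (auto simp: regular_ring_def restrict_def fun_eq_iff)
      then show ?case
        using A.c_pure[OF V(1) pure] B.c_pure[OF V(1) pure] C.c_pure[OF V(1) pure] const[OF V(1)] l pure(1)
        by (simp add: EV.smult_l_distr EV.smult_assoc1 del: carrier_regular_ring restrict_apply)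
    next
      case (add Z Z')
      then have Z: "Z \<in> Sec A.MX V" "Z' \<in> Sec A.MX V" by simp_all
      note cl = A.c_closed[OF V(1) A.germ_section_MX[OF V(1)]] B.c_closed[OF V(1) B.germ_section_MX[OF V(1)]]
      note cZ = cl[OF Z(1)] cl[OF Z(2)]
      show ?case
        using add(3,4) A.c_add[OF V(1) Z] B.c_add[OF V(1) Z] C.c_add[OF V(1) Z] const[OF V(1)] cZ
        by (simp add: EV.smult_r_distr EV.a_ac del: carrier_regular_ring restrict_apply)
    qed
    then have "c2 V (restrict S V) = ?r V (restrict S V)" using Z by simp
    moreover have "restr E U V (?r U S) = ?r V (restrict S V)"
    proof -
      have k: "restrict (\<lambda>x\<in>U. k) V = (\<lambda>x\<in>V. k)" for k :: complex using V(3) by (auto simp: restrict_def fun_eq_iff)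
      have "restr E U V ((\<lambda>x\<in>U. k) \<odot>\<^bsub>sections E U\<^esub> m) = (\<lambda>x\<in>V. k) \<odot>\<^bsub>sections E V\<^esub> restr E U V m"
        if "m \<in> Sec E U" for k m
        using A.E.restr_smult[OF U V(1,3) regular_const[OF U] that] k by simp
      then show ?thesis
        using A.E.restr_add[OF U V(1,3) EU.smult_closed[OF const[OF U] A.c_closed[OF U S]] EU.smult_closed[OF const[OF U] B.c_closed[OF U S]]]
          A.c_closed[OF U S] B.c_closed[OF U S] A.c_restrict[OF U V(1,3) S] B.c_restrict[OF U V(1,3) S] by simp
    qed
    ultimately show "\<exists>V\<in>opens X. x \<in> V \<and> V \<subseteq> U \<and> restr E U V (c2 U S) = restr E U V (?r U S)"
      using V C.c_restrict[OF U V(1,3) S] by (intro bexI[of _ V]) simp_all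
  qed
qed

section \<open>Non-simplicity of a pair with a nonzero field\<close>

theorem proposition4p14:
  fixes X D :: "'n::finite pt set"
    and g s :: nat and r :: "nat \<Rightarrow> nat" and d :: "nat \<Rightarrow> int"
    and E :: "('n pt, 'm) presheaf"
    and \<Phi> :: "'n pt set \<Rightarrow> 'm \<Rightarrow> ('n, 'm, 'n log_vector_field) tensor_section"
  assumes "smooth_projective_curve X"
    and "has_genus X g" and "2 \<le> g"
    and "finite D" and "D \<subseteq> X"
    and "E \<in> HN_bundles X s r d"
    and "\<Phi> \<in> cohiggs_fields X D E"
    and "\<Phi> \<noteq> zero_hom X E (tensor_sheaf X E (log_tangent_sheaf X D))"
  shows "\<not> simple_pair X D E \<Phi>"
proof
  assume simple: "simple_pair X D E \<Phi>"
  from \<open>E \<in> HN_bundles X s r d\<close> obtain k where vb: "vector_bundle X k E"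
    by (auto simp: HN_bundles_def)
  then interpret E: sheaf_mod X E by unfold_locales (simp add: vector_bundle_def)
  interpret smooth_pair X D
    by (intro smooth_pair.intro irreducible_variety.intro smooth_pair_axioms.intro)
      (use assms E.cring in \<open>simp_all add: smooth_projective_curve_def\<close>)
  let ?K = "canonical_sheaf X"
  interpret KX: module "regular_ring X X" "sections ?K X"
    unfolding canonical_sheaf_def by (rule module_dual_sheaf[OF presheaf_tangent_sheaf X_open])
  from \<open>has_genus X g\<close> obtain b where b: "\<forall>i<g. b i \<in> Sec ?K X"
    and basis: "\<forall>m\<in>Sec ?K X. \<exists>!a. a \<in> {..<g} \<rightarrow>\<^sub>E (UNIV :: complex set) \<and>
       m = (\<Oplus>\<^bsub>sections ?K X\<^esub>i\<in>{..<g}. (\<lambda>x\<in>X. a i) \<odot>\<^bsub>sections ?K X\<^esub> b i)"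
    unfolding has_genus_def h0_def by (elim exE conjE)
  note b = b[rule_format]
  have b01: "b 0 \<in> Sec ?K X" "b 1 \<in> Sec ?K X" using b \<open>2 \<le> g\<close> by auto
  have const: "(\<lambda>x\<in>U. z) \<in> carrier (regular_ring X U)" if "U \<in> opens X" for U and z :: complex
    using regular_const[OF that] by simp
  \<comment> \<open>A plane of differentials is enough: the scalar attached to a contraction depends
    linearly on the differential, so its vanishing is one linear condition on \<open>(p, q)\<close>.
    The bound on the genus supplies the two basis elements.\<close>
  define comb where "comb p q = (\<lambda>x\<in>X. p) \<odot>\<^bsub>sections ?K X\<^esub> b 0 \<oplus>\<^bsub>sections ?K X\<^esub> (\<lambda>x\<in>X. q) \<odot>\<^bsub>sections ?K X\<^esub> b 1"
    for p q :: complex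
  have comb: "comb p q \<in> Sec ?K X" for p q using const[OF X_open] b01 by (simp add: comb_def)
  have independent: "p = 0 \<and> q = 0" if "comb p q = \<zero>\<^bsub>sections ?K X\<^esub>" for p q
  proof -
    \<comment> \<open>The coefficients of \<open>comb p q\<close> in the full basis, padded by
      zeros. Comparison with the zero family uses the uniqueness of coordinates of the zero
      differential.\<close>
    let ?a = "\<lambda>i\<in>{..<g}. if i = 0 then p else if i = 1 then q else 0" and ?z = "\<lambda>i\<in>{..<g}. 0 :: complex"
    let ?f = "\<lambda>i. (\<lambda>x\<in>X. ?a i) \<odot>\<^bsub>sections ?K X\<^esub> b i"
    have zero: "(\<lambda>x\<in>X. 0) \<odot>\<^bsub>sections ?K X\<^esub> b i = \<zero>\<^bsub>sections ?K X\<^esub>" if "i < g" for i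
      using KX.smult_l_null[OF b[OF that]] by (simp add: regular_ring_def)
    have "(\<Oplus>\<^bsub>sections ?K X\<^esub>i\<in>{..<g}. ?f i) = (\<Oplus>\<^bsub>sections ?K X\<^esub>i\<in>{0,1}. ?f i)"
      by (rule KX.M.add.finprod_mono_neutral_cong_right)
        (use \<open>2 \<le> g\<close> const[OF X_open] b zero in \<open>auto simp del: carrier_regular_ring\<close>)
    also have "\<dots> = comb p q"
    proof -
      have "?f 0 = (\<lambda>x\<in>X. p) \<odot>\<^bsub>sections ?K X\<^esub> b 0" "?f 1 = (\<lambda>x\<in>X. q) \<odot>\<^bsub>sections ?K X\<^esub> b 1"
        using \<open>2 \<le> g\<close> by simp_all
      moreover have "?f 0 \<in> Sec ?K X" "?f 1 \<in> Sec ?K X"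
        using KX.smult_closed[OF const[OF X_open] b01(1)] KX.smult_closed[OF const[OF X_open] b01(2)] by blast+
      ultimately show ?thesis
        using KX.M.finsum_insert[of "{1}" 0 ?f] KX.M.finsum_insert[of "{}" 1 ?f] by (simp add: comb_def)
    qed
    finally have 1: "\<zero>\<^bsub>sections ?K X\<^esub> = (\<Oplus>\<^bsub>sections ?K X\<^esub>i\<in>{..<g}. ?f i)" using that by simp
    have "(\<Oplus>\<^bsub>sections ?K X\<^esub>i\<in>{..<g}. (\<lambda>x\<in>X. ?z i) \<odot>\<^bsub>sections ?K X\<^esub> b i) =
        (\<Oplus>\<^bsub>sections ?K X\<^esub>i\<in>{..<g}. \<zero>\<^bsub>sections ?K X\<^esub>)"
      by (rule KX.M.finsum_cong') (use zero in auto)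
    then have 2: "\<zero>\<^bsub>sections ?K X\<^esub> = (\<Oplus>\<^bsub>sections ?K X\<^esub>i\<in>{..<g}. (\<lambda>x\<in>X. ?z i) \<odot>\<^bsub>sections ?K X\<^esub> b i)" by simp
    have "?a \<in> {..<g} \<rightarrow>\<^sub>E UNIV" "?z \<in> {..<g} \<rightarrow>\<^sub>E UNIV" by auto
    with 1 2 bspec[OF basis KX.zero_closed] have eq: "?a = ?z" by blast
    show ?thesis using fun_cong[OF eq, of 0] fun_cong[OF eq, of 1] \<open>2 \<le> g\<close> by simp
  qed
  have contraction_exists: "\<exists>lam c. bundle_contraction X D v lam E c" if "v \<in> Sec ?K X" for v
  proof -
    interpret contraction X D v by unfold_locales fact
    obtain lam where "contracts lam" using contracts_exists by blast
    then interpret contraction_form X D v lam by unfold_locales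
    interpret contraction_bundle X D v lam E by unfold_locales
    obtain c where "bundle_contracts c" using bundle_contracts_exists by blast
    then have "bundle_contraction X D v lam E c" by unfold_locales
    then show ?thesis by blast
  qed
  have \<Phi>m: "presheaf_mor X E (tensor_sheaf X E LX) \<Phi>"
    using \<open>\<Phi> \<in> cohiggs_fields X D E\<close> unfolding cohiggs_fields_def by (rule sheaf_homs_presheaf_mor)
  \<comment> \<open>Simplicity enters as surjectivity of \<open>scalar_hom\<close> onto the
    endomorphisms of the pair, among which the contracted field lies by
    \<open>contracted_field_End\<close>.\<close>
  have scalar: "\<exists>a. \<forall>U\<in>opens X. \<forall>m\<in>Sec E U. c U (\<Phi> U m) = (\<lambda>x\<in>U. a) \<odot>\<^bsub>sections E U\<^esub> m"
    if "bundle_contraction X D v lam E c" for v lam c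
  proof -
    interpret bundle_contraction X D v lam E c by fact
    have "ext_mor X E (\<lambda>U m. c U (\<Phi> U m)) \<in> range (scalar_hom X E)"
      using contracted_field_End[OF \<open>\<Phi> \<in> cohiggs_fields X D E\<close>] simple
      by (simp add: simple_pair_def bij_betw_def)
    then obtain a where a: "ext_mor X E (\<lambda>U m. c U (\<Phi> U m)) = scalar_hom X E a" by blast
    have "c U (\<Phi> U m) = (\<lambda>x\<in>U. a) \<odot>\<^bsub>sections E U\<^esub> m" if "U \<in> opens X" "m \<in> Sec E U" for U m
      using fun_cong[OF fun_cong[OF a, of U], of m] that by (simp add: scalar_hom_def)
    then show ?thesis by blast
  qed
  obtain lam0 c0 where c0: "bundle_contraction X D (b 0) lam0 E c0" using contraction_exists b01 by blast
  obtain lam1 c1 where c1: "bundle_contraction X D (b 1) lam1 E c1" using contraction_exists b01 by blast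
  obtain a0 where a0: "\<And>U m. \<lbrakk>U \<in> opens X; m \<in> Sec E U\<rbrakk> \<Longrightarrow> c0 U (\<Phi> U m) = (\<lambda>x\<in>U. a0) \<odot>\<^bsub>sections E U\<^esub> m"
    using scalar[OF c0] by blast
  obtain a1 where a1: "\<And>U m. \<lbrakk>U \<in> opens X; m \<in> Sec E U\<rbrakk> \<Longrightarrow> c1 U (\<Phi> U m) = (\<lambda>x\<in>U. a1) \<odot>\<^bsub>sections E U\<^esub> m"
    using scalar[OF c1] by blast
  \<comment> \<open>A nonzero vector in the kernel of the linear form with coefficients
    \<open>a0\<close> and \<open>a1\<close>. In the second case (-a1, a0) is nonzero because of its
    last entry.\<close>
  obtain p q :: complex where pq: "p * a0 + q * a1 = 0" "\<not> (p = 0 \<and> q = 0)"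
  proof (cases "a0 = 0")
    case True
    then show thesis using that[of 1 0] by simp
  next
    case False
    then show thesis using that[of "- a1" a0] by simp
  qed
  obtain lam c where c_pq: "bundle_contraction X D (comb p q) lam E c" using contraction_exists comb by blast
  interpret bundle_contraction X D "comb p q" lam E c by fact
  have nz: "comb p q \<noteq> \<zero>\<^bsub>sections ?K X\<^esub>" using independent pq(2) by blast
  have comb_apply: "comb p q U \<delta> x = p * b 0 U \<delta> x + q * b 1 U \<delta> x"
    if "U \<in> opens X" "\<delta> \<in> derivations X U" "x \<in> U" for U \<delta> x
  proof -
    have x: "x \<in> X" "U \<subseteq> X" using opens_subset that by blast+
    note app = operator_sheaf_apply[of U X X \<delta> "Sec TX" x, OF that(1) x(2) _ that(3)]
    show ?thesis
      unfolding comb_def canonical_sheaf_def dual_sheaf_def using app that x by simp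
  qed
  \<comment> \<open>By linearity in the differential, contracting \<Phi> with
    \<open>comb p q\<close> multiplies by p a0 + q a1 = 0, and a nonzero differential contracts
    injectively.\<close>
  have zero: "\<Phi> U m = \<zero>\<^bsub>sections EL U\<^esub>" if U: "U \<in> opens X" and m: "m \<in> Sec E U" for U m
  proof (rule c_injective[OF nz vb U presheaf_morD(1)[OF \<Phi>m U m]])
    interpret EU: module "regular_ring X U" "sections E U" by (rule E.module[OF U])
    have "c U (\<Phi> U m) = (\<lambda>x\<in>U. p) \<odot>\<^bsub>sections E U\<^esub> ((\<lambda>x\<in>U. a0) \<odot>\<^bsub>sections E U\<^esub> m) \<oplus>\<^bsub>sections E U\<^esub>
        (\<lambda>x\<in>U. q) \<odot>\<^bsub>sections E U\<^esub> ((\<lambda>x\<in>U. a1) \<odot>\<^bsub>sections E U\<^esub> m)"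
      using contraction_linear_combination[OF c0 c1 c_pq comb_apply U presheaf_morD(1)[OF \<Phi>m U m]]
        a0[OF U m] a1[OF U m] by simp
    also have "\<dots> = ((\<lambda>x\<in>U. p) \<otimes>\<^bsub>regular_ring X U\<^esub> (\<lambda>x\<in>U. a0) \<oplus>\<^bsub>regular_ring X U\<^esub>
        (\<lambda>x\<in>U. q) \<otimes>\<^bsub>regular_ring X U\<^esub> (\<lambda>x\<in>U. a1)) \<odot>\<^bsub>sections E U\<^esub> m"
      using const[OF U] m by (simp add: EU.smult_l_distr EU.smult_assoc1 del: carrier_regular_ring restrict_apply)
    also have "(\<lambda>x\<in>U. p) \<otimes>\<^bsub>regular_ring X U\<^esub> (\<lambda>x\<in>U. a0) \<oplus>\<^bsub>regular_ring X U\<^esub>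
        (\<lambda>x\<in>U. q) \<otimes>\<^bsub>regular_ring X U\<^esub> (\<lambda>x\<in>U. a1) = \<zero>\<^bsub>regular_ring X U\<^esub>"
      using pq(1) by (auto simp: regular_ring_def restrict_def fun_eq_iff)
    finally show "c U (\<Phi> U m) = \<zero>\<^bsub>sections E U\<^esub>" using m by simp
  qed
  have "\<Phi> = zero_hom X E EL"
  proof
    fix U
    \<comment> \<open>Equality with \<open>zero_hom\<close> also concerns arguments that are not
      open sets or not sections. There both sides are \<open>undefined\<close>, as elements of
      \<open>sheaf_homs\<close> are extensional.\<close>
    have \<Phi>P: "\<Phi> \<in> (\<Pi>\<^sub>E V\<in>{V \<in> opens X. V \<subseteq> X}. Sec E V \<rightarrow>\<^sub>E Sec EL V)"
      using \<open>\<Phi> \<in> cohiggs_fields X D E\<close> unfolding cohiggs_fields_def sheaf_homs_def by (elim CollectE conjE)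
    show "\<Phi> U = zero_hom X E EL U"
    proof (cases "U \<in> opens X")
      case True
      then have "U \<in> {V \<in> opens X. V \<subseteq> X}" using opens_subset by blast
      then have "\<Phi> U \<in> Sec E U \<rightarrow>\<^sub>E Sec EL U" using \<Phi>P by (auto simp: PiE_iff)
      then have "\<Phi> U m = (\<lambda>m\<in>Sec E U. \<zero>\<^bsub>sections EL U\<^esub>) m" for m
        using zero[OF True] by (cases "m \<in> Sec E U") (auto simp: PiE_iff extensional_def)
      then show ?thesis using True by (auto simp: zero_hom_def)
    next
      case False
      then have "\<Phi> U = undefined" using \<Phi>P by (auto simp: PiE_iff extensional_def)
      then show ?thesis using False by (simp add: zero_hom_def)
    qed
  qed
  with \<open>\<Phi> \<noteq> zero_hom X E (tensor_sheaf X E (log_tangent_sheaf X D))\<close> show False by blast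
qed

end
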